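(* Let $n\ge 1$, let $\rho_1,\dots,\rho_n\in(0,+\infty)$, let $I=\prod_{i=1}^n[0,\rho_i]$, and let $\Omega$, $L_i$, $B_i$, $\zeta_i$, $K_i$, $\gamma_i$, $\mu_i$, $P_I$ and the parameters $\lambda_i,\eta_i\ge 0$ ($i=1,\dots,n$) be as described in the context. Assume that the following conditions hold. (a) For every $i=1,\dots,n$, $w_i:P_I\to\mathbb{R}$ is continuous, and $$-\infty<\underline{w}_i:=\inf_{u\in P_I}w_i[u],\qquad \overline{w}_i:=\sup_{u\in P_I}w_i[u]<+\infty .$$ (b) For every $i=1,\dots,n$, $f_i\in C(\overline{\Omega}\times I\times[\underline{w}_i,\overline{w}_i])$ is real-valued and $f_i\ge 0$. Set $$M_i:=\max_{(x,u,w)\in\overline{\Omega}\times I\times[\underline{w}_i,\overline{w}_i]}f_i(x,u,w).$$ (c) There exist $\delta\in(0,+\infty)$, $i_0\in\{1,\dots,n\}$ and $\rho_0\in(0,\min_{i=1,\dots,n}\rho_i)$ such that $$f_{i_0}(x,u,w)\ge\delta u_{i_0}\quad\text{for every }(x,u,w)\in\overline{\Omega}\times I_0\times[\underline{w}_{i_0}^0,\overline{w}_{i_0}^0],$$ where $I_0:=\prod_{i=1}^n[0,\rho_0]$, $\underline{w}_{i_0}^0:=\inf_{u\in P_{I_0}}w_{i_0}[u]$ and $\overline{w}_{i_0}^0:=\sup_{u\in P_{I_0}}w_{i_0}[u]$. (d) For every $i=1,\dots,n$, $\zeta_i\in C^{2-\delta_i+\hat\mu}(\partial\Omega)$, $\zeta_i\ge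 0$, and $h_i:P_I\to[0,+\infty)$ is continuous and bounded. Set $$\overline{h}_i:=\sup_{u\in\partial P_I}h_i[u],$$ where $\partial P_I$ is the boundary of $P_I$ relative to the cone $P=C(\overline\Omega,\mathbb{R}^n_+)$. (e) The inequality $$\frac{\mu_{i_0}}{\delta}\le\lambda_{i_0}$$ holds and, for every $i=1,\dots,n$, $$\lambda_iM_i\|K_i(\hat 1)\|_\infty+\eta_i\overline{h}_i\|\gamma_i\|_\infty\le\rho_i .$$ Then the system $$\begin{cases}L_iu_i=\lambda_if_i(x,u,w_i[u]), & x\in\Omega,\ i=1,\dots,n,\\ B_iu_i=\eta_i\zeta_i(x)h_i[u], & x\in\partial\Omega,\ i=1,\dots,n,\end{cases}$$ has a nonzero positive weak solution $u=(u_1,\dots,u_n)$ such that $\rho_0\le\|u\|$ and $\|u_i\|_\infty\le\rho_i$ for every $i=1,\dots,n$.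
   Context: Domain. $\Omega\subset\mathbb{R}^m$, $m\ge 2$, is a bounded domain (open, connected) whose boundary $\partial\Omega$ is an $(m-1)$-dimensional $C^{2+\hat\mu}$-manifold for some $\hat\mu\in(0,1)$, with $\Omega$ lying locally on one side of $\partial\Omega$. $C^{\hat\mu}(\overline\Omega)$ is the space of $\hat\mu$-Hölder continuous real functions on $\overline\Omega$, and $C^{k+\hat\mu}(\overline\Omega)$ is the space of $g\in C^k(\overline\Omega)$ all of whose partial derivatives of order $k$ are $\hat\mu$-Hölder continuous on $\overline\Omega$. Differential operators. For $i=1,\dots,n$, $$L_iu(x)=-\sum_{j,l=1}^m a_{ijl}(x)\frac{\partial^2u}{\partial x_j\partial x_l}(x)+\sum_{j=1}^m a_{ij}(x)\frac{\partial u}{\partial x_j}(x)+a_i(x)u(x),\quad x\in\Omega,$$ where $a_{ijl},a_{ij},a_i\in C^{\hat\mu}(\overline\Omega)$, $a_i\ge 0$ on $\overline\Omega$, $a_{ijl}=a_{ilj}$ on $\overline\Omega$, and there is $\bar\mu_{i0}>0$ with $\sum_{j,l=1}^m a_{ijl}(x)\xi_j\xi_l\ge\bar\mu_{i0}\|\xi\|^2$ for all $x\in\Omega$, $\xi\in\mathbb{R}^m$. Boundary operators. For $i=1,\dots,n$, $B_iu(x)=b_i(x)u(x)+\delta_i\frac{\partial u}{\partial\nu}(x)$ for $x\in\partial\Omega$, where $\nu$ is an outward pointing, nowhere tangent vector field on $\partial\Omega$ of class $C^{1+\hat\mu}$ (not necessarily unit), $\frac{\partial u}{\partial\nu}$ is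 the directional derivative of $u$ with respect to $\nu$, $b_i:\partial\Omega\to\mathbb{R}$ is of class $C^{1+\hat\mu}$, and one of the following holds: $\delta_i=0$ and $b_i\equiv 1$ (Dirichlet); or $\delta_i=1$, $b_i\equiv 0$ and $a_i\not\equiv 0$ (Neumann); or $\delta_i=1$, $b_i\ge 0$ and $b_i\not\equiv 0$ (regular oblique derivative). Also $\zeta_i\in C^{2-\delta_i+\hat\mu}(\partial\Omega)$. Solution operators (known facts fixing notation). For $g\in C^{\hat\mu}(\overline\Omega)$ the problem $L_iu=g$ in $\Omega$, $B_iu=0$ on $\partial\Omega$ has a unique classical solution $u=:K_ig\in C^{2+\hat\mu}(\overline\Omega)$. The linear operator $K_i$ extends uniquely to a continuous, linear, compact operator $K_i:C(\overline\Omega)\to C(\overline\Omega)$, which maps nonnegative functions to nonnegative functions. Its spectral radius $r(K_i)$ lies in $(0,+\infty)$; set $\mu_i:=1/r(K_i)$; there is a nonnegative $\varphi_i\in C(\overline\Omega)$, $\varphi_i\not\equiv0$, with $\varphi_i=\mu_iK_i\varphi_i$. The function $\gamma_i\in C^{2+\hat\mu}(\overline\Omega)$ is the unique solution of $L_iu=0$ in $\Omega$, $B_iu=\zeta_i$ on $\partial\Omega$. The constant function equal to $1$ on $\overline\Omega$ is denoted $\hat 1$. Spaces and cones. $\|z\|_\infty=\max_{x\in\overline\Omega}|z(x)|$ for $z\in C(\overline\Omega)$, and $\|u\|=\max_{i=1,\dots,n}\|u_i\|_\infty$ for $u=(u_1,\dots,u_n)\in C(\overline\Omega,\mathbb{R}^n)$.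 $\mathbb{R}_+=[0,+\infty)$, $P=C(\overline\Omega,\mathbb{R}^n_+)$, and for $J=\prod_{i=1}^nJ_i\subset\mathbb{R}^n_+$ with each $J_i$ a nonempty closed interval, $P_J=\{u\in P:u(x)\in J\text{ for all }x\in\overline\Omega\}$. Weak solutions. The parameters $\lambda_i,\eta_i$ are nonnegative reals. A function $u\in P_I=C(\overline\Omega,I)$ is a weak solution of the system if $$u_i=\lambda_iK_iF_i(u)+\eta_i\,h_i[u]\,\gamma_i\quad\text{for all }i=1,\dots,n,\qquad F_i(u)(x):=f_i(x,u(x),w_i[u]).$$ It is a nonzero positive weak solution if moreover all components of $u$ are nonnegative and $u_j\not\equiv 0$ for some $j$. *)

theory Defs
  imports "HOL-Analysis.Analysis"
begin

section \<open>Hoelder classes\<close>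

definition holder_on :: "real \<Rightarrow> (real^'m) set \<Rightarrow> (real^'m \<Rightarrow> real) \<Rightarrow> bool" where
  "holder_on \<mu> S g \<longleftrightarrow> (\<exists>C\<ge>0. \<forall>x\<in>S. \<forall>y\<in>S. \<bar>g x - g y\<bar> \<le> C * norm (x - y) powr \<mu>)"

text \<open>
  \<open>holder_class k \<mu> D S u\<close>, for an open set \<open>D\<close> with \<open>D \<subseteq> S \<subseteq> closure D\<close>: \<open>u\<close> is \<open>k\<close> times
  continuously differentiable in \<open>D\<close>, its derivatives up to order \<open>k\<close> extend continuously to \<open>S\<close>,
  and those of order \<open>k\<close> are Hoelder continuous with exponent \<open>\<mu>\<close> on \<open>S\<close>. With
  \<open>S = closure D\<close> this is the usual class of order \<open>k + \<mu>\<close> up to the boundary; with \<open>S = D\<close>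
  it is the class on an open set. The function \<open>G\<close> is the gradient, extended to \<open>S\<close>.
\<close>
primrec holder_class ::
  "nat \<Rightarrow> real \<Rightarrow> (real^'m) set \<Rightarrow> (real^'m) set \<Rightarrow> (real^'m \<Rightarrow> real) \<Rightarrow> bool" where
  "holder_class 0 \<mu> D S u \<longleftrightarrow> holder_on \<mu> S u"
| "holder_class (Suc k) \<mu> D S u \<longleftrightarrow>
     continuous_on S u \<and>
     (\<exists>G :: real^'m \<Rightarrow> real^'m.
        (\<forall>x\<in>D. (u has_derivative (\<lambda>v. G x \<bullet> v)) (at x)) \<and>
        (\<forall>j. holder_class k \<mu> D S (\<lambda>x. G x $ j)))"

section \<open>Domains\<close>

text \<open>
  The last conjunct says that near each boundary point a diffeomorphism of class \<open>2 + \<mu>\<close> maps the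
  boundary to a coordinate hyperplane and the domain to one side of it: the boundary is a
  hypersurface of that class and the domain lies locally on one side of it.
\<close>
definition holder_domain :: "real \<Rightarrow> (real^'m) set \<Rightarrow> bool" where
  "holder_domain \<mu> \<Omega> \<longleftrightarrow>
     open \<Omega> \<and> connected \<Omega> \<and> \<Omega> \<noteq> {} \<and> bounded \<Omega> \<and>
     (\<forall>p\<in>frontier \<Omega>. \<exists>U (V :: (real^'m) set) \<Psi> \<Phi> k.
        open U \<and> p \<in> U \<and> open V \<and> homeomorphism U V \<Psi> \<Phi> \<and>
        (\<forall>j. holder_class 2 \<mu> U U (\<lambda>x. \<Psi> x $ j)) \<and>
        (\<forall>j. holder_class 2 \<mu> V V (\<lambda>y. \<Phi> y $ j)) \<and>
        (\<forall>x\<in>U. x \<in> \<Omega> \<longleftrightarrow> \<Psi> x $ k > 0) \<and>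
        (\<forall>x\<in>U. x \<in> frontier \<Omega> \<longleftrightarrow> \<Psi> x $ k = 0))"

text \<open>
  A function on the boundary is of class \<open>k + \<mu>\<close> if it is locally the restriction of a function of
  that class on an open subset of the ambient space. For a boundary of class \<open>2 + \<mu>\<close> and
  \<open>k \<le> 2\<close> this agrees with regularity in local charts.
\<close>
definition boundary_class :: "nat \<Rightarrow> real \<Rightarrow> (real^'m) set \<Rightarrow> (real^'m \<Rightarrow> real) \<Rightarrow> bool" where
  "boundary_class k \<mu> \<Omega> g \<longleftrightarrow>
     (\<forall>p\<in>frontier \<Omega>. \<exists>U G. open U \<and> p \<in> U \<and> holder_class k \<mu> U U G \<and>
        (\<forall>x\<in>U \<inter> frontier \<Omega>. G x = g x))"

text \<open>Velocities at \<open>x\<close> of curves lying in the set \<open>M\<close>.\<close>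
definition tangent_vectors :: "(real^'m) set \<Rightarrow> real^'m \<Rightarrow> (real^'m) set" where
  "tangent_vectors M x =
     {v. \<exists>c :: real \<Rightarrow> real^'m. c 0 = x \<and> eventually (\<lambda>t. c t \<in> M) (nhds 0) \<and>
           (c has_vector_derivative v) (at 0)}"

definition outward_field :: "real \<Rightarrow> (real^'m) set \<Rightarrow> (real^'m \<Rightarrow> real^'m) \<Rightarrow> bool" where
  "outward_field \<mu> \<Omega> \<nu> \<longleftrightarrow>
     (\<forall>j. boundary_class 1 \<mu> \<Omega> (\<lambda>x. \<nu> x $ j)) \<and>
     (\<forall>x\<in>frontier \<Omega>. \<nu> x \<notin> tangent_vectors (frontier \<Omega>) x \<and>
        eventually (\<lambda>t. x - t *\<^sub>R \<nu> x \<in> \<Omega> \<and> x + t *\<^sub>R \<nu> x \<notin> closure \<Omega>) (at_right 0))"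

section \<open>Differential and boundary operators\<close>

definition partial_deriv :: "'m \<Rightarrow> (real^'m \<Rightarrow> real) \<Rightarrow> real^'m \<Rightarrow> real" where
  "partial_deriv j u x = deriv (\<lambda>t. u (x + t *\<^sub>R axis j 1)) 0"

definition elliptic_op ::
  "('m \<Rightarrow> 'm \<Rightarrow> real^'m \<Rightarrow> real) \<Rightarrow> ('m \<Rightarrow> real^'m \<Rightarrow> real) \<Rightarrow> (real^'m \<Rightarrow> real) \<Rightarrow>
   (real^'m \<Rightarrow> real) \<Rightarrow> real^'m \<Rightarrow> real" where
  "elliptic_op a2 a1 a0 u x =
     - (\<Sum>j\<in>UNIV. \<Sum>l\<in>UNIV. a2 j l x * partial_deriv j (partial_deriv l u) x)
     + (\<Sum>j\<in>UNIV. a1 j x * partial_deriv j u x) + a0 x * u x"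

definition elliptic_coeffs ::
  "real \<Rightarrow> (real^'m) set \<Rightarrow> ('m \<Rightarrow> 'm \<Rightarrow> real^'m \<Rightarrow> real) \<Rightarrow> ('m \<Rightarrow> real^'m \<Rightarrow> real) \<Rightarrow>
   (real^'m \<Rightarrow> real) \<Rightarrow> bool" where
  "elliptic_coeffs \<mu> \<Omega> a2 a1 a0 \<longleftrightarrow>
     (\<forall>j l. holder_on \<mu> (closure \<Omega>) (a2 j l)) \<and>
     (\<forall>j. holder_on \<mu> (closure \<Omega>) (a1 j)) \<and>
     holder_on \<mu> (closure \<Omega>) a0 \<and>
     (\<forall>x\<in>closure \<Omega>. 0 \<le> a0 x) \<and>
     (\<forall>j l. \<forall>x\<in>closure \<Omega>. a2 j l x = a2 l j x) \<and>
     (\<exists>\<mu>0>0. \<forall>x\<in>\<Omega>. \<forall>\<xi> :: real^'m.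
        (\<Sum>j\<in>UNIV. \<Sum>l\<in>UNIV. a2 j l x * \<xi> $ j * \<xi> $ l) \<ge> \<mu>0 * (norm \<xi>)\<^sup>2)"

text \<open>
  Directional derivative at a boundary point along a field pointing outward; it is one-sided
  because the function is only given on the closure of the domain.
\<close>
definition outward_deriv :: "(real^'m \<Rightarrow> real^'m) \<Rightarrow> (real^'m \<Rightarrow> real) \<Rightarrow> real^'m \<Rightarrow> real" where
  "outward_deriv \<nu> u x = Lim (at_right 0) (\<lambda>t. (u x - u (x - t *\<^sub>R \<nu> x)) / t)"

definition boundary_op ::
  "(real^'m \<Rightarrow> real^'m) \<Rightarrow> (real^'m \<Rightarrow> real) \<Rightarrow> nat \<Rightarrow> (real^'m \<Rightarrow> real) \<Rightarrow> real^'m \<Rightarrow> real" where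
  "boundary_op \<nu> b d u x = b x * u x + real d * outward_deriv \<nu> u x"

text \<open>The three cases: Dirichlet, Neumann, regular oblique derivative.\<close>
definition boundary_coeffs ::
  "real \<Rightarrow> (real^'m) set \<Rightarrow> (real^'m \<Rightarrow> real) \<Rightarrow> (real^'m \<Rightarrow> real) \<Rightarrow> nat \<Rightarrow> bool" where
  "boundary_coeffs \<mu> \<Omega> a0 b d \<longleftrightarrow>
     boundary_class 1 \<mu> \<Omega> b \<and>
     (d = 0 \<and> (\<forall>x\<in>frontier \<Omega>. b x = 1) \<or>
      d = 1 \<and> (\<forall>x\<in>frontier \<Omega>. b x = 0) \<and> (\<exists>x\<in>closure \<Omega>. a0 x \<noteq> 0) \<or>
      d = 1 \<and> (\<forall>x\<in>frontier \<Omega>. 0 \<le> b x) \<and> (\<exists>x\<in>frontier \<Omega>. b x \<noteq> 0))"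

section \<open>Spaces of continuous functions\<close>

text \<open>
  The continuous functions on the closure with the supremum metric. Elements of its carrier are
  extensional, that is, \<open>undefined\<close> outside the closure, so that equal functions on the closure
  are equal. On vector functions the supremum metric comes from the Euclidean norm of the values;
  its topology is the one given by \<open>vec_sup_norm\<close> below.
\<close>
definition C_metric :: "(real^'m) set \<Rightarrow> (real^'m \<Rightarrow> 'b::metric_space) metric" where
  "C_metric \<Omega> = cfunspace (top_of_set (closure \<Omega>)) euclidean_metric"

abbreviation C_space :: "(real^'m) set \<Rightarrow> (real^'m \<Rightarrow> 'b::metric_space) set" where
  "C_space \<Omega> \<equiv> mspace (C_metric \<Omega>)"

abbreviation C_top :: "(real^'m) set \<Rightarrow> (real^'m \<Rightarrow> 'b::metric_space) topology" where
  "C_top \<Omega> \<equiv> mtopology_of (C_metric \<Omega>)"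

definition sup_norm :: "(real^'m) set \<Rightarrow> (real^'m \<Rightarrow> real) \<Rightarrow> real" where
  "sup_norm \<Omega> z = (SUP x\<in>closure \<Omega>. \<bar>z x\<bar>)"

definition vec_sup_norm :: "(real^'m) set \<Rightarrow> (real^'m \<Rightarrow> real^'n) \<Rightarrow> real" where
  "vec_sup_norm \<Omega> u = Max (range (\<lambda>i. sup_norm \<Omega> (\<lambda>x. u x $ i)))"

definition P_set :: "(real^'m) set \<Rightarrow> (real^'n) set \<Rightarrow> (real^'m \<Rightarrow> real^'n) set" where
  "P_set \<Omega> J = {u \<in> C_space \<Omega>. \<forall>x\<in>closure \<Omega>. u x \<in> J}"

definition P_cone :: "(real^'m) set \<Rightarrow> (real^'m \<Rightarrow> real^'n) set" where
  "P_cone \<Omega> = P_set \<Omega> {v. \<forall>i. 0 \<le> v $ i}"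

definition P_boundary :: "(real^'m) set \<Rightarrow> (real^'n) set \<Rightarrow> (real^'m \<Rightarrow> real^'n) set" where
  "P_boundary \<Omega> J = subtopology (C_top \<Omega>) (P_cone \<Omega>) frontier_of (P_set \<Omega> J)"

definition continuous_functional ::
  "(real^'m) set \<Rightarrow> (real^'n) set \<Rightarrow> ((real^'m \<Rightarrow> real^'n) \<Rightarrow> real) \<Rightarrow> bool" where
  "continuous_functional \<Omega> J w \<longleftrightarrow>
     continuous_map (subtopology (C_top \<Omega>) (P_set \<Omega> J)) euclideanreal w"

section \<open>Operators on continuous functions\<close>

definition continuous_linear_operator ::
  "(real^'m) set \<Rightarrow> ((real^'m \<Rightarrow> real) \<Rightarrow> real^'m \<Rightarrow> real) \<Rightarrow> bool" where
  "continuous_linear_operator \<Omega> K \<longleftrightarrow>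
     continuous_map (C_top \<Omega>) (C_top \<Omega>) K \<and>
     (\<forall>g\<in>C_space \<Omega>. \<forall>g'\<in>C_space \<Omega>. \<forall>x\<in>closure \<Omega>.
        K (\<lambda>y\<in>closure \<Omega>. g y + g' y) x = K g x + K g' x) \<and>
     (\<forall>c. \<forall>g\<in>C_space \<Omega>. \<forall>x\<in>closure \<Omega>. K (\<lambda>y\<in>closure \<Omega>. c * g y) x = c * K g x)"

definition compact_operator ::
  "(real^'m) set \<Rightarrow> ((real^'m \<Rightarrow> real) \<Rightarrow> real^'m \<Rightarrow> real) \<Rightarrow> bool" where
  "compact_operator \<Omega> K \<longleftrightarrow>
     (\<forall>B \<subseteq> C_space \<Omega>. (\<exists>c. \<forall>g\<in>B. sup_norm \<Omega> g \<le> c) \<longrightarrow>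
        compactin (C_top \<Omega>) (C_top \<Omega> closure_of (K ` B)))"

definition positive_operator ::
  "(real^'m) set \<Rightarrow> ((real^'m \<Rightarrow> real) \<Rightarrow> real^'m \<Rightarrow> real) \<Rightarrow> bool" where
  "positive_operator \<Omega> K \<longleftrightarrow>
     (\<forall>g\<in>C_space \<Omega>. (\<forall>x\<in>closure \<Omega>. 0 \<le> g x) \<longrightarrow> (\<forall>x\<in>closure \<Omega>. 0 \<le> K g x))"

text \<open>
  The spectrum of a real operator is that of its complexification. For a continuous operator on
  this Banach space the inverse of a bijective \<open>z - K\<close> is automatically continuous, so
  bijectivity is all that has to be asked.
\<close>
definition complexification ::
  "(real^'m) set \<Rightarrow> ((real^'m \<Rightarrow> real) \<Rightarrow> real^'m \<Rightarrow> real) \<Rightarrow>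
   (real^'m \<Rightarrow> complex) \<Rightarrow> real^'m \<Rightarrow> complex" where
  "complexification \<Omega> K f =
     (\<lambda>x\<in>closure \<Omega>. Complex (K (\<lambda>y\<in>closure \<Omega>. Re (f y)) x) (K (\<lambda>y\<in>closure \<Omega>. Im (f y)) x))"

definition operator_spectrum ::
  "(real^'m) set \<Rightarrow> ((real^'m \<Rightarrow> real) \<Rightarrow> real^'m \<Rightarrow> real) \<Rightarrow> complex set" where
  "operator_spectrum \<Omega> K =
     {z. \<not> bij_betw (\<lambda>f. \<lambda>x\<in>closure \<Omega>. z * f x - complexification \<Omega> K f x)
            (C_space \<Omega>) (C_space \<Omega>)}"

definition operator_radius ::
  "(real^'m) set \<Rightarrow> ((real^'m \<Rightarrow> real) \<Rightarrow> real^'m \<Rightarrow> real) \<Rightarrow> real" where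
  "operator_radius \<Omega> K = (SUP z\<in>operator_spectrum \<Omega> K. cmod z)"

definition principal_value ::
  "(real^'m) set \<Rightarrow> ((real^'m \<Rightarrow> real) \<Rightarrow> real^'m \<Rightarrow> real) \<Rightarrow> real" where
  "principal_value \<Omega> K = 1 / operator_radius \<Omega> K"

section \<open>Solutions\<close>

definition classical_solution ::
  "real \<Rightarrow> (real^'m) set \<Rightarrow> ((real^'m \<Rightarrow> real) \<Rightarrow> real^'m \<Rightarrow> real) \<Rightarrow>
   ((real^'m \<Rightarrow> real) \<Rightarrow> real^'m \<Rightarrow> real) \<Rightarrow> (real^'m \<Rightarrow> real) \<Rightarrow> (real^'m \<Rightarrow> real) \<Rightarrow>
   (real^'m \<Rightarrow> real) \<Rightarrow> bool" where
  "classical_solution \<mu> \<Omega> L B g \<zeta> u \<longleftrightarrow>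
     u \<in> C_space \<Omega> \<and> holder_class 2 \<mu> \<Omega> (closure \<Omega>) u \<and>
     (\<forall>x\<in>\<Omega>. L u x = g x) \<and> (\<forall>x\<in>frontier \<Omega>. B u x = \<zeta> x)"

definition unique_classical_solution ::
  "real \<Rightarrow> (real^'m) set \<Rightarrow> ((real^'m \<Rightarrow> real) \<Rightarrow> real^'m \<Rightarrow> real) \<Rightarrow>
   ((real^'m \<Rightarrow> real) \<Rightarrow> real^'m \<Rightarrow> real) \<Rightarrow> (real^'m \<Rightarrow> real) \<Rightarrow> (real^'m \<Rightarrow> real) \<Rightarrow>
   (real^'m \<Rightarrow> real) \<Rightarrow> bool" where
  "unique_classical_solution \<mu> \<Omega> L B g \<zeta> u \<longleftrightarrow>
     classical_solution \<mu> \<Omega> L B g \<zeta> u \<and>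
     (\<forall>v. classical_solution \<mu> \<Omega> L B g \<zeta> v \<longrightarrow> v = u)"

text \<open>
  The continuous linear extension, to all continuous functions on the closure, of the map that
  sends a Hoelder continuous \<open>g\<close> to the solution of \<open>L u = g\<close>, \<open>B u = 0\<close>. By density of the
  Hoelder functions at most one \<open>K\<close>, as a map on \<open>C_space \<Omega>\<close>, satisfies this.
\<close>
definition solution_operator ::
  "real \<Rightarrow> (real^'m) set \<Rightarrow> ((real^'m \<Rightarrow> real) \<Rightarrow> real^'m \<Rightarrow> real) \<Rightarrow>
   ((real^'m \<Rightarrow> real) \<Rightarrow> real^'m \<Rightarrow> real) \<Rightarrow> ((real^'m \<Rightarrow> real) \<Rightarrow> real^'m \<Rightarrow> real) \<Rightarrow> bool" where
  "solution_operator \<mu> \<Omega> L B K \<longleftrightarrow>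
     continuous_linear_operator \<Omega> K \<and>
     (\<forall>g\<in>C_space \<Omega>. holder_on \<mu> (closure \<Omega>) g \<longrightarrow>
        unique_classical_solution \<mu> \<Omega> L B g (\<lambda>x. 0) (K g))"

definition superposition ::
  "(real^'m) set \<Rightarrow> ((real^'m) \<times> (real^'n) \<times> real \<Rightarrow> real) \<Rightarrow> ((real^'m \<Rightarrow> real^'n) \<Rightarrow> real) \<Rightarrow>
   (real^'m \<Rightarrow> real^'n) \<Rightarrow> real^'m \<Rightarrow> real" where
  "superposition \<Omega> f w u = (\<lambda>x\<in>closure \<Omega>. f (x, u x, w u))"

definition weak_solution ::
  "(real^'m) set \<Rightarrow> (real^'n) set \<Rightarrow> ('n \<Rightarrow> (real^'m \<Rightarrow> real) \<Rightarrow> real^'m \<Rightarrow> real) \<Rightarrow>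
   ('n \<Rightarrow> real^'m \<Rightarrow> real) \<Rightarrow> ('n \<Rightarrow> real) \<Rightarrow> ('n \<Rightarrow> real) \<Rightarrow>
   ('n \<Rightarrow> (real^'m) \<times> (real^'n) \<times> real \<Rightarrow> real) \<Rightarrow> ('n \<Rightarrow> (real^'m \<Rightarrow> real^'n) \<Rightarrow> real) \<Rightarrow>
   ('n \<Rightarrow> (real^'m \<Rightarrow> real^'n) \<Rightarrow> real) \<Rightarrow> (real^'m \<Rightarrow> real^'n) \<Rightarrow> bool" where
  "weak_solution \<Omega> I K \<gamma> lam eta f w h u \<longleftrightarrow>
     u \<in> P_set \<Omega> I \<and>
     (\<forall>i. \<forall>x\<in>closure \<Omega>.
        u x $ i = lam i * K i (superposition \<Omega> (f i) (w i) u) x + eta i * h i u * \<gamma> i x)"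

definition nonzero_positive :: "(real^'m) set \<Rightarrow> (real^'m \<Rightarrow> real^'n) \<Rightarrow> bool" where
  "nonzero_positive \<Omega> u \<longleftrightarrow>
     (\<forall>i. \<forall>x\<in>closure \<Omega>. 0 \<le> u x $ i) \<and> (\<exists>j. \<exists>x\<in>closure \<Omega>. u x $ j \<noteq> 0)"

end

theory Submission
  imports Defs "HOL-Probability.Discrete_Topology"
begin

text \<open>
  Let \<open>T\<close> be the right-hand side of the fixed point equation, \<open>\<phi>\<close> the positive eigenfunction of
  \<open>K i0\<close>, \<open>e\<close> the \<open>i0\<close>-th unit vector and \<open>s u = max 0 (\<rho>0 - \<parallel>u\<parallel>)\<close>. By Schauder's theorem the
  map \<open>S u = min (T u + s u \<phi> e) \<rho>\<close>, truncated componentwise, has a fixed point \<open>u\<close> in \<open>P_I\<close>. If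
  \<open>\<parallel>u\<parallel> < \<rho>0\<close>, the truncation is inactive, so \<open>u i0 \<ge> mu i0 K i0 (u i0) + s u \<phi>\<close> with \<open>s u > 0\<close>;
  iterating, \<open>u i0 \<ge> n s u \<phi>\<close> for all \<open>n\<close>, which is absurd. Hence \<open>\<parallel>u\<parallel> \<ge> \<rho>0\<close> and \<open>s u = 0\<close>. If the
  truncation were active somewhere, \<open>u\<close> would lie on the boundary of \<open>P_I\<close>, where hypothesis (e)
  keeps \<open>T u\<close> below \<open>\<rho>\<close>; so \<open>u = T u\<close>. This replaces the fixed point index and does not
  need \<open>T\<close> to map \<open>P_I\<close> into itself.

  That \<open>\<gamma> i \<ge> 0\<close> is a maximum principle: adding a small multiple of \<open>K i 1\<close> makes the equation
  strict, and Hopf's argument excludes a negative minimum on the boundary.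
\<close>

section \<open>Fixed points\<close>

text \<open>The zero function may itself solve the system, so a fixed point of the truncated
  \<open>T\<close> alone could be trivial. The term \<open>s u \<phi> e\<close> repels small
  functions and switches itself off at norm \<open>\<rho>0\<close>. The eigenfunction is the right
  forcing because (e) gives \<open>lam i0 * \<delta> \<ge> mu i0\<close> with equality allowed:
  \<open>T\<close> need not magnify \<open>\<phi>\<close>, but \<open>mu i0 K i0\<close> returns
  every multiple of \<open>\<phi>\<close> already gained, and the forcing adds one more. The box
  \<open>P_I\<close> is not compact, but its image under \<open>S\<close> is relatively compact:
  each \<open>K i\<close> is compact, and the other terms are finitely many bounded scalars times
  fixed functions. Schauder's theorem is reduced to Brouwer's in a dimension equal to the size of a
  finite net found inside the proof; this is why the cube lives in
  \<open>nat \<Rightarrow> real\<close> and its dimension is a term, not a type.\<close>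

lemma finite_common_subsequence:
  fixes Q :: "'i \<Rightarrow> (nat \<Rightarrow> nat) \<Rightarrow> bool"
  assumes "finite A"
    and ex: "\<And>i r. i \<in> A \<Longrightarrow> strict_mono r \<Longrightarrow> \<exists>s :: nat \<Rightarrow> nat. strict_mono s \<and> Q i (r \<circ> s)"
    and sub: "\<And>i r (s :: nat \<Rightarrow> nat). i \<in> A \<Longrightarrow> Q i r \<Longrightarrow> strict_mono s \<Longrightarrow> Q i (r \<circ> s)"
  shows "\<exists>r. strict_mono r \<and> (\<forall>i\<in>A. Q i r)"
  using assms
proof (induction A rule: finite_induct)
  case empty
  show ?case by (auto intro: strict_mono_id)
next
  case (insert a A)
  then obtain r where r: "strict_mono r" "\<forall>i\<in>A. Q i r" by auto
  obtain s where s: "strict_mono s" "Q a (r \<circ> s)"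
    using insert.prems(1)[OF insertI1 r(1)] by blast
  have "strict_mono (r \<circ> s)" using r s by (simp add: strict_mono_o)
  moreover have "\<forall>i\<in>insert a A. Q i (r \<circ> s)"
    using s r insert.prems(2) by (metis insertE insertI2)
  ultimately show ?case by blast
qed

section \<open>Brouwer's theorem on a cube, from Kuhn's combinatorial lemma\<close>

lemma tendsto_product_coordinates:
  fixes f :: "'i \<Rightarrow> 'a \<Rightarrow> 'b::topological_space"
  assumes "\<And>a. ((\<lambda>i. f i a) \<longlongrightarrow> l a) F"
  shows "(f \<longlongrightarrow> l) F"
  using assms
  by (simp flip: limitin_canonical_iff euclidean_product_topology add: limitin_componentwise)

text \<open>Grid points of mesh \<open>1 / Suc k\<close> are labelled in each coordinate by the
  direction in which \<open>f\<close> moves it. Kuhn's lemma yields a cell showing both labels in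
  every coordinate; as the mesh shrinks, such cells cluster at a point where neither strict
  inequality between \<open>f x i\<close> and \<open>x i\<close> can hold.\<close>

lemma brouwer_unit_cube_nat:
  fixes f :: "(nat \<Rightarrow> real) \<Rightarrow> nat \<Rightarrow> real"
  defines "Q \<equiv> {x. \<forall>i. x i \<in> {0..1}}"
  assumes cont: "\<And>i. i < n \<Longrightarrow> continuous_on Q (\<lambda>x. f x i)"
    and maps: "\<And>x i. x \<in> Q \<Longrightarrow> i < n \<Longrightarrow> f x i \<in> {0..1}"
  shows "\<exists>x\<in>Q. \<forall>i<n. f x i = x i"
proof -
  define pt where "pt k r = (\<lambda>i. if i < n then real (r i) / real (Suc k) else 0)" for k and r :: "nat \<Rightarrow> nat"
  \<comment> \<open>On the far face \<open>r i = Suc k\<close> the label must be 1 for Kuhn's lemma,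
    even if \<open>f\<close> fixes that coordinate. This is harmless: there
    \<open>pt k r i = 1\<close>, so \<open>f\<close> cannot exceed it.\<close>
  define label where
    "label k r i = (if r i < Suc k \<and> pt k r i \<le> f (pt k r) i then 0 else 1::nat)" for k r i
  have ptQ: "pt k r \<in> Q" if "\<forall>i<n. r i \<le> Suc k" for k r
    using that by (auto simp: Q_def pt_def divide_simps)
  have label1: "f (pt k r) i \<le> pt k r i" if "\<forall>i<n. r i \<le> Suc k" "i < n" "label k r i = 1" for k r i
  proof (cases "r i < Suc k")
    case True
    then show ?thesis using that by (auto simp: label_def split: if_splits)
  next
    case False
    then have "pt k r i = 1" using that le_antisym[of "r i" "Suc k"]
      by (auto simp: pt_def)
    then show ?thesis using maps[OF ptQ[OF that(1)] that(2)] by auto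
  qed
  have label0: "pt k r i \<le> f (pt k r) i" if "label k r i = 0" for k r i
    using that by (auto simp: label_def split: if_splits)
  \<comment> \<open>These are the vertices of the grid cell with lower corner
    \<open>q\<close>.\<close>
  define near where "near q c \<longleftrightarrow> (\<forall>j<n. q j \<le> c j \<and> c j \<le> q j + 1)" for q c :: "nat \<Rightarrow> nat"
  have "\<exists>q. (\<forall>i<n. q i < Suc k) \<and>
     (\<forall>i<n. \<exists>a b. near q a \<and> near q b \<and> label k a i = 0 \<and> label k b i = 1)" for k
  proof -
    have z: "label k x i = 0" if "\<forall>i<n. x i \<le> Suc k" "i < n" "x i = 0" for x i
      using that maps[OF ptQ[OF that(1)] that(2)] by (auto simp: label_def pt_def)
    obtain q where q: "\<forall>i<n. q i < Suc k"
      and *: "\<forall>i<n. \<exists>r s. (\<forall>j<n. q j \<le> r j \<and> r j \<le> q j + 1) \<and> (\<forall>j<n. q j \<le> s j \<and> s j \<le> q j + 1)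
             \<and> label k r i \<noteq> label k s i"
    proof (rule kuhn_lemma)
      show "0 < Suc k" by simp
      show "\<forall>x. (\<forall>i<n. x i \<le> Suc k) \<longrightarrow> (\<forall>i<n. x i = 0 \<longrightarrow> label k x i = 0)"
        by (intro allI impI) (rule z)
      show "\<forall>x. (\<forall>i<n. x i \<le> Suc k) \<longrightarrow> (\<forall>i<n. label k x i = 0 \<or> label k x i = 1)"
        by (simp add: label_def)
      show "\<forall>x. (\<forall>i<n. x i \<le> Suc k) \<longrightarrow> (\<forall>i<n. x i = Suc k \<longrightarrow> label k x i = 1)"
        by (simp add: label_def)
    qed (rule that)
    have "\<exists>a b. near q a \<and> near q b \<and> label k a i = 0 \<and> label k b i = 1" if i: "i < n" for i
    proof -
      obtain r s where rs: "near q r" "near q s" "label k r i \<noteq> label k s i"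
        using *[folded near_def, rule_format, OF i] by auto
      then show ?thesis
        by (cases "label k r i = 0") (auto simp: label_def split: if_splits)
    qed
    with q show ?thesis by blast
  qed
  then obtain q where q: "\<And>k. \<forall>i<n. q k i < Suc k"
    and cell: "\<And>k. \<forall>i<n. \<exists>a b. near (q k) a \<and> near (q k) b \<and> label k a i = 0 \<and> label k b i = 1"
    using choice[of "\<lambda>k q. (\<forall>i<n. q i < Suc k) \<and>
     (\<forall>i<n. \<exists>a b. near q a \<and> near q b \<and> label k a i = 0 \<and> label k b i = 1)"] by blast
  \<comment> \<open>The two vertices with opposite labels depend on the coordinate \<open>i\<close>;
    they share only the cell.\<close>
  define a where "a k i = (SOME a. near (q k) a \<and> label k a i = 0)" for k i
  define b where "b k i = (SOME b. near (q k) b \<and> label k b i = 1)" for k i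
  have near: "near (q k) (a k i)" "near (q k) (b k i)" and lab: "label k (a k i) i = 0" "label k (b k i) i = 1"
    if "i < n" for k i
    using someI_ex[of "\<lambda>a. near (q k) a \<and> label k a i = 0"] someI_ex[of "\<lambda>b. near (q k) b \<and> label k b i = 1"]
      cell that unfolding a_def b_def by blast+
  have near_le: "\<forall>i<n. c i \<le> Suc k" if "near (q k) c" for k c
  proof (intro allI impI)
    fix i assume "i < n"
    then have "c i \<le> q k i + 1" "q k i < Suc k" using that q[of k] by (simp_all add: near_def)
    then show "c i \<le> Suc k" by simp
  qed
  \<comment> \<open>It is enough that the lower corners converge along a subsequence: every vertex
    of a cell differs from its corner by at most the mesh, so all choices of vertices have the same
    limit.\<close>
  have "\<exists>r. strict_mono r \<and> (\<forall>i\<in>{..<n}. \<exists>l. (\<lambda>k. pt (r k) (q (r k)) i) \<longlonglongrightarrow> l)"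
  proof (rule finite_common_subsequence)
    fix i and r :: "nat \<Rightarrow> nat" assume "i \<in> {..<n}" "strict_mono r"
    have "pt k (q k) i \<in> {0..1}" for k using ptQ[of "q k" k] q[of k] by (auto simp: Q_def less_imp_le)
    then obtain l s where "strict_mono s" "((\<lambda>k. pt (r k) (q (r k)) i) \<circ> s) \<longlonglongrightarrow> l"
      using seq_compactE[OF compact_imp_seq_compact[OF compact_Icc[of 0 "1::real"]],
          of "\<lambda>k. pt (r k) (q (r k)) i"] by blast
    then show "\<exists>s. strict_mono s \<and> (\<exists>l. (\<lambda>k. pt ((r \<circ> s) k) (q ((r \<circ> s) k)) i) \<longlonglongrightarrow> l)"
      by (auto simp: o_def)
  next
    fix i and r s :: "nat \<Rightarrow> nat"
    assume "\<exists>l. (\<lambda>k. pt (r k) (q (r k)) i) \<longlonglongrightarrow> l" and s: "strict_mono s"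
    then obtain l where "(\<lambda>k. pt (r k) (q (r k)) i) \<longlonglongrightarrow> l" by blast
    from LIMSEQ_subseq_LIMSEQ[OF this s]
    show "\<exists>l. (\<lambda>k. pt ((r \<circ> s) k) (q ((r \<circ> s) k)) i) \<longlonglongrightarrow> l" by (auto simp: o_def)
  qed simp
  then obtain r where r: "strict_mono r" and conv: "\<forall>i\<in>{..<n}. \<exists>l. (\<lambda>k. pt (r k) (q (r k)) i) \<longlonglongrightarrow> l"
    by blast
  from bchoice[OF conv] obtain l where l: "\<And>i. i < n \<Longrightarrow> (\<lambda>k. pt (r k) (q (r k)) i) \<longlonglongrightarrow> l i"
    by auto
  define x where "x i = (if i < n then l i else 0)" for i
  have small: "(\<lambda>k. 1 / real (Suc (r k))) \<longlonglongrightarrow> 0"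
    using LIMSEQ_subseq_LIMSEQ[OF LIMSEQ_Suc[OF lim_1_over_n] r] by (simp add: o_def)
  have lim: "(\<lambda>k. pt (r k) (c k)) \<longlonglongrightarrow> x"
    if c: "\<And>k. near (q (r k)) (c k)" for c
  proof -
    have "(\<lambda>k. pt (r k) (c k) i) \<longlonglongrightarrow> x i" for i
    proof (cases "i < n")
      case True
      have *: "\<bar>pt (r k) (c k) i - pt (r k) (q (r k)) i\<bar> \<le> 1 / real (Suc (r k))" for k
        using c[of k] True unfolding near_def
        by (auto simp: pt_def diff_divide_distrib[symmetric] intro!: divide_right_mono)
      have "(\<lambda>k. pt (r k) (c k) i - pt (r k) (q (r k)) i) \<longlonglongrightarrow> 0"
        by (rule Lim_null_comparison[OF _ small]) (use * in auto)
      from tendsto_add[OF this l[OF True]] show ?thesis by (simp add: x_def True)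
    qed (simp add: pt_def x_def)
    then show ?thesis by (intro tendsto_product_coordinates)
  qed
  have xQ: "x \<in> Q"
  proof -
    have "0 \<le> l i \<and> l i \<le> 1" if "i < n" for i
    proof -
      have "pt (r k) (q (r k)) i \<in> {0..1}" for k using ptQ q by (auto simp: Q_def less_imp_le)
      then show ?thesis using closed_sequentially[OF closed_atLeastAtMost _ l[OF that]] by auto
    qed
    then show ?thesis by (auto simp: Q_def x_def)
  qed
  have "f x i = x i" if i: "i < n" for i
  proof (rule antisym)
    have inQ: "pt (r k) (a (r k) i) \<in> Q" "pt (r k) (b (r k) i) \<in> Q" for k
      using near[OF i] near_le by (auto intro!: ptQ)
    have A: "(\<lambda>k. pt (r k) (a (r k) i)) \<longlonglongrightarrow> x" by (rule lim) (use near[OF i] in auto)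
    have B: "(\<lambda>k. pt (r k) (b (r k) i)) \<longlonglongrightarrow> x" by (rule lim) (use near[OF i] in auto)
    have fA: "(\<lambda>k. f (pt (r k) (a (r k) i)) i) \<longlonglongrightarrow> f x i"
      using continuous_on_tendsto_compose[OF cont[OF i] A xQ] inQ by auto
    have fB: "(\<lambda>k. f (pt (r k) (b (r k) i)) i) \<longlonglongrightarrow> f x i"
      using continuous_on_tendsto_compose[OF cont[OF i] B xQ] inQ by auto
    have A': "(\<lambda>k. pt (r k) (a (r k) i) i) \<longlonglongrightarrow> x i"
      using continuous_on_tendsto_compose[OF continuous_on_product_coordinates A] by auto
    have B': "(\<lambda>k. pt (r k) (b (r k) i) i) \<longlonglongrightarrow> x i"
      using continuous_on_tendsto_compose[OF continuous_on_product_coordinates B] by auto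
    show "x i \<le> f x i" by (rule LIMSEQ_le[OF A' fA]) (use label0 lab(1)[OF i] in auto)
    have "\<forall>j<n. b (r k) i j \<le> Suc (r k)" for k
      using near(2)[OF i] near_le by blast
    then show "f x i \<le> x i" by (intro LIMSEQ_le[OF fB B']) (use label1 lab(2)[OF i] i in auto)
  qed
  with xQ show ?thesis by blast
qed


text \<open>The Schauder projection: tent functions around an \<open>e\<close>-net of
  \<open>S\<close> give barycentric weights for \<open>f (X t)\<close>, so a map of weights to
  weights has a fixed point by Brouwer. Its point \<open>X t\<close> is moved by at most
  \<open>e\<close>, and compactness of \<open>S\<close> lets \<open>e\<close> tend to zero.\<close>

lemma schauder:
  fixes C S :: "'a::real_normed_vector set"
  assumes "convex C" "C \<noteq> {}" "compact S" "S \<subseteq> C"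
    and cont: "continuous_on C f" and maps: "f ` C \<subseteq> S"
  shows "\<exists>x\<in>C. f x = x"
proof -
  have approx: "\<exists>x\<in>C. dist (f x) x \<le> e" if e: "e > 0" for e
  proof -
    obtain Y where Y: "finite Y" "Y \<subseteq> S" "S \<subseteq> (\<Union>y\<in>Y. ball y e)"
      using seq_compact_imp_totally_bounded[OF compact_imp_seq_compact[OF \<open>compact S\<close>], rule_format, OF e] by metis
    have "Y \<noteq> {}" using Y maps \<open>C \<noteq> {}\<close> by fastforce
    obtain y where y: "bij_betw y {0..<card Y} Y" using ex_bij_betw_nat_finite[OF Y(1)] by blast
    define N where "N = card Y"
    have N: "N > 0" using \<open>Y \<noteq> {}\<close> Y(1) by (simp add: N_def card_gt_0_iff)
    have Yy: "Y = y ` {..<N}" using y by (auto simp: N_def bij_betw_def lessThan_atLeast0)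
    have yC: "y j \<in> C" if "j < N" for j using that Yy Y(2) assms(4) by blast
    \<comment> \<open>The tent \<open>m j\<close> is positive exactly on the open
      \<open>e\<close>-ball around \<open>y j\<close>. Since these balls cover \<open>S\<close>, the
      total \<open>\<sigma>\<close> is positive on \<open>S\<close>, where all values of
      \<open>f\<close> lie.\<close>
    define m where "m j z = max 0 (e - dist z (y j))" for j z
    define \<sigma> where "\<sigma> z = (\<Sum>j<N. m j z)" for z
    have m0: "0 \<le> m j z" for j z by (simp add: m_def)
    have \<sigma>: "\<sigma> z > 0" if z: "z \<in> S" for z
    proof -
      obtain v where v: "v \<in> Y" "z \<in> ball v e" using z Y(3) by blast
      then obtain j where "j < N" "v = y j" using Yy by blast
      with v have "j < N" "dist z (y j) < e" by (simp_all add: dist_commute)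
      then show ?thesis unfolding \<sigma>_def using m0 by (intro sum_pos2[of _ j]) (auto simp: m_def)
    qed
    define s where "s t = (\<Sum>j<N. t j)" for t :: "nat \<Rightarrow> real"
    \<comment> \<open>the point \<open>y 0\<close> receives the missing mass, so \<open>X\<close> maps the whole cube, not only the simplex, into \<open>C\<close>\<close>
    define X where "X t = (1 / max 1 (s t)) *\<^sub>R ((\<Sum>j<N. t j *\<^sub>R y j) + max 0 (1 - s t) *\<^sub>R y 0)"
      for t :: "nat \<Rightarrow> real"
    define Q where "Q = {x :: nat \<Rightarrow> real. \<forall>i. x i \<in> {0..1}}"
    have XC: "X t \<in> C" if t: "t \<in> Q" for t
    proof -
      define c where "c j = (t j + (if j = 0 then max 0 (1 - s t) else 0)) / max 1 (s t)" for j
      have s0: "0 \<le> s t" using t by (auto simp: s_def Q_def intro!: sum_nonneg)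
      have "X t = (\<Sum>j<N. c j *\<^sub>R y j)"
        using N by (simp add: X_def c_def scaleR_right_distrib scaleR_left_distrib add_divide_distrib
            sum.distrib scaleR_sum_right if_distrib[of "\<lambda>x. x / _"] if_distrib[of "\<lambda>x. x *\<^sub>R _"] 
            sum.delta cong: if_cong)
      moreover have "(\<Sum>j<N. c j) = 1"
      proof -
        have "(\<Sum>j<N. c j) = (s t + max 0 (1 - s t)) / max 1 (s t)"
          using N by (simp add: c_def flip: sum_divide_distrib) (simp add: sum.distrib sum.delta s_def)
        also have "\<dots> = 1" using s0 by (auto simp: max_def)
        finally show ?thesis .
      qed
      moreover have "0 \<le> c j" for j using t by (auto simp: c_def Q_def)
      ultimately show ?thesis using yC by (auto intro!: convex_sum[OF _ \<open>convex C\<close>])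
    qed
    have contX: "continuous_on Q X"
    proof -
      have *: "continuous_on Q (\<lambda>t. t j)" for j
        by (rule continuous_on_subset[OF continuous_on_product_coordinates]) simp
      have s: "continuous_on Q s" unfolding s_def by (intro continuous_intros *)
      show ?thesis unfolding X_def by (intro continuous_intros * s) auto
    qed
    have "\<exists>t\<in>Q. \<forall>i<N. m i (f (X t)) / \<sigma> (f (X t)) = t i"
      unfolding Q_def
    proof (rule brouwer_unit_cube_nat, unfold Q_def[symmetric])
      have fX: "continuous_on Q (\<lambda>t. f (X t))"
        by (rule continuous_on_compose2[OF cont contX]) (use XC in auto)
      show "continuous_on Q (\<lambda>t. m i (f (X t)) / \<sigma> (f (X t)))" for i
        unfolding m_def \<sigma>_def
      proof (intro continuous_intros fX)
        show "\<forall>t\<in>Q. (\<Sum>j<N. max 0 (e - dist (f (X t)) (y j))) \<noteq> 0"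
          using \<sigma> XC maps unfolding \<sigma>_def m_def by (metis image_subset_iff less_irrefl)
      qed
      show "m i (f (X t)) / \<sigma> (f (X t)) \<in> {0..1}" if "t \<in> Q" "i < N" for t i
      proof -
        have "m i (f (X t)) \<le> \<sigma> (f (X t))"
          unfolding \<sigma>_def using that m0 by (intro member_le_sum) auto
        moreover have "\<sigma> (f (X t)) > 0" using \<sigma> XC maps that by blast
        ultimately show ?thesis using m0 by auto
      qed
    qed
    then obtain t where t: "t \<in> Q" "\<And>i. i < N \<Longrightarrow> t i = m i (f (X t)) / \<sigma> (f (X t))" by metis
    define z where "z = f (X t)"
    have "z \<in> S" using XC t maps by (auto simp: z_def)
    \<comment> \<open>A fixed point consists of normalized weights and so lies on the simplex, where
      the denominator and the correction at \<open>y 0\<close> drop out of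
      \<open>X t\<close>.\<close>
    have st: "s t = 1"
      using t(2) \<sigma>[OF \<open>z \<in> S\<close>] by (simp add: s_def z_def[symmetric] flip: sum_divide_distrib) (simp add: \<sigma>_def)
    have "z - X t = (\<Sum>j<N. t j *\<^sub>R (z - y j))"
      using st by (simp add: X_def s_def scaleR_right_diff_distrib sum_subtractf flip: scaleR_sum_left)
    also have "norm \<dots> \<le> (\<Sum>j<N. t j * e)"
    proof (rule sum_norm_le)
      fix j assume j: "j \<in> {..<N}"
      have "0 \<le> t j" using t(1) by (auto simp: Q_def)
      moreover have "t j = 0 \<or> dist z (y j) \<le> e"
        using t(2)[of j] j by (auto simp: m_def z_def[symmetric])
      ultimately show "norm (t j *\<^sub>R (z - y j)) \<le> t j * e"
        by (auto simp: dist_norm intro: mult_left_mono)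
    qed
    also have "\<dots> = e" using st by (simp add: s_def flip: sum_distrib_right)
    finally have "dist z (X t) \<le> e" by (simp add: dist_norm)
    then show ?thesis using XC t(1) z_def by blast
  qed
  define e where "e k = 1 / real (Suc k)" for k
  have "\<forall>k. \<exists>x\<in>C. dist (f x) x \<le> e k" using approx by (simp add: e_def)
  then obtain x where x: "\<And>k. x k \<in> C" "\<And>k. dist (f (x k)) (x k) \<le> e k" by metis
  have "\<forall>k. f (x k) \<in> S" using x maps by blast
  then obtain l r where l: "l \<in> S" "strict_mono r" "((\<lambda>k. f (x k)) \<circ> r) \<longlonglongrightarrow> l"
    using compact_imp_seq_compact[OF \<open>compact S\<close>] unfolding seq_compact_def by metis
  have "(\<lambda>k. e (r k)) \<longlonglongrightarrow> 0"
    unfolding e_def using LIMSEQ_subseq_LIMSEQ[OF LIMSEQ_Suc[OF lim_1_over_n] l(2)] by (simp add: o_def)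
  then have "(\<lambda>k. x (r k) - f (x (r k))) \<longlonglongrightarrow> 0"
    by (rule Lim_null_comparison[rotated]) (use x(2) in \<open>auto simp: dist_norm norm_minus_commute\<close>)
  from tendsto_add[OF this l(3)] have xl: "(\<lambda>k. x (r k)) \<longlonglongrightarrow> l" by (simp add: o_def)
  have "(\<lambda>k. f (x (r k))) \<longlonglongrightarrow> f l"
    using continuous_on_tendsto_compose[OF cont xl] l(1) assms(4) x(1) by auto
  then have "f l = l" using l(3) LIMSEQ_unique by (auto simp: o_def)
  then show ?thesis using l(1) assms(4) by blast
qed

section \<open>Schauder's theorem for sets of functions under uniform convergence\<close>

lemma compact_closure_sequentially:
  fixes T :: "'a::metric_space set"
  assumes "\<And>X :: nat \<Rightarrow> 'a. (\<And>k. X k \<in> T) \<Longrightarrow> \<exists>r l. strict_mono r \<and> (\<lambda>k. X (r k)) \<longlonglongrightarrow> l"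
  shows "compact (closure T)"
  unfolding compact_eq_seq_compact_metric
proof (rule seq_compactI)
  fix Z :: "nat \<Rightarrow> 'a" assume Z: "\<forall>k. Z k \<in> closure T"
  \<comment> \<open>A sequence in the closure is shadowed by one in \<open>T\<close> at distance
    tending to zero; convergence of a subsequence transfers from the shadow.\<close>
  have "\<forall>k. \<exists>t\<in>T. dist t (Z k) < 1 / real (Suc k)"
    using Z by (auto simp: closure_approachable)
  then obtain X where X: "\<And>k. X k \<in> T" "\<And>k. dist (X k) (Z k) < 1 / real (Suc k)" by metis
  obtain r l where r: "strict_mono r" "(\<lambda>k. X (r k)) \<longlonglongrightarrow> l" using assms[of X] X(1) by blast
  have "(\<lambda>k. 1 / real (Suc (r k))) \<longlonglongrightarrow> 0"
    using LIMSEQ_subseq_LIMSEQ[OF LIMSEQ_Suc[OF lim_1_over_n] r(1)] by (simp add: o_def)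
  then have "(\<lambda>k. dist (X (r k)) (Z (r k))) \<longlonglongrightarrow> 0"
    by (rule Lim_null_comparison[rotated]) (use X(2) in \<open>auto intro!: always_eventually less_imp_le\<close>)
  with r(2) have "(\<lambda>k. dist (X (r k)) (Z (r k)) + dist (X (r k)) l) \<longlonglongrightarrow> 0"
    by (auto simp: tendsto_dist_iff[of _ l] intro: tendsto_add_zero)
  then have "(\<lambda>k. dist (Z (r k)) l) \<longlonglongrightarrow> 0"
    by (rule Lim_null_comparison[rotated]) (auto intro!: always_eventually dist_triangle3)
  then have "(\<lambda>k. Z (r k)) \<longlonglongrightarrow> l" by (simp add: tendsto_dist_iff[of _ l])
  moreover have "l \<in> closure T"
    by (rule closed_sequentially[OF closed_closure _ r(2)]) (use X(1) closure_subset in blast)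
  ultimately show "\<exists>l\<in>closure T. \<exists>r. strict_mono r \<and> (Z \<circ> r) \<longlonglongrightarrow> l"
    using r(1) by (auto simp: o_def)
qed

lemma schauder_uniform_limit:
  fixes C :: "('x \<Rightarrow> 'b::real_normed_vector) set"
  assumes ext: "C \<subseteq> extensional D" and bdd: "\<And>u. u \<in> C \<Longrightarrow> bounded (u ` D)" and "C \<noteq> {}"
    and conv: "\<And>u v t. u \<in> C \<Longrightarrow> v \<in> C \<Longrightarrow> 0 \<le> t \<Longrightarrow> t \<le> 1 \<Longrightarrow> (\<lambda>x\<in>D. (1 - t) *\<^sub>R u x + t *\<^sub>R v x) \<in> C"
    and maps: "\<And>u. u \<in> C \<Longrightarrow> S u \<in> C"
    and cont: "\<And>U u. (\<And>k. U k \<in> C) \<Longrightarrow> u \<in> C \<Longrightarrow> uniform_limit D U u sequentially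
        \<Longrightarrow> uniform_limit D (\<lambda>k. S (U k)) (S u) sequentially"
    and comp: "\<And>U :: nat \<Rightarrow> 'x \<Rightarrow> 'b. (\<And>k. U k \<in> C) \<Longrightarrow>
        \<exists>r v. strict_mono r \<and> v \<in> C \<and> uniform_limit D (\<lambda>k. S (U (r k))) v sequentially"
  shows "\<exists>u\<in>C. S u = u"
proof -
  \<comment> \<open>over the discrete topology every bounded function is continuous, so \<open>C\<close> embeds in a normed space\<close>
  define e :: "('x \<Rightarrow> 'b) \<Rightarrow> 'x discrete \<Rightarrow>\<^sub>C 'b"
    where "e u = Bcontfun (\<lambda>z. if of_discrete z \<in> D then u (of_discrete z) else 0)" for u
  have e: "apply_bcontfun (e u) z = (if of_discrete z \<in> D then u (of_discrete z) else 0)" if u: "u \<in> C" for u z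
  proof -
    obtain B where B: "\<And>x. x \<in> D \<Longrightarrow> norm (u x) \<le> B"
      using bdd[OF u] by (auto simp: bounded_iff)
    have "(\<lambda>z. if of_discrete z \<in> D then u (of_discrete z) else 0) \<in> bcontfun"
    proof (rule bcontfun_normI)
      show "continuous_on UNIV (\<lambda>z. if of_discrete z \<in> D then u (of_discrete z) else 0)"
        by (auto simp: continuous_on_open_vimage open_discrete)
      show "norm (if of_discrete z \<in> D then u (of_discrete z) else 0) \<le> max 0 B" for z
        using B by (auto simp: le_max_iff_disj)
    qed
    then show ?thesis by (simp add: e_def Bcontfun_inverse)
  qed
  define R where "R v = (\<lambda>x\<in>D. apply_bcontfun v (discrete x))" for v :: "'x discrete \<Rightarrow>\<^sub>C 'b"
  have Re: "R (e u) = u" if "u \<in> C" for u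
    using e[OF that] ext that by (auto simp: R_def discrete_inverse extensional_def fun_eq_iff)
  have lim: "(\<lambda>k. e (U k)) \<longlonglongrightarrow> e u \<longleftrightarrow> uniform_limit D U u sequentially"
    if U: "\<And>k. U k \<in> C" and u: "u \<in> C" for U u
  proof -
    have "(\<lambda>k. e (U k)) \<longlonglongrightarrow> e u \<longleftrightarrow> uniform_limit UNIV (\<lambda>k. apply_bcontfun (e (U k))) (apply_bcontfun (e u)) sequentially"
      by (rule iffI, erule tendsto_bcontfun_uniform_limit, erule uniform_limit_tendsto_bcontfun)
    also have "\<dots> \<longleftrightarrow> uniform_limit D U u sequentially"
    proof -
      have "(\<forall>z\<in>UNIV. dist (apply_bcontfun (e (U k)) z) (apply_bcontfun (e u) z) < \<epsilon>)
          \<longleftrightarrow> (\<forall>x\<in>D. dist (U k x) (u x) < \<epsilon>)" if "\<epsilon> > 0" for k \<epsilon>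
      proof
        assume *: "\<forall>z\<in>UNIV. dist (apply_bcontfun (e (U k)) z) (apply_bcontfun (e u) z) < \<epsilon>"
        show "\<forall>x\<in>D. dist (U k x) (u x) < \<epsilon>"
        proof
          fix x assume "x \<in> D"
          then show "dist (U k x) (u x) < \<epsilon>"
            using *[rule_format, of "discrete x"] U u by (simp add: e discrete_inverse)
        qed
      qed (use U u \<open>\<epsilon> > 0\<close> in \<open>simp add: e\<close>)
      then show ?thesis by (simp add: uniform_limit_iff)
    qed
    finally show ?thesis .
  qed
  have lim': "\<exists>r l. strict_mono r \<and> l \<in> e ` C \<and> (\<lambda>k. e (S (U (r k)))) \<longlonglongrightarrow> l" if U: "\<And>k. U k \<in> C" for U :: "nat \<Rightarrow> 'x \<Rightarrow> 'b"
  proof -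
    obtain r v where rv: "strict_mono r" "v \<in> C" "uniform_limit D (\<lambda>k. S (U (r k))) v sequentially"
      using comp[of U] U by blast
    then have "(\<lambda>k. e (S (U (r k)))) \<longlonglongrightarrow> e v" by (subst lim) (auto intro: maps U)
    with rv show ?thesis by blast
  qed
  have "\<exists>v\<in>e ` C. e (S (R v)) = v"
  proof (rule schauder)
    show "convex (e ` C)"
    proof (rule convexI, clarify)
      fix a b :: real and u v assume *: "u \<in> C" "v \<in> C" "0 \<le> a" "0 \<le> b" "a + b = 1"
      define c where "c = (\<lambda>x\<in>D. (1 - b) *\<^sub>R u x + b *\<^sub>R v x)"
      have a: "a = 1 - b" using * by simp
      have c: "c \<in> C" unfolding c_def by (rule conv) (use * in auto)
      have "a *\<^sub>R e u + b *\<^sub>R e v = e c"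
        by (rule bcontfun_eqI) (simp add: e * c, simp add: c_def a)
      with c show "a *\<^sub>R e u + b *\<^sub>R e v \<in> e ` C" by blast
    qed
    show "compact (closure (e ` S ` C))"
    proof (rule compact_closure_sequentially)
      fix X assume "\<And>k :: nat. X k \<in> e ` S ` C"
      then have "\<forall>k. \<exists>u\<in>C. X k = e (S u)" by blast
      then obtain U where "\<And>k. U k \<in> C" "\<And>k. X k = e (S (U k))" by metis
      with lim'[of U] show "\<exists>r l. strict_mono r \<and> (\<lambda>k. X (r k)) \<longlonglongrightarrow> l" by auto
    qed
    show "closure (e ` S ` C) \<subseteq> e ` C"
    proof
      fix y assume "y \<in> closure (e ` S ` C)"
      then obtain X where "\<forall>k. X k \<in> e ` S ` C" and y: "X \<longlonglongrightarrow> y" by (auto simp: closure_sequential)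
      then have "\<forall>k. \<exists>u\<in>C. X k = e (S u)" by blast
      then obtain U where U: "\<And>k. U k \<in> C" "\<And>k. X k = e (S (U k))" by metis
      obtain r l where "strict_mono r" "l \<in> e ` C" "(\<lambda>k. e (S (U (r k)))) \<longlonglongrightarrow> l" using lim'[of U] U by blast
      then show "y \<in> e ` C"
        using LIMSEQ_subseq_LIMSEQ[OF y, of r] LIMSEQ_unique by (auto simp: o_def U)
    qed
    show "continuous_on (e ` C) (\<lambda>v. e (S (R v)))"
      unfolding continuous_on_sequentially
    proof (intro allI ballI impI, elim conjE)
      fix X v assume v: "v \<in> e ` C" and X: "\<forall>k. X k \<in> e ` C" "X \<longlonglongrightarrow> v"
      obtain u where u: "u \<in> C" "v = e u" using v by blast
      have "\<forall>k. \<exists>u\<in>C. X k = e u" using X(1) by blast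
      then obtain U where U: "\<And>k. U k \<in> C" "\<And>k. X k = e (U k)" by metis
      have "uniform_limit D U u sequentially" using X(2) U u lim[of U u] by (simp add: U(2)[abs_def])
      then have "(\<lambda>k. e (S (U k))) \<longlonglongrightarrow> e (S u)" using lim[of "\<lambda>k. S (U k)" "S u"] cont U u maps by blast
      then show "((\<lambda>v. e (S (R v))) \<circ> X) \<longlonglongrightarrow> e (S (R v))" by (simp add: o_def U u Re)
    qed
    show "(\<lambda>v. e (S (R v))) ` e ` C \<subseteq> closure (e ` S ` C)"
      using closure_subset Re by fastforce
    show "e ` C \<noteq> {}" using \<open>C \<noteq> {}\<close> by simp
  qed
  then obtain u where "u \<in> C" "e (S u) = e u" using Re by auto
  then show ?thesis using Re maps by metis
qed

section \<open>Sequences in spaces of continuous functions\<close>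

text \<open>On a compact domain a continuous function is bounded, so the boundedness built into the
  function space is automatic.\<close>

lemma C_space_iff:
  fixes \<Omega> :: "(real^'m) set" and u :: "real^'m \<Rightarrow> 'b::metric_space"
  assumes "bounded \<Omega>"
  shows "u \<in> C_space \<Omega> \<longleftrightarrow> u \<in> extensional (closure \<Omega>) \<and> continuous_on (closure \<Omega>) u"
proof -
  have "compact (closure \<Omega>)" using assms by simp
  then have "compactin (top_of_set (closure \<Omega>)) (topspace (top_of_set (closure \<Omega>)))"
    by (simp add: compactin_subtopology)
  from compactin_mspace_cfunspace[OF this, of "euclidean_metric :: 'b metric"] show ?thesis
    unfolding C_metric_def by (simp del: mspace_cfunspace)
qed

lemma limitin_C_top:
  fixes \<Omega> :: "(real^'m) set" and U :: "nat \<Rightarrow> real^'m \<Rightarrow> 'b::metric_space"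
  assumes "\<And>k. U k \<in> C_space \<Omega>" "u \<in> C_space \<Omega>"
  shows "limitin (C_top \<Omega>) U u sequentially \<longleftrightarrow> uniform_limit (closure \<Omega>) U u sequentially"
proof -
  let ?d = "mdist (C_metric \<Omega>) :: (real^'m \<Rightarrow> 'b) \<Rightarrow> _"
  interpret Metric_space "C_space \<Omega> :: (real^'m \<Rightarrow> 'b) set" ?d by (rule Metric_space_mspace_mdist)
  have dist: "dist (U k x) (u x) \<le> ?d (U k) u" if "x \<in> closure \<Omega>" for k x
    using mdist_cfunspace_imp_mdist_le[of "U k" "top_of_set (closure \<Omega>)" euclidean_metric u "?d (U k) u" x]
      assms that by (simp add: C_metric_def del: mspace_cfunspace)
  have le: "?d (U k) u \<le> e" if "\<And>x. x \<in> closure \<Omega> \<Longrightarrow> dist (U k x) (u x) \<le> e" "0 \<le> e" for k e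
    unfolding C_metric_def by (rule mdist_cfunspace_le) (use that in auto)
  have "limitin mtopology U u sequentially \<longleftrightarrow> uniform_limit (closure \<Omega>) U u sequentially"
    unfolding limitin_metric uniform_limit_iff
  proof (intro iffI conjI allI impI; (elim conjE)?)
    fix e :: real
    assume "\<forall>e>0. \<forall>\<^sub>F k in sequentially. U k \<in> C_space \<Omega> \<and> ?d (U k) u < e" "e > 0"
    then show "\<forall>\<^sub>F k in sequentially. \<forall>x\<in>closure \<Omega>. dist (U k x) (u x) < e"
      by (auto elim!: allE[of _ e] eventually_mono dest: dist intro: le_less_trans)
  next
    fix e :: real
    assume *: "\<forall>e>0. \<forall>\<^sub>F k in sequentially. \<forall>x\<in>closure \<Omega>. dist (U k x) (u x) < e" "e > 0"
    \<comment> \<open>The distance is a supremum, for which strict pointwise bounds give only a weak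
      one; halving \<open>e\<close> restores strictness.\<close>
    then have "\<forall>\<^sub>F k in sequentially. \<forall>x\<in>closure \<Omega>. dist (U k x) (u x) < e / 2"
      using half_gt_zero by blast
    then show "\<forall>\<^sub>F k in sequentially. U k \<in> C_space \<Omega> \<and> ?d (U k) u < e"
    proof (rule eventually_mono)
      fix k assume "\<forall>x\<in>closure \<Omega>. dist (U k x) (u x) < e / 2"
      then have "?d (U k) u \<le> e / 2" using \<open>e > 0\<close> by (intro le) auto
      with \<open>e > 0\<close> assms show "U k \<in> C_space \<Omega> \<and> ?d (U k) u < e" by auto
    qed
  qed (use assms in auto)
  then show ?thesis by (simp add: mtopology_of_def)
qed

lemma P_set_subset_C_space: "P_set \<Omega> J \<subseteq> C_space \<Omega>"
  by (auto simp: P_set_def)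

lemma tendsto_continuous_functional:
  assumes "continuous_functional \<Omega> J w" "\<And>k. U k \<in> P_set \<Omega> J" "u \<in> P_set \<Omega> J"
    and "uniform_limit (closure \<Omega>) U u sequentially"
  shows "(\<lambda>k. w (U k)) \<longlonglongrightarrow> w u"
proof -
  have "limitin (C_top \<Omega>) U u sequentially"
    using assms P_set_subset_C_space by (subst limitin_C_top) blast+
  then have "limitin (subtopology (C_top \<Omega>) (P_set \<Omega> J)) U u sequentially"
    using assms by (simp add: limitin_subtopology)
  from continuous_map_limit[OF assms(1)[unfolded continuous_functional_def] this] show ?thesis
    by (simp add: o_def)
qed

lemma continuous_linear_operator_in_C_space:
  "continuous_linear_operator \<Omega> K \<Longrightarrow> g \<in> C_space \<Omega> \<Longrightarrow> K g \<in> C_space \<Omega>"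
  by (auto simp: continuous_linear_operator_def continuous_map_def)

lemma uniform_limit_continuous_linear_operator:
  assumes K: "continuous_linear_operator \<Omega> K" and "\<And>k. g k \<in> C_space \<Omega>" "l \<in> C_space \<Omega>"
    and "uniform_limit (closure \<Omega>) g l sequentially"
  shows "uniform_limit (closure \<Omega>) (\<lambda>k. K (g k)) (K l) sequentially"
proof -
  have "limitin (C_top \<Omega>) g l sequentially" using assms by (subst limitin_C_top) auto
  with K have "limitin (C_top \<Omega>) (K \<circ> g) (K l) sequentially"
    unfolding continuous_linear_operator_def by (intro continuous_map_limit) auto
  then show ?thesis
    using assms continuous_linear_operator_in_C_space[OF K] by (subst (asm) limitin_C_top) (auto simp: o_def)
qed

lemma compact_operator_subsequence:
  fixes \<Omega> :: "(real^'m) set" and g :: "nat \<Rightarrow> real^'m \<Rightarrow> real"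
  assumes K: "continuous_linear_operator \<Omega> K" "compact_operator \<Omega> K"
    and g: "\<And>k. g k \<in> C_space \<Omega>" "\<And>k. sup_norm \<Omega> (g k) \<le> c"
  shows "\<exists>r l. strict_mono r \<and> l \<in> C_space \<Omega> \<and> uniform_limit (closure \<Omega>) (\<lambda>k. K (g (r k))) l sequentially"
proof -
  interpret Metric_space "C_space \<Omega> :: (real^'m \<Rightarrow> real) set" "mdist (C_metric \<Omega>)"
    by (rule Metric_space_mspace_mdist)
  have KC: "K (g k) \<in> C_space \<Omega>" for k using continuous_linear_operator_in_C_space[OF K(1)] g by blast
  have "range g \<subseteq> C_space \<Omega>" "\<exists>c. \<forall>u\<in>range g. sup_norm \<Omega> u \<le> c" using g by auto
  then have "compactin mtopology (mtopology closure_of (K ` range g))"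
    using K(2) unfolding compact_operator_def mtopology_of_def by blast
  moreover have "range (\<lambda>k. K (g k)) \<subseteq> mtopology closure_of (K ` range g)"
    using closure_of_subset[of "K ` range g" mtopology] KC by auto
  ultimately obtain l r where "l \<in> mtopology closure_of (K ` range g)" "strict_mono r"
    and l: "limitin mtopology ((\<lambda>k. K (g k)) \<circ> r) l sequentially"
    unfolding compactin_sequentially by meson
  moreover from l have "l \<in> C_space \<Omega>" by (simp add: limitin_metric)
  ultimately show ?thesis
    using limitin_C_top[of "\<lambda>k. K (g (r k))" \<Omega> l] KC by (auto simp: o_def mtopology_of_def)
qed

lemma sup_norm_bound:
  assumes "bounded \<Omega>" "u \<in> C_space \<Omega>" "x \<in> closure \<Omega>"
  shows "\<bar>u x\<bar> \<le> sup_norm \<Omega> u"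
proof -
  have "compact ((\<lambda>x. \<bar>u x\<bar>) ` closure \<Omega>)"
    using assms by (intro compact_continuous_image) (auto simp: C_space_iff intro: continuous_intros)
  then show ?thesis
    unfolding sup_norm_def using assms(3)
    by (intro cSUP_upper bounded_imp_bdd_above compact_imp_bounded) auto
qed

lemma closedin_P_set:
  fixes \<Omega> :: "(real^'m) set" and J :: "(real^'n) set"
  assumes "closed J"
  shows "closedin (C_top \<Omega>) (P_set \<Omega> J)"
proof -
  interpret Metric_space "C_space \<Omega> :: (real^'m \<Rightarrow> real^'n) set" "mdist (C_metric \<Omega>)"
    by (rule Metric_space_mspace_mdist)
  have "closedin mtopology (P_set \<Omega> J)"
    unfolding metric_closedin_iff_sequentially_closed
  proof (intro conjI allI impI P_set_subset_C_space, elim conjE)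
    fix U u assume U: "range U \<subseteq> P_set \<Omega> J" and lim: "limitin mtopology U u sequentially"
    have u: "u \<in> C_space \<Omega>" using lim by (simp add: limitin_metric)
    have "uniform_limit (closure \<Omega>) U u sequentially"
      using U u lim P_set_subset_C_space by (subst limitin_C_top[symmetric]) (auto simp: mtopology_of_def)
    then have "u x \<in> J" if "x \<in> closure \<Omega>" for x
      using closed_sequentially[OF assms _ tendsto_uniform_limitI[OF _ that]] U that
      by (auto simp: P_set_def image_subset_iff)
    with u show "u \<in> P_set \<Omega> J" by (simp add: P_set_def)
  qed
  then show ?thesis by (simp add: mtopology_of_def)
qed

text \<open>A closed set contains its frontier. Consequently a functional bounded above on
  \<open>P_set \<Omega> J\<close> is bounded above on the boundary, and its supremum there really is
  an upper bound.\<close>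

lemma P_boundary_subset:
  assumes "closed J"
  shows "P_boundary \<Omega> J \<subseteq> P_set \<Omega> J"
  using closure_of_subtopology_subset[of "C_top \<Omega>" "P_cone \<Omega>" "P_set \<Omega> J"]
    closure_of_closedin[OF closedin_P_set[OF assms]]
  unfolding P_boundary_def frontier_of_def by blast

text \<open>The multiples \<open>(1 + 1 / Suc k) u\<close> stay in the cone and converge uniformly
  to \<open>u\<close>, but leave \<open>P_set \<Omega> J\<close> at the point \<open>x\<close>.
  Hence \<open>u\<close> is not interior relative to the cone.\<close>

lemma P_boundaryI:
  fixes \<Omega> :: "(real^'m) set" and J :: "(real^'n) set"
  assumes u: "u \<in> P_set \<Omega> J" and J: "J \<subseteq> {v. \<forall>i. 0 \<le> v $ i}" and b: "bounded \<Omega>"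
    and x: "x \<in> closure \<Omega>" and out: "\<And>t. t > 1 \<Longrightarrow> t *\<^sub>R u x \<notin> J"
  shows "u \<in> P_boundary \<Omega> J"
proof -
  let ?T = "subtopology (C_top \<Omega>) (P_cone \<Omega>)"
  have sub: "P_set \<Omega> J \<subseteq> topspace ?T"
    using J by (auto simp: P_cone_def P_set_def)
  have "u \<notin> ?T interior_of P_set \<Omega> J"
  proof
    assume int: "u \<in> ?T interior_of P_set \<Omega> J"
    define U where "U k = (\<lambda>x\<in>closure \<Omega>. (1 + 1 / real (Suc k)) *\<^sub>R u x)" for k
    have uC: "u \<in> C_space \<Omega>" using u by (simp add: P_set_def)
    have UC: "U k \<in> P_cone \<Omega>" for k
      using u J b by (auto simp: P_cone_def P_set_def C_space_iff U_def subset_iff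
          intro!: continuous_intros)
    have "bounded (u ` closure \<Omega>)"
      using uC b by (auto simp: C_space_iff intro!: compact_imp_bounded compact_continuous_image)
    then obtain B where B: "\<And>x. x \<in> closure \<Omega> \<Longrightarrow> norm (u x) \<le> B" by (auto simp: bounded_iff)
    have "uniform_limit (closure \<Omega>) U u sequentially"
      unfolding uniform_limit_iff
    proof (intro allI impI)
      fix e :: real assume "e > 0"
      have "(\<lambda>k. B * (1 / real (Suc k))) \<longlonglongrightarrow> B * 0"
        by (intro tendsto_intros LIMSEQ_Suc lim_1_over_n)
      then have "\<forall>\<^sub>F k in sequentially. B * (1 / real (Suc k)) < e"
        using \<open>e > 0\<close> by (intro order_tendstoD) auto
      then show "\<forall>\<^sub>F k in sequentially. \<forall>x\<in>closure \<Omega>. dist (U k x) (u x) < e"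
      proof (rule eventually_mono, intro ballI)
        fix k x assume k: "B * (1 / real (Suc k)) < e" and x: "x \<in> closure \<Omega>"
        have "dist (U k x) (u x) = norm (u x) * (1 / real (Suc k))"
          using x by (simp add: U_def dist_norm scaleR_left_distrib)
        also have "\<dots> \<le> B * (1 / real (Suc k))" using B[OF x] by (intro mult_right_mono) auto
        finally show "dist (U k x) (u x) < e" using k by simp
      qed
    qed
    then have "limitin (C_top \<Omega>) U u sequentially"
      using UC uC P_set_subset_C_space by (subst limitin_C_top) (auto simp: P_cone_def)
    then have "limitin ?T U u sequentially"
      using UC u sub by (auto simp: limitin_subtopology)
    then have "\<forall>\<^sub>F k in sequentially. U k \<in> ?T interior_of P_set \<Omega> J"
      using int by (auto simp: limitin_def)
    then obtain k where "U k \<in> P_set \<Omega> J"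
      using interior_of_subset by (fastforce simp: eventually_sequentially)
    then show False using out[of "1 + 1 / real (Suc k)"] x by (auto simp: P_set_def U_def)
  qed
  then show ?thesis
    using closure_of_subset[OF sub] u by (auto simp: P_boundary_def frontier_of_def)
qed

section \<open>A maximum principle\<close>

lemma sum_sum_insert:
  fixes F :: "'i \<Rightarrow> 'i \<Rightarrow> real"
  assumes "finite I" "k \<notin> I"
  shows "(\<Sum>i\<in>insert k I. \<Sum>j\<in>insert k I. F i j)
    = (\<Sum>i\<in>I. \<Sum>j\<in>I. F i j) + (\<Sum>i\<in>I. F i k + F k i) + F k k"
  using assms by (simp add: sum.distrib)

text \<open>This is nonnegativity of the trace of a product of a positive definite and a positive
  semidefinite matrix, proved by elimination instead of diagonalization. Splitting off index
  \<open>k\<close> leaves the Schur complement paired with \<open>h\<close>, plus the form of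
  \<open>h\<close> at the \<open>k\<close>-th column of \<open>a\<close>, divided by
  \<open>a k k\<close>. Only the quadratic form of \<open>h\<close> enters, so Hessian rows may be
  inserted without knowing that mixed derivatives commute.\<close>

lemma sum_mult_pos_def_nonneg:
  fixes a h :: "'i \<Rightarrow> 'i \<Rightarrow> real"
  assumes "finite I"
    and sym: "\<And>i j. i \<in> I \<Longrightarrow> j \<in> I \<Longrightarrow> a i j = a j i"
    and pos: "\<And>\<xi>. \<exists>i\<in>I. \<xi> i \<noteq> 0 \<Longrightarrow> 0 < (\<Sum>i\<in>I. \<Sum>j\<in>I. a i j * \<xi> i * \<xi> j)"
    and nonneg: "\<And>\<xi>. 0 \<le> (\<Sum>i\<in>I. \<Sum>j\<in>I. h i j * \<xi> i * \<xi> j)"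
  shows "0 \<le> (\<Sum>i\<in>I. \<Sum>j\<in>I. a i j * h i j)"
  using assms
proof (induction I arbitrary: a rule: finite_induct)
  case empty
  then show ?case by simp
next
  case (insert k I)
  note ins = sum_sum_insert[OF insert.hyps]
  have kI: "i \<noteq> k" if "i \<in> I" for i using insert.hyps that by blast
  define \<alpha> where "\<alpha> = a k k"
  have \<alpha>: "\<alpha> > 0"
  proof -
    have *: "0 < (\<Sum>i\<in>insert k I. \<Sum>j\<in>insert k I. a i j * of_bool (i = k) * of_bool (j = k))"
      by (rule insert.prems(2)[of "\<lambda>i. of_bool (i = k)"]) auto
    have "(\<Sum>i\<in>I. \<Sum>j\<in>I. a i j * of_bool (i = k) * of_bool (j = k)) = 0"
      "(\<Sum>i\<in>I. a i k * of_bool (i = k) * of_bool (k = k) + a k i * of_bool (k = k) * of_bool (i = k)) = 0"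
      by (auto intro!: sum.neutral simp: kI)
    with * show ?thesis unfolding ins \<alpha>_def by simp
  qed
  \<comment> \<open>the Schur complement of the entry \<open>a k k\<close>\<close>
  define a' where "a' i j = a i j - a i k * a j k / \<alpha>" for i j
  have "0 \<le> (\<Sum>i\<in>I. \<Sum>j\<in>I. a' i j * h i j)"
  proof (rule insert.IH)
    show "a' i j = a' j i" if "i \<in> I" "j \<in> I" for i j
      using insert.prems(1)[of i j] that by (simp add: a'_def)
    show "0 < (\<Sum>i\<in>I. \<Sum>j\<in>I. a' i j * \<xi> i * \<xi> j)" if \<xi>: "\<exists>i\<in>I. \<xi> i \<noteq> 0" for \<xi>
    proof -
      define s where "s = (\<Sum>i\<in>I. a i k * \<xi> i)"
      \<comment> \<open>Among all extensions of \<open>\<xi>\<close> to the index \<open>k\<close>,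
        this value minimizes the form of \<open>a\<close>; the minimum is the form of the Schur
        complement at \<open>\<xi>\<close>.\<close>
      define \<theta> where "\<theta> = \<xi>(k := - s / \<alpha>)"
      have \<theta>: "\<theta> i = \<xi> i" if "i \<in> I" for i using kI[OF that] by (simp add: \<theta>_def)
      have \<theta>k: "\<theta> k = - s / \<alpha>" by (simp add: \<theta>_def)
      have "0 < (\<Sum>i\<in>insert k I. \<Sum>j\<in>insert k I. a i j * \<theta> i * \<theta> j)"
        by (rule insert.prems(2)) (use \<xi> \<theta> in auto)
      also have "\<dots> = (\<Sum>i\<in>I. \<Sum>j\<in>I. a i j * \<xi> i * \<xi> j) + (\<Sum>i\<in>I. 2 * \<theta> k * (a i k * \<xi> i)) + \<alpha> * (\<theta> k)\<^sup>2"
      proof -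
        have "a k i = a i k" if "i \<in> I" for i using insert.prems(1)[of i k] that by simp
        then show ?thesis
          unfolding ins by (simp add: \<theta> \<alpha>_def power2_eq_square algebra_simps cong: sum.cong)
      qed
      also have "(\<Sum>i\<in>I. 2 * \<theta> k * (a i k * \<xi> i)) = 2 * \<theta> k * s"
        by (simp add: s_def sum_distrib_left)
      also have "(\<Sum>i\<in>I. \<Sum>j\<in>I. a i j * \<xi> i * \<xi> j) + 2 * \<theta> k * s + \<alpha> * (\<theta> k)\<^sup>2
          = (\<Sum>i\<in>I. \<Sum>j\<in>I. a i j * \<xi> i * \<xi> j) - s * s / \<alpha>"
        using \<alpha> by (simp add: \<theta>k power2_eq_square field_simps)
      also have "s * s / \<alpha> = (\<Sum>i\<in>I. \<Sum>j\<in>I. (a i k * a j k / \<alpha>) * \<xi> i * \<xi> j)"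
        by (simp add: s_def sum_product sum_divide_distrib mult_ac)
      finally show ?thesis
        by (simp add: a'_def left_diff_distrib sum_subtractf)
    qed
    show "0 \<le> (\<Sum>i\<in>I. \<Sum>j\<in>I. h i j * \<xi> i * \<xi> j)" for \<xi>
    proof -
      have "0 \<le> (\<Sum>i\<in>insert k I. \<Sum>j\<in>insert k I. h i j * (\<xi>(k := 0)) i * (\<xi>(k := 0)) j)"
        by (rule insert.prems(3))
      then show ?thesis unfolding ins by (simp add: kI cong: sum.cong)
    qed
  qed
  moreover have "(\<Sum>i\<in>insert k I. \<Sum>j\<in>insert k I. a i j * h i j)
      = (\<Sum>i\<in>I. \<Sum>j\<in>I. a' i j * h i j)
        + (\<Sum>i\<in>insert k I. \<Sum>j\<in>insert k I. h i j * a i k * a j k) / \<alpha>"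
  proof -
    have "a k i = a i k" if "i \<in> I" for i using insert.prems(1)[of i k] that by simp
    \<comment> \<open>By symmetry, subtracting \<open>a i k * a j k / \<alpha>\<close> annihilates
      the whole row and column \<open>k\<close>, so only the sum over \<open>I\<close>
      survives.\<close>
    then have "(\<Sum>i\<in>insert k I. \<Sum>j\<in>insert k I. a i j * h i j - h i j * a i k * a j k / \<alpha>)
        = (\<Sum>i\<in>I. \<Sum>j\<in>I. a' i j * h i j)"
      using \<alpha> unfolding ins by (simp add: a'_def \<alpha>_def algebra_simps cong: sum.cong)
    then show ?thesis
      by (simp only: sum_subtractf sum_divide_distrib)
  qed
  ultimately show ?case
    using insert.prems(3)[of "\<lambda>i. a i k"] \<alpha> by simp
qed

text \<open>The rows \<open>H j\<close> are the gradients at \<open>x\<close> of the partial derivatives of \<open>u\<close>.\<close>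
definition has_jet2 :: "(real^'m \<Rightarrow> real) \<Rightarrow> real^'m \<Rightarrow> real^'m \<Rightarrow> ('m \<Rightarrow> real^'m) \<Rightarrow> bool" where
  "has_jet2 u x p H \<longleftrightarrow> (\<exists>S G. open S \<and> x \<in> S \<and> (\<forall>y\<in>S. (u has_derivative (\<lambda>v. G y \<bullet> v)) (at y)) \<and>
     G x = p \<and> (\<forall>j. ((\<lambda>y. G y $ j) has_derivative (\<lambda>v. H j \<bullet> v)) (at x)))"

lemma has_derivative_line:
  fixes u :: "real^'m \<Rightarrow> real"
  assumes "(u has_derivative (\<lambda>v. g \<bullet> v)) (at (x + t *\<^sub>R \<xi>))"
  shows "((\<lambda>t. u (x + t *\<^sub>R \<xi>)) has_real_derivative g \<bullet> \<xi>) (at t)"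
proof -
  have "((\<lambda>t. x + t *\<^sub>R \<xi>) has_derivative (\<lambda>s. s *\<^sub>R \<xi>)) (at t)"
    by (auto intro!: derivative_eq_intros)
  from has_derivative_compose[OF this assms] show ?thesis
    by (simp add: has_field_derivative_def mult_commute_abs)
qed

lemma partial_deriv_eq:
  assumes "(u has_derivative (\<lambda>v. g \<bullet> v)) (at x)"
  shows "partial_deriv j u x = g $ j"
  unfolding partial_deriv_def
  using has_derivative_line[of u g x 0 "axis j 1"] assms
  by (intro DERIV_imp_deriv) (simp add: inner_axis)

text \<open>The inner \<open>partial_deriv\<close> has to be identified on a neighbourhood before
  the outer one can be evaluated at \<open>x\<close>; the open set in \<open>has_jet2\<close>
  provides it.\<close>

lemma elliptic_op_has_jet2:
  assumes "has_jet2 u x p H"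
  shows "elliptic_op a2 a1 a0 u x =
    - (\<Sum>j\<in>UNIV. \<Sum>l\<in>UNIV. a2 j l x * H l $ j) + (\<Sum>j\<in>UNIV. a1 j x * p $ j) + a0 x * u x"
proof -
  obtain S G where S: "open S" "x \<in> S" and u: "\<And>y. y \<in> S \<Longrightarrow> (u has_derivative (\<lambda>v. G y \<bullet> v)) (at y)"
    and p: "G x = p" and H: "\<And>j. ((\<lambda>y. G y $ j) has_derivative (\<lambda>v. H j \<bullet> v)) (at x)"
    using assms unfolding has_jet2_def by blast
  have 1: "partial_deriv l u y = G y $ l" if "y \<in> S" for y l by (rule partial_deriv_eq[OF u[OF that]])
  have "(partial_deriv l u has_derivative (\<lambda>v. H l \<bullet> v)) (at x)" for l
    by (rule has_derivative_transform_within_open[OF H S]) (simp add: 1)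
  then have "partial_deriv j (partial_deriv l u) x = H l $ j" for j l by (rule partial_deriv_eq)
  with S p show ?thesis by (simp add: elliptic_op_def 1)
qed

lemma has_jet2_const: "has_jet2 (\<lambda>y::real^'m. c) x 0 (\<lambda>j. 0)"
proof -
  have "(\<bullet>) (0::real^'m) = (\<lambda>v. 0)" by (simp add: fun_eq_iff)
  then show ?thesis
    unfolding has_jet2_def by (intro exI[of _ UNIV] exI[of _ "\<lambda>y. 0"]) auto
qed

lemma has_jet2_add_mult:
  assumes "has_jet2 u x p H" "has_jet2 v x q J"
  shows "has_jet2 (\<lambda>y. u y + c * v y) x (p + c *\<^sub>R q) (\<lambda>j. H j + c *\<^sub>R J j)"
proof -
  obtain S G where S: "open S" "x \<in> S" and u: "\<And>y. y \<in> S \<Longrightarrow> (u has_derivative (\<lambda>v. G y \<bullet> v)) (at y)"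
    and p: "G x = p" and H: "\<And>j. ((\<lambda>y. G y $ j) has_derivative (\<lambda>v. H j \<bullet> v)) (at x)"
    using assms(1) unfolding has_jet2_def by blast
  obtain S' G' where S': "open S'" "x \<in> S'" and v: "\<And>y. y \<in> S' \<Longrightarrow> (v has_derivative (\<lambda>v. G' y \<bullet> v)) (at y)"
    and q: "G' x = q" and J: "\<And>j. ((\<lambda>y. G' y $ j) has_derivative (\<lambda>v. J j \<bullet> v)) (at x)"
    using assms(2) unfolding has_jet2_def by blast
  show ?thesis
    unfolding has_jet2_def
  proof (intro exI conjI ballI allI)
    show "open (S \<inter> S')" "x \<in> S \<inter> S'" using S S' by auto
    show "((\<lambda>y. u y + c * v y) has_derivative (\<lambda>v. (G y + c *\<^sub>R G' y) \<bullet> v)) (at y)" if "y \<in> S \<inter> S'" for y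
      using that by (auto intro!: derivative_eq_intros u v simp: inner_add_left)
    show "((\<lambda>y. (G y + c *\<^sub>R G' y) $ j) has_derivative (\<lambda>v. (H j + c *\<^sub>R J j) \<bullet> v)) (at x)" for j
      by (auto intro!: derivative_eq_intros H J simp: inner_add_left)
    show "G x + c *\<^sub>R G' x = p + c *\<^sub>R q" by (simp add: p q)
  qed
qed

lemma elliptic_op_add_mult:
  assumes "has_jet2 u x p H" "has_jet2 v x q J"
  shows "elliptic_op a2 a1 a0 (\<lambda>y. u y + c * v y) x
    = elliptic_op a2 a1 a0 u x + c * elliptic_op a2 a1 a0 v x"
  unfolding elliptic_op_has_jet2[OF has_jet2_add_mult[OF assms]] elliptic_op_has_jet2[OF assms(1)]
    elliptic_op_has_jet2[OF assms(2)]
  by (simp add: algebra_simps sum.distrib sum_distrib_left)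

lemma has_jet2_norm_power2:
  fixes x z :: "real^'m"
  shows "has_jet2 (\<lambda>y. (norm (y - z))\<^sup>2) x (2 *\<^sub>R (x - z)) (\<lambda>j. 2 *\<^sub>R axis j 1)"
  unfolding has_jet2_def
proof (intro exI[of _ UNIV] exI conjI ballI allI)
  show "((\<lambda>y. (norm (y - z))\<^sup>2) has_derivative (\<lambda>v. (2 *\<^sub>R (y - z)) \<bullet> v)) (at y)" for y
    unfolding power2_norm_eq_inner by (auto intro!: derivative_eq_intros simp: inner_commute)
  show "((\<lambda>y. (2 *\<^sub>R (y - z)) $ j) has_derivative (\<lambda>v. (2 *\<^sub>R axis j 1) \<bullet> v)) (at x)" for j
    by (auto intro!: derivative_eq_intros simp: inner_axis' bounded_linear.has_derivative[OF bounded_linear_vec_nth])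
qed auto

text \<open>Both claims are tested on lines through \<open>x\<close>. If the second derivative along
  \<open>\<xi>\<close> were negative, the first one, which vanishes at \<open>x\<close>, would be
  negative just after, and the mean value theorem would produce a value below the minimum. This uses
  differentiability of the gradient only at \<open>x\<close> itself.\<close>

lemma has_jet2_local_min:
  assumes "has_jet2 u x p H" and min: "\<forall>\<^sub>F y in nhds x. u x \<le> u y"
  shows "p = 0" and "0 \<le> (\<Sum>l\<in>UNIV. (H l \<bullet> \<xi>) * \<xi> $ l)"
proof -
  obtain S G where S: "open S" "x \<in> S" and u: "\<And>y. y \<in> S \<Longrightarrow> (u has_derivative (\<lambda>v. G y \<bullet> v)) (at y)"
    and p: "G x = p" and H: "\<And>j. ((\<lambda>y. G y $ j) has_derivative (\<lambda>v. H j \<bullet> v)) (at x)"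
    using assms(1) unfolding has_jet2_def by blast
  have lim: "((\<lambda>t. x + t *\<^sub>R \<xi>) \<longlongrightarrow> x) (nhds 0)" for \<xi>
    by (rule tendsto_eq_intros filterlim_ident refl | simp)+
  have inS: "\<forall>\<^sub>F t in nhds 0. x + t *\<^sub>R \<xi> \<in> S" for \<xi>
    using lim S by (rule topological_tendstoD)
  have minl: "\<forall>\<^sub>F t in nhds 0. u x \<le> u (x + t *\<^sub>R \<xi>)" for \<xi>
    using filterlim_iff[THEN iffD1, OF lim, rule_format, OF min] .
  have "p \<bullet> \<xi> = 0" for \<xi>
  proof -
    obtain d where "d > 0" "\<forall>t. \<bar>0 - t\<bar> < d \<longrightarrow> u x \<le> u (x + t *\<^sub>R \<xi>)"
      using minl[of \<xi>] unfolding eventually_nhds_metric by (auto simp: dist_real_def)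
    moreover have "((\<lambda>t. u (x + t *\<^sub>R \<xi>)) has_real_derivative p \<bullet> \<xi>) (at 0)"
      using has_derivative_line[of u p x 0 \<xi>] u[OF S(2)] p by simp
    ultimately show ?thesis by (auto intro: DERIV_local_min)
  qed
  from this[of p] show p0: "p = 0" by simp
  show "0 \<le> (\<Sum>l\<in>UNIV. (H l \<bullet> \<xi>) * \<xi> $ l)"
  proof (rule ccontr)
    assume neg: "\<not> ?thesis"
    obtain d where d: "d > 0" "\<And>t. \<bar>t\<bar> < d \<Longrightarrow> x + t *\<^sub>R \<xi> \<in> S \<and> u x \<le> u (x + t *\<^sub>R \<xi>)"
      using eventually_conj[OF inS minl, of \<xi> \<xi>] unfolding eventually_nhds_metric by (auto simp: dist_real_def)
    have "((\<lambda>t. \<Sum>l\<in>UNIV. G (x + t *\<^sub>R \<xi>) $ l * \<xi> $ l) has_real_derivative (\<Sum>l\<in>UNIV. (H l \<bullet> \<xi>) * \<xi> $ l)) (at 0)"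
      using has_derivative_line[of "\<lambda>y. G y $ _" _ x 0 \<xi>] H by (intro DERIV_sum DERIV_cmult_right) simp
    then have "((\<lambda>t. G (x + t *\<^sub>R \<xi>) \<bullet> \<xi>) has_real_derivative (\<Sum>l\<in>UNIV. (H l \<bullet> \<xi>) * \<xi> $ l)) (at 0)"
      by (simp add: inner_vec_def)
    from DERIV_neg_dec_right[OF this] neg obtain d' where d': "d' > 0"
      "\<And>t. 0 < t \<Longrightarrow> t < d' \<Longrightarrow> G (x + t *\<^sub>R \<xi>) \<bullet> \<xi> < 0" using p p0 by auto
    define h where "h = min d d' / 2"
    have h: "0 < h" "h < d" "h < d'" using d(1) d'(1) by (auto simp: h_def min_def)
    have "\<exists>z>0. z < h \<and> u (x + h *\<^sub>R \<xi>) - u (x + 0 *\<^sub>R \<xi>) = (h - 0) * (G (x + z *\<^sub>R \<xi>) \<bullet> \<xi>)"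
      by (rule MVT2[OF h(1)]) (use d h in \<open>auto intro!: has_derivative_line u\<close>)
    then obtain z where "0 < z" "z < h" and z: "u (x + h *\<^sub>R \<xi>) - u x = h * (G (x + z *\<^sub>R \<xi>) \<bullet> \<xi>)" by auto
    then have "u (x + h *\<^sub>R \<xi>) - u x < 0" using d'(2)[of z] h by (simp add: mult_pos_neg)
    then show False using d(2)[of h] h by simp
  qed
qed

text \<open>The principal part is minus a trace of the coefficient matrix times the Hessian, the
  drift term vanishes with the gradient, and \<open>a0 x * u x\<close> has the right sign because
  the minimum is not positive.\<close>

lemma elliptic_op_nonpos_at_min:
  fixes x :: "real^'m"
  assumes jet: "has_jet2 u x p H" and min: "\<forall>\<^sub>F y in nhds x. u x \<le> u y" and "u x \<le> 0" "0 \<le> a0 x"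
    and sym: "\<And>j l. a2 j l x = a2 l j x" and "\<mu>0 > 0"
    and ell: "\<And>\<xi> :: real^'m. \<mu>0 * (norm \<xi>)\<^sup>2 \<le> (\<Sum>j\<in>UNIV. \<Sum>l\<in>UNIV. a2 j l x * \<xi> $ j * \<xi> $ l)"
  shows "elliptic_op a2 a1 a0 u x \<le> 0"
proof -
  have "0 \<le> (\<Sum>j\<in>UNIV. \<Sum>l\<in>UNIV. a2 j l x * (H l $ j))"
  proof (rule sum_mult_pos_def_nonneg[where a="\<lambda>j l. a2 j l x" and h="\<lambda>j l. H l $ j"])
    show "0 < (\<Sum>j\<in>UNIV. \<Sum>l\<in>UNIV. a2 j l x * \<xi> j * \<xi> l)" if "\<exists>i\<in>UNIV. \<xi> i \<noteq> 0" for \<xi>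
    proof -
      have "(\<chi> i. \<xi> i) \<noteq> 0" using that by (auto simp: vec_eq_iff)
      then have "0 < \<mu>0 * (norm (\<chi> i. \<xi> i))\<^sup>2" using \<open>\<mu>0 > 0\<close> by simp
      also note ell
      finally show ?thesis by simp
    qed
    show "0 \<le> (\<Sum>i\<in>UNIV. \<Sum>j\<in>UNIV. H j $ i * \<xi> i * \<xi> j)" for \<xi>
    proof -
      have "0 \<le> (\<Sum>l\<in>UNIV. (H l \<bullet> (\<chi> i. \<xi> i)) * (\<chi> i. \<xi> i) $ l)"
        by (rule has_jet2_local_min(2)[OF jet min])
      also have "\<dots> = (\<Sum>l\<in>UNIV. \<Sum>i\<in>UNIV. H l $ i * \<xi> i * \<xi> l)"
        by (simp add: inner_vec_def sum_distrib_right)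
      finally show ?thesis by (subst sum.swap)
    qed
  qed (use sym in auto)
  moreover have "a0 x * u x \<le> 0" using assms by (simp add: mult_nonneg_nonpos)
  ultimately show ?thesis
    unfolding elliptic_op_has_jet2[OF jet] has_jet2_local_min(1)[OF jet min] by simp
qed

section \<open>Derivatives up to the boundary\<close>

lemma holder_on_imp_continuous_on:
  assumes "0 < \<mu>" "holder_on \<mu> S g"
  shows "continuous_on S g"
  unfolding continuous_on_def
proof
  fix x assume x: "x \<in> S"
  obtain C where C: "\<And>x y. x \<in> S \<Longrightarrow> y \<in> S \<Longrightarrow> \<bar>g x - g y\<bar> \<le> C * norm (x - y) powr \<mu>"
    using assms(2) unfolding holder_on_def by blast
  have "((\<lambda>y. C * norm (y - x) powr \<mu>) \<longlongrightarrow> C * 0) (at x within S)"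
  proof (intro tendsto_mult_left)
    have "((\<lambda>y. norm (y - x)) \<longlongrightarrow> 0) (at x within S)"
      by (rule tendsto_eq_intros refl | simp)+
    then have "((\<lambda>y. norm (y - x) powr \<mu>) \<longlongrightarrow> 0 powr \<mu>) (at x within S)"
      using assms(1) by (intro tendsto_powr2) auto
    then show "((\<lambda>y. norm (y - x) powr \<mu>) \<longlongrightarrow> 0) (at x within S)" by simp
  qed
  then have "((\<lambda>y. C * norm (y - x) powr \<mu>) \<longlongrightarrow> 0) (at x within S)" by simp
  then have "((\<lambda>y. g y - g x) \<longlongrightarrow> 0) (at x within S)"
    by (rule Lim_null_comparison[rotated]) (use C x in \<open>auto simp: eventually_at_filter\<close>)
  then show "(g \<longlongrightarrow> g x) (at x within S)" by (simp add: LIM_zero_iff)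
qed

text \<open>Gradient and Hessian rows are explicit arguments so that their continuous extensions can
  be evaluated at points of \<open>S\<close> outside \<open>D\<close>, where they need not be
  derivatives of \<open>u\<close>.\<close>

definition C2_with :: "(real^'m) set \<Rightarrow> (real^'m) set \<Rightarrow> (real^'m \<Rightarrow> real) \<Rightarrow> (real^'m \<Rightarrow> real^'m) \<Rightarrow>
    ('m \<Rightarrow> real^'m \<Rightarrow> real^'m) \<Rightarrow> bool" where
  "C2_with D S u G H \<longleftrightarrow> continuous_on S u \<and> (\<forall>j. continuous_on S (\<lambda>x. G x $ j)) \<and>
     (\<forall>j l. continuous_on S (\<lambda>x. H j x $ l)) \<and>
     (\<forall>x\<in>D. (u has_derivative (\<lambda>v. G x \<bullet> v)) (at x) \<and>
        (\<forall>j. ((\<lambda>y. G y $ j) has_derivative (\<lambda>v. H j x \<bullet> v)) (at x)))"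

lemma holder_class_2_imp_C2_with:
  assumes "holder_class 2 \<mu> D S u" "0 < \<mu>"
  shows "\<exists>G H. C2_with D S u G H"
proof -
  obtain G where G: "continuous_on S u" "\<And>x. x \<in> D \<Longrightarrow> (u has_derivative (\<lambda>v. G x \<bullet> v)) (at x)"
    "\<And>j. holder_class 1 \<mu> D S (\<lambda>x. G x $ j)"
    using assms by (auto simp: numeral_2_eq_2)
  have "\<forall>j. \<exists>H. (\<forall>x\<in>D. ((\<lambda>y. G y $ j) has_derivative (\<lambda>v. H x \<bullet> v)) (at x)) \<and>
      (\<forall>l. holder_on \<mu> S (\<lambda>x. H x $ l))"
    using G(3) by auto
  then obtain H where H: "\<And>x j. x \<in> D \<Longrightarrow> ((\<lambda>y. G y $ j) has_derivative (\<lambda>v. H j x \<bullet> v)) (at x)"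
    "\<And>j l. holder_on \<mu> S (\<lambda>x. H j x $ l)" by metis
  have "continuous_on S (\<lambda>x. G x $ j)" for j using G(3)[of j] by simp
  with G(1,2) H(1) holder_on_imp_continuous_on[OF assms(2) H(2)] show ?thesis
    unfolding C2_with_def by blast
qed

lemma has_jet2_C2_with:
  assumes "open D" "x \<in> D" "C2_with D S u G H"
  shows "has_jet2 u x (G x) (\<lambda>j. H j x)"
  unfolding has_jet2_def by (intro exI[of _ D] exI[of _ G]) (use assms in \<open>auto simp: C2_with_def\<close>)

text \<open>At a boundary point \<open>u\<close> is only known to be continuous. The mean value
  theorem on the inward segment expresses the quotient by the gradient at an inner point, and
  continuity of the extended gradient gives the limit.\<close>

lemma tendsto_outward_difference_quotient:
  fixes \<Omega> :: "(real^'m) set"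
  assumes u: "continuous_on (closure \<Omega>) u"
    and du: "\<And>y. y \<in> \<Omega> \<Longrightarrow> (u has_derivative (\<lambda>v. G y \<bullet> v)) (at y)"
    and G: "\<And>j. continuous_on (closure \<Omega>) (\<lambda>y. G y $ j)"
    and x: "x \<in> closure \<Omega>" and inw: "eventually (\<lambda>t. x - t *\<^sub>R n \<in> \<Omega>) (at_right 0)"
  shows "((\<lambda>t. (u x - u (x - t *\<^sub>R n)) / t) \<longlongrightarrow> G x \<bullet> n) (at_right 0)"
proof -
  obtain d where d0: "d > 0" "\<And>t. 0 < t \<Longrightarrow> t < d \<Longrightarrow> x - t *\<^sub>R n \<in> \<Omega>"
    using inw unfolding eventually_at_right_field by (auto simp: dist_real_def)
  have cl: "x - t *\<^sub>R n \<in> closure \<Omega>" if "0 \<le> t" "t < d" for t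
    using that d0(2)[of t] x closure_subset[of \<Omega>] by (cases "t = 0") auto
  have mvt: "\<exists>z>0. z < t \<and> (u x - u (x - t *\<^sub>R n)) / t = G (x - z *\<^sub>R n) \<bullet> n" if t: "0 < t" "t < d" for t
  proof -
    have c: "continuous_on {0..t} (\<lambda>t. u (x - t *\<^sub>R n))"
      by (rule continuous_on_compose2[OF u]) (use cl t in \<open>auto intro!: continuous_intros\<close>)
    have d: "((\<lambda>t. u (x - t *\<^sub>R n)) has_derivative (*) (- (G (x - z *\<^sub>R n) \<bullet> n))) (at z)"
      if "0 < z" "z < t" for z
      using has_derivative_line[of u "G (x - z *\<^sub>R n)" x z "- n"] du[OF d0(2), of z] that t
      by (simp add: has_field_derivative_def)
    obtain z where "0 < z" "z < t"
      "u (x - t *\<^sub>R n) - u (x - 0 *\<^sub>R n) = - (G (x - z *\<^sub>R n) \<bullet> n) * (t - 0)"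
      by (rule mvt[OF t(1) c d])
    with t show ?thesis by (auto simp: field_simps)
  qed
  have "((\<lambda>z. x - z *\<^sub>R n) \<longlongrightarrow> x) (at_right 0)"
    by (rule tendsto_eq_intros refl | simp)+
  moreover have "\<forall>\<^sub>F z in at_right 0. x - z *\<^sub>R n \<in> closure \<Omega>"
    using inw by (rule eventually_mono) (use closure_subset in auto)
  ultimately have "((\<lambda>z. G (x - z *\<^sub>R n) $ j) \<longlongrightarrow> G x $ j) (at_right 0)" for j
    using continuous_on_tendsto_compose[OF G] x by blast
  then have "((\<lambda>z. G (x - z *\<^sub>R n) \<bullet> n) \<longlongrightarrow> G x \<bullet> n) (at_right 0)"
    by (rule tendsto_inner[OF vec_tendstoI tendsto_const])
  note lim = this
  show ?thesis
  proof (rule tendstoI)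
    fix e :: real assume "e > 0"
    then obtain d' where d': "d' > 0" "\<And>z. 0 < z \<Longrightarrow> z < d' \<Longrightarrow> dist (G (x - z *\<^sub>R n) \<bullet> n) (G x \<bullet> n) < e"
      using tendstoD[OF lim] unfolding eventually_at_right_field by blast
    show "\<forall>\<^sub>F t in at_right 0. dist ((u x - u (x - t *\<^sub>R n)) / t) (G x \<bullet> n) < e"
      unfolding eventually_at_right_field
    proof (intro exI[of _ "min d d'"] conjI allI impI)
      fix t :: real assume "0 < t" "t < min d d'"
      then have t: "0 < t" "t < d" "t < d'" by simp_all
      from mvt[OF t(1,2)] obtain z where "0 < z" "z < t" "(u x - u (x - t *\<^sub>R n)) / t = G (x - z *\<^sub>R n) \<bullet> n"
        by blast
      then show "dist ((u x - u (x - t *\<^sub>R n)) / t) (G x \<bullet> n) < e" using d'(2)[of z] t(3) by simp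
    qed (use d0 d' in auto)
  qed
qed

section \<open>Boundary charts and Hopf's boundary point estimate\<close>

lemma has_derivative_vecI:
  fixes f :: "'a::real_normed_vector \<Rightarrow> real^'n"
  assumes "\<And>j. ((\<lambda>x. f x $ j) has_derivative (\<lambda>v. g j v)) (at a within S)"
  shows "(f has_derivative (\<lambda>v. \<chi> j. g j v)) (at a within S)"
  unfolding has_derivative_componentwise_within[of f]
  using assms by (auto simp: Basis_vec_def cart_eq_inner_axis[symmetric])

text \<open>Were the derivative zero, the straight line in direction \<open>D\<Psi> n\<close> would
  stay in the hyperplane that represents the boundary. Its image under \<open>\<Phi>\<close> would
  be a curve in the frontier whose velocity is \<open>D\<Phi> (D\<Psi> n) = n\<close>, making
  \<open>n\<close> tangent.\<close>

lemma boundary_chart_derivative_nonzero: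
  fixes \<Omega> U V :: "(real^'m) set"
  assumes U: "open U" "x0 \<in> U" and V: "open V" and hom: "homeomorphism U V \<Psi> \<Phi>"
    and d\<Psi>: "\<And>j. ((\<lambda>x. \<Psi> x $ j) has_derivative (\<lambda>v. g j \<bullet> v)) (at x0)"
    and d\<Phi>: "\<And>j. ((\<lambda>y. \<Phi> y $ j) has_derivative (\<lambda>v. g' j \<bullet> v)) (at (\<Psi> x0))"
    and fr: "\<forall>x\<in>U. x \<in> frontier \<Omega> \<longleftrightarrow> \<Psi> x $ k = 0"
    and x0: "x0 \<in> frontier \<Omega>" and n: "n \<notin> tangent_vectors (frontier \<Omega>) x0"
  shows "g k \<bullet> n \<noteq> 0"
proof
  assume gn: "g k \<bullet> n = 0"
  define D\<Psi> where "D\<Psi> v = (\<chi> j. g j \<bullet> v)" for v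
  define D\<Phi> where "D\<Phi> v = (\<chi> j. g' j \<bullet> v)" for v
  have \<Psi>: "(\<Psi> has_derivative D\<Psi>) (at x0)" unfolding D\<Psi>_def by (rule has_derivative_vecI[OF d\<Psi>])
  have \<Phi>: "(\<Phi> has_derivative D\<Phi>) (at (\<Psi> x0))" unfolding D\<Phi>_def by (rule has_derivative_vecI[OF d\<Phi>])
  have \<Phi>\<Psi>: "\<Phi> (\<Psi> x) = x" if "x \<in> U" for x using hom that by (simp add: homeomorphism_def)
  have "((\<lambda>x. \<Phi> (\<Psi> x)) has_derivative (\<lambda>v. D\<Phi> (D\<Psi> v))) (at x0)"
    by (rule has_derivative_compose[OF \<Psi> \<Phi>])
  moreover have "((\<lambda>x. \<Phi> (\<Psi> x)) has_derivative (\<lambda>v. v)) (at x0)"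
    by (rule has_derivative_transform_within_open[OF has_derivative_ident U]) (simp add: \<Phi>\<Psi>)
  ultimately have id: "D\<Phi> (D\<Psi> v) = v" for v by (metis has_derivative_unique)
  define y where "y t = \<Psi> x0 + t *\<^sub>R D\<Psi> n" for t
  have dy: "(y has_derivative (\<lambda>t. t *\<^sub>R D\<Psi> n)) (at 0)"
    unfolding y_def by (auto intro!: derivative_eq_intros)
  have "((\<lambda>t. \<Phi> (y t)) has_derivative (\<lambda>t. D\<Phi> (t *\<^sub>R D\<Psi> n))) (at 0)"
    by (rule has_derivative_compose[OF dy]) (use \<Phi> in \<open>simp add: y_def\<close>)
  then have "((\<lambda>t. \<Phi> (y t)) has_vector_derivative n) (at 0)"
    using id linear_cmul[OF has_derivative_linear[OF \<Phi>]] by (simp add: has_vector_derivative_def)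
  moreover have "\<forall>\<^sub>F t in nhds 0. \<Phi> (y t) \<in> frontier \<Omega>"
  proof -
    have "(y \<longlongrightarrow> \<Psi> x0) (nhds 0)"
      unfolding y_def by (rule tendsto_eq_intros filterlim_ident refl | simp)+
    moreover have "\<Psi> x0 \<in> V" using hom U by (auto simp: homeomorphism_def)
    ultimately have "\<forall>\<^sub>F t in nhds 0. y t \<in> V" using V topological_tendstoD by blast
    then show ?thesis
    proof (rule eventually_mono)
      fix t assume "y t \<in> V"
      then have "\<Phi> (y t) \<in> U" "\<Psi> (\<Phi> (y t)) = y t" using hom by (auto simp: homeomorphism_def)
      moreover have "y t $ k = 0" using fr x0 U gn by (simp add: y_def D\<Psi>_def)
      ultimately show "\<Phi> (y t) \<in> frontier \<Omega>" using fr by simp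
    qed
  qed
  moreover have "\<Phi> (y 0) = x0" using \<Phi>\<Psi> U by (simp add: y_def)
  ultimately have "n \<in> tangent_vectors (frontier \<Omega>) x0"
    unfolding tangent_vectors_def by (intro CollectI exI[of _ "\<lambda>t. \<Phi> (y t)"]) auto
  with n show False by blast
qed

text \<open>The barrier is the straightening coordinate minus a paraboloid, in place of the
  exponential on an annulus. It need not be a subsolution: since \<open>L v\<close> is at least
  \<open>e > 0\<close>, boundedness of the operator on the barrier and a small factor
  \<open>\<kappa>\<close> suffice. Comparison gives \<open>v - v x0 \<ge> \<kappa> \<beta>\<close>
  near \<open>x0\<close>, with equality at \<open>x0\<close>, hence a bound for the outward
  derivative.\<close>

lemma hopf_boundary_point:
  fixes \<Omega> :: "(real^'m) set"
  assumes \<mu>: "0 < \<mu>" and dom: "holder_domain \<mu> \<Omega>" and coeffs: "elliptic_coeffs \<mu> \<Omega> a2 a1 a0"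
    and x0: "x0 \<in> frontier \<Omega>" and n: "n \<notin> tangent_vectors (frontier \<Omega>) x0"
    and inw: "eventually (\<lambda>t. x0 - t *\<^sub>R n \<in> \<Omega>) (at_right 0)"
    and v: "continuous_on (closure \<Omega>) v" and jet: "\<And>x. x \<in> \<Omega> \<Longrightarrow> \<exists>p H. has_jet2 v x p H"
    and e: "0 < e" and Lv: "\<And>x. x \<in> \<Omega> \<Longrightarrow> e \<le> elliptic_op a2 a1 a0 v x"
    and min: "\<And>y. y \<in> closure \<Omega> \<Longrightarrow> v x0 \<le> v y" and v0: "v x0 \<le> 0"
    and lim: "((\<lambda>t. (v x0 - v (x0 - t *\<^sub>R n)) / t) \<longlongrightarrow> l) (at_right 0)"
  shows "l < 0"
proof -
  have "open \<Omega>" using dom by (simp add: holder_domain_def)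
  have sub: "\<Omega> \<subseteq> closure \<Omega>" by (rule closure_subset)
  obtain U and V :: "(real^'m) set" and \<Psi> \<Phi> k where
    chart: "open U \<and> x0 \<in> U \<and> open V \<and> homeomorphism U V \<Psi> \<Phi> \<and>
        (\<forall>j. holder_class 2 \<mu> U U (\<lambda>x. \<Psi> x $ j)) \<and>
        (\<forall>j. holder_class 2 \<mu> V V (\<lambda>y. \<Phi> y $ j)) \<and>
        (\<forall>x\<in>U. x \<in> \<Omega> \<longleftrightarrow> \<Psi> x $ k > 0) \<and>
        (\<forall>x\<in>U. x \<in> frontier \<Omega> \<longleftrightarrow> \<Psi> x $ k = 0)"
    using dom[unfolded holder_domain_def, THEN conjunct2, THEN conjunct2, THEN conjunct2, THEN conjunct2,
      THEN bspec, OF x0]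
    by (elim exE) (rule that)
  from chart have U: "open U" "x0 \<in> U" and V: "open V" and hom: "homeomorphism U V \<Psi> \<Phi>"
    and c\<Psi>: "holder_class 2 \<mu> U U (\<lambda>x. \<Psi> x $ j)" and c\<Phi>: "holder_class 2 \<mu> V V (\<lambda>y. \<Phi> y $ j)"
    and pos: "\<forall>x\<in>U. x \<in> \<Omega> \<longleftrightarrow> \<Psi> x $ k > 0" and fr: "\<forall>x\<in>U. x \<in> frontier \<Omega> \<longleftrightarrow> \<Psi> x $ k = 0" for j
    by simp_all
  define \<psi> where "\<psi> x = \<Psi> x $ k" for x
  obtain G H where C2: "C2_with U U \<psi> G H"
    using holder_class_2_imp_C2_with[OF c\<Psi>[of k, folded \<psi>_def] \<mu>] by blast
  then have \<psi>: "continuous_on U \<psi>" and G: "\<And>x. x \<in> U \<Longrightarrow> (\<psi> has_derivative (\<lambda>v. G x \<bullet> v)) (at x)"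
    and Gc: "\<And>j. continuous_on U (\<lambda>x. G x $ j)" and Hc: "\<And>j l. continuous_on U (\<lambda>x. H j x $ l)"
    by (simp_all add: C2_with_def)
  have "\<exists>g. ((\<lambda>x. \<Psi> x $ j) has_derivative (\<lambda>v. g \<bullet> v)) (at x0)" for j
    using holder_class_2_imp_C2_with[OF c\<Psi>[of j] \<mu>] U(2) unfolding C2_with_def by blast
  then obtain g where g: "\<And>j. ((\<lambda>x. \<Psi> x $ j) has_derivative (\<lambda>v. g j \<bullet> v)) (at x0)" by metis
  have \<Psi>x0: "\<Psi> x0 \<in> V" using hom U by (auto simp: homeomorphism_def)
  have "\<exists>g. ((\<lambda>y. \<Phi> y $ j) has_derivative (\<lambda>v. g \<bullet> v)) (at (\<Psi> x0))" for j
    using holder_class_2_imp_C2_with[OF c\<Phi>[of j] \<mu>] \<Psi>x0 unfolding C2_with_def by blast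
  then obtain g' where g': "\<And>j. ((\<lambda>y. \<Phi> y $ j) has_derivative (\<lambda>v. g' j \<bullet> v)) (at (\<Psi> x0))" by metis
  have "g k \<bullet> n = G x0 \<bullet> n"
    using has_derivative_unique[OF g[of k, folded \<psi>_def] G[OF U(2)]] by metis
  with boundary_chart_derivative_nonzero[OF U V hom g g' fr x0 n] have Gn0: "G x0 \<bullet> n \<noteq> 0" by simp
  have \<psi>0: "\<psi> x0 = 0" using fr x0 U by (simp add: \<psi>_def)

  obtain r where r: "r > 0" "cball x0 r \<subseteq> U" using U open_contains_cball by blast
  let ?B = "cball x0 r"
  let ?W = "closure \<Omega> \<inter> ?B"
  have "compact ?W" by (simp add: closed_Int_compact)
  have \<psi>B: "continuous_on ?B \<psi>" using \<psi> r continuous_on_subset by blast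
  have "bounded (\<psi> ` ?B)" by (rule compact_imp_bounded[OF compact_continuous_image[OF \<psi>B]]) simp
  then obtain M where M: "\<And>x. x \<in> ?B \<Longrightarrow> \<bar>\<psi> x\<bar> \<le> M" by (auto simp: bounded_iff simp del: mem_cball)
  \<comment> \<open>With this constant the paraboloid equals \<open>M\<close> on the sphere of
    radius \<open>r\<close>, which is an upper bound for \<open>\<psi>\<close> there.\<close>
  define N where "N = M / r\<^sup>2"
  \<comment> \<open>barrier: nonpositive on the boundary of the domain and on the sphere of radius \<open>r\<close>\<close>
  define \<beta> where "\<beta> y = \<psi> y + (- N) * (norm (y - x0))\<^sup>2" for y
  \<comment> \<open>An explicit formula for the operator applied to the barrier. It is continuous up
    to the boundary points in \<open>?W\<close>, so compactness bounds it.\<close>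
  define Lb where "Lb x = - (\<Sum>j\<in>UNIV. \<Sum>l\<in>UNIV. a2 j l x * (H l x + (- N) *\<^sub>R 2 *\<^sub>R axis l 1) $ j)
    + (\<Sum>j\<in>UNIV. a1 j x * (G x + (- N) *\<^sub>R 2 *\<^sub>R (x - x0)) $ j) + a0 x * \<beta> x" for x
  have \<beta>jet: "has_jet2 \<beta> x (G x + (- N) *\<^sub>R (2 *\<^sub>R (x - x0))) (\<lambda>j. H j x + (- N) *\<^sub>R (2 *\<^sub>R axis j 1))"
    if "x \<in> U" for x
    unfolding \<beta>_def
    by (rule has_jet2_add_mult[OF has_jet2_C2_with[OF U(1) that C2] has_jet2_norm_power2])
  have L\<beta>: "elliptic_op a2 a1 a0 \<beta> x = Lb x" if "x \<in> U" for x
    unfolding elliptic_op_has_jet2[OF \<beta>jet[OF that]] Lb_def by simp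
  have "continuous_on ?W Lb"
  proof -
    have "holder_on \<mu> (closure \<Omega>) (a2 j i)" "holder_on \<mu> (closure \<Omega>) (a1 j)" "holder_on \<mu> (closure \<Omega>) a0"
      for i j using coeffs by (simp_all add: elliptic_coeffs_def)
    note a = this[THEN holder_on_imp_continuous_on[OF \<mu>], THEN continuous_on_subset, OF Int_lower1]
    have GH: "continuous_on ?W (\<lambda>x. G x $ j)" "continuous_on ?W (\<lambda>x. H i x $ j)" "continuous_on ?W \<psi>" for i j
      by (rule continuous_on_subset[OF Gc] continuous_on_subset[OF Hc] continuous_on_subset[OF \<psi>];
          use r in blast)+
    show ?thesis
      unfolding Lb_def \<beta>_def by (auto intro!: continuous_intros a GH)
  qed
  then have "bounded (Lb ` ?W)" using \<open>compact ?W\<close> by (intro compact_imp_bounded compact_continuous_image)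
  then obtain C where C: "C > 0" "\<And>x. x \<in> ?W \<Longrightarrow> \<bar>Lb x\<bar> \<le> C" by (auto simp: bounded_pos)
  \<comment> \<open>With this factor the barrier consumes at most half of the strict inequality
    \<open>e \<le> L v\<close>.\<close>
  define \<kappa> where "\<kappa> = e / (2 * C)"
  have \<kappa>: "\<kappa> > 0" using e C by (simp add: \<kappa>_def)
  define w where "w y = (v y + (- 1) * v x0) + (- \<kappa>) * \<beta> y" for y
  have w_nonneg: "0 \<le> w y" if y: "y \<in> ?W" for y
  proof (rule ccontr)
    assume "\<not> 0 \<le> w y"
    have "continuous_on ?W w" unfolding w_def \<beta>_def
      by (intro continuous_intros continuous_on_subset[OF v] continuous_on_subset[OF \<psi>B]) auto
    then obtain x1 where x1: "x1 \<in> ?W" "\<And>y. y \<in> ?W \<Longrightarrow> w x1 \<le> w y"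
      using continuous_attains_inf[OF \<open>compact ?W\<close>, of w] y by blast
    have neg: "w x1 < 0" using x1(2)[OF y] \<open>\<not> 0 \<le> w y\<close> by simp
    \<comment> \<open>Where the barrier is not positive, \<open>w \<ge> v - v x0 \<ge> 0\<close>. A
      negative minimum therefore needs \<open>\<beta> x1 > 0\<close>, which excludes both the
      boundary of the domain and the sphere, so it is an interior local minimum.\<close>
    have "\<beta> x1 > 0"
    proof (rule ccontr)
      assume "\<not> \<beta> x1 > 0"
      then have "\<kappa> * \<beta> x1 \<le> 0" using \<kappa> by (simp add: mult_nonneg_nonpos)
      then show False using neg min[of x1] x1(1) by (simp add: w_def)
    qed
    have N0: "N \<ge> 0" using M[of x0] r by (auto simp: N_def)
    have "0 \<le> N * (norm (x1 - x0))\<^sup>2" using N0 by simp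
    then have "\<psi> x1 > 0" using \<open>\<beta> x1 > 0\<close> unfolding \<beta>_def by linarith
    then have x1\<Omega>: "x1 \<in> \<Omega>" using pos x1(1) r by (auto simp: \<psi>_def)
    have "norm (x1 - x0) \<noteq> r"
    proof
      assume "norm (x1 - x0) = r"
      then have "\<beta> x1 = \<psi> x1 - M" using r by (simp add: \<beta>_def N_def)
      then show False using \<open>\<beta> x1 > 0\<close> M[of x1] x1(1) by auto
    qed
    then have x1r: "x1 \<in> ball x0 r" using x1(1) by (simp add: dist_norm norm_minus_commute)
    obtain p J where vjet: "has_jet2 v x1 p J" using jet x1\<Omega> by blast
    have x1U: "x1 \<in> U" using x1(1) r by blast
    note j1 = has_jet2_add_mult[OF vjet has_jet2_const]
    note j2 = has_jet2_add_mult[OF j1 \<beta>jet[OF x1U]]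
    have "\<forall>\<^sub>F y in nhds x1. y \<in> \<Omega> \<inter> ball x0 r"
      using \<open>open \<Omega>\<close> x1\<Omega> x1r by (intro eventually_nhds_in_open) auto
    then have "\<forall>\<^sub>F y in nhds x1. w x1 \<le> w y"
      by (rule eventually_mono) (use x1(2) sub in auto)
    moreover obtain \<mu>0 where "\<mu>0 > 0" "\<And>\<xi> :: real^'m. \<mu>0 * (norm \<xi>)\<^sup>2 \<le> (\<Sum>j\<in>UNIV. \<Sum>l\<in>UNIV. a2 j l x1 * \<xi> $ j * \<xi> $ l)"
      using coeffs x1\<Omega> unfolding elliptic_coeffs_def by blast
    moreover have "0 \<le> a0 x1" "\<And>j l. a2 j l x1 = a2 l j x1"
      using coeffs x1(1) unfolding elliptic_coeffs_def by auto
    ultimately have "elliptic_op a2 a1 a0 w x1 \<le> 0"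
      using elliptic_op_nonpos_at_min[where u = w and x = x1, OF j2[of "-1" "v x0" "-\<kappa>", folded w_def]] neg
      by auto
    moreover have "elliptic_op a2 a1 a0 w x1
        = elliptic_op a2 a1 a0 v x1 - a0 x1 * v x0 - \<kappa> * Lb x1"
      unfolding w_def elliptic_op_add_mult[OF j1 \<beta>jet[OF x1U]] elliptic_op_add_mult[OF vjet has_jet2_const]
        elliptic_op_has_jet2[OF has_jet2_const] L\<beta>[OF x1U] by simp
    \<comment> \<open>Subtracting the constant \<open>v x0 \<le> 0\<close> can only increase the
      operator value, so \<open>L w\<close> is at least \<open>e - \<kappa> C = e / 2\<close> at
      \<open>x1\<close>.\<close>
    moreover have "a0 x1 * v x0 \<le> 0" using \<open>0 \<le> a0 x1\<close> v0 by (simp add: mult_nonneg_nonpos)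
    moreover have "\<kappa> * Lb x1 \<le> \<kappa> * C" using C(2)[OF x1(1)] \<kappa> by (intro mult_left_mono) auto
    moreover have "\<kappa> * C = e / 2" using C by (simp add: \<kappa>_def)
    ultimately show False using Lv[OF x1\<Omega>] e by simp
  qed

  have x0c: "x0 \<in> closure \<Omega>" using x0 by (simp add: frontier_def)
  have toB: "\<forall>\<^sub>F t in at_right 0. x0 - t *\<^sub>R n \<in> ?B"
  proof -
    have "((\<lambda>t. x0 - t *\<^sub>R n) \<longlongrightarrow> x0) (at_right 0)" by (rule tendsto_eq_intros refl | simp)+
    then have "\<forall>\<^sub>F t in at_right 0. x0 - t *\<^sub>R n \<in> ball x0 r"
      by (rule topological_tendstoD) (use r in auto)
    then show ?thesis by (rule eventually_mono) auto
  qed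
  have quot: "\<forall>\<^sub>F t in at_right 0. (v x0 - v (x0 - t *\<^sub>R n)) / t \<le> - \<kappa> * (\<psi> (x0 - t *\<^sub>R n) / t - N * t * (norm n)\<^sup>2)"
    using inw toB eventually_at_right_less
  proof eventually_elim
    case (elim t)
    then have "0 \<le> w (x0 - t *\<^sub>R n)" using w_nonneg sub by blast
    moreover have "w (x0 - t *\<^sub>R n) = v (x0 - t *\<^sub>R n) - v x0 - \<kappa> * (\<psi> (x0 - t *\<^sub>R n) - N * (t * t * (norm n)\<^sup>2))"
      using elim by (simp add: w_def \<beta>_def power2_eq_square mult_ac)
    ultimately have "v x0 - v (x0 - t *\<^sub>R n) \<le> - \<kappa> * (\<psi> (x0 - t *\<^sub>R n) - N * (t * t * (norm n)\<^sup>2))"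
      by simp
    then have "(v x0 - v (x0 - t *\<^sub>R n)) / t \<le> (- \<kappa> * (\<psi> (x0 - t *\<^sub>R n) - N * (t * t * (norm n)\<^sup>2))) / t"
      using elim by (intro divide_right_mono) auto
    also have "\<dots> = - \<kappa> * (\<psi> (x0 - t *\<^sub>R n) / t - N * t * (norm n)\<^sup>2)"
      using elim by (simp add: field_simps)
    finally show ?case .
  qed
  have \<psi>lim: "((\<lambda>t. \<psi> (x0 - t *\<^sub>R n) / t) \<longlongrightarrow> - (G x0 \<bullet> n)) (at_right 0)"
  proof -
    have "((\<lambda>t. \<psi> (x0 - t *\<^sub>R n)) has_real_derivative - (G x0 \<bullet> n)) (at 0)"
      using has_derivative_line[of \<psi> "G x0" x0 0 "- n"] G[OF U(2)] by simp
    then have "((\<lambda>t. (\<psi> (x0 - t *\<^sub>R n) - \<psi> x0) / t) \<longlongrightarrow> - (G x0 \<bullet> n)) (at 0)"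
      by (simp add: has_field_derivative_iff)
    then show ?thesis using \<psi>0 by (auto intro: tendsto_mono[OF at_le])
  qed
  have "((\<lambda>t. - \<kappa> * (\<psi> (x0 - t *\<^sub>R n) / t - N * t * (norm n)\<^sup>2)) \<longlongrightarrow> - \<kappa> * (- (G x0 \<bullet> n) - N * 0 * (norm n)\<^sup>2)) (at_right 0)"
    by (intro tendsto_intros \<psi>lim)
  from tendsto_le[OF _ this lim quot] have "l \<le> \<kappa> * (G x0 \<bullet> n)" by simp
  \<comment> \<open>The inward segment enters the set where \<open>\<psi>\<close> is positive, which
    gives the weak sign; nontangency of \<open>n\<close> makes it strict.\<close>
  moreover have "0 \<le> - (G x0 \<bullet> n)"
  proof (rule tendsto_lowerbound[OF \<psi>lim])
    show "\<forall>\<^sub>F t in at_right 0. 0 \<le> \<psi> (x0 - t *\<^sub>R n) / t"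
      using inw toB eventually_at_right_less
    proof eventually_elim
      case (elim t)
      then have "\<psi> (x0 - t *\<^sub>R n) > 0" using pos r(2) unfolding \<psi>_def by blast
      with elim show ?case by simp
    qed
  qed simp
  ultimately show ?thesis using mult_pos_neg[OF \<kappa>, of "G x0 \<bullet> n"] Gn0 by linarith
qed

text \<open>Because \<open>\<psi>\<close> has zero boundary data, the perturbed function
  \<open>v = u + e \<psi>\<close> keeps the data \<open>\<zeta>\<close> while its operator value is
  at least \<open>e\<close>. At a negative boundary minimum, the Dirichlet condition gives
  \<open>v = \<zeta> \<ge> 0\<close>, and the derivative conditions give a sum of a nonpositive and
  a negative term equal to \<open>\<zeta> \<ge> 0\<close>. Both are impossible.\<close>

lemma classical_solution_nonneg:
  fixes \<Omega> :: "(real^'m) set"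
  assumes \<mu>: "0 < \<mu>" and dom: "holder_domain \<mu> \<Omega>" and coeffs: "elliptic_coeffs \<mu> \<Omega> a2 a1 a0"
    and field: "outward_field \<mu> \<Omega> \<nu>" and bc: "boundary_coeffs \<mu> \<Omega> a0 b d"
    and \<psi>: "classical_solution \<mu> \<Omega> (elliptic_op a2 a1 a0) (boundary_op \<nu> b d) (\<lambda>x. 1) (\<lambda>x. 0) \<psi>"
    and u: "classical_solution \<mu> \<Omega> (elliptic_op a2 a1 a0) (boundary_op \<nu> b d) g \<zeta> u"
    and g: "\<And>x. x \<in> \<Omega> \<Longrightarrow> 0 \<le> g x" and \<zeta>: "\<And>x. x \<in> frontier \<Omega> \<Longrightarrow> 0 \<le> \<zeta> x"
    and x: "x \<in> closure \<Omega>"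
  shows "0 \<le> u x"
proof -
  have "open \<Omega>" "bounded \<Omega>" using dom by (simp_all add: holder_domain_def)
  obtain Gu Hu where uC2: "C2_with \<Omega> (closure \<Omega>) u Gu Hu"
    using holder_class_2_imp_C2_with \<mu> u unfolding classical_solution_def by blast
  obtain G\<psi> H\<psi> where \<psi>C2: "C2_with \<Omega> (closure \<Omega>) \<psi> G\<psi> H\<psi>"
    using holder_class_2_imp_C2_with \<mu> \<psi> unfolding classical_solution_def by blast
  have nonneg: "0 \<le> u y + e * \<psi> y" if e: "e > 0" and y: "y \<in> closure \<Omega>" for e y
  proof (rule ccontr)
    assume "\<not> 0 \<le> u y + e * \<psi> y"
    define v where "v y = u y + e * \<psi> y" for y
    have vc: "continuous_on (closure \<Omega>) v"
      using uC2 \<psi>C2 unfolding v_def C2_with_def by (intro continuous_intros) auto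
    have "compact (closure \<Omega>)" "closure \<Omega> \<noteq> {}" using \<open>bounded \<Omega>\<close> y by auto
    from continuous_attains_inf[OF this vc]
    obtain x0 where x0: "x0 \<in> closure \<Omega>" and min: "\<And>y. y \<in> closure \<Omega> \<Longrightarrow> v x0 \<le> v y" by blast
    have neg: "v x0 < 0" using min[OF y] \<open>\<not> 0 \<le> u y + e * \<psi> y\<close> by (simp add: v_def)
    have ju: "has_jet2 u z (Gu z) (\<lambda>j. Hu j z)" and j\<psi>: "has_jet2 \<psi> z (G\<psi> z) (\<lambda>j. H\<psi> j z)" if "z \<in> \<Omega>" for z
      using has_jet2_C2_with[OF \<open>open \<Omega>\<close> that] uC2 \<psi>C2 by blast+
    have jv: "has_jet2 v z (Gu z + e *\<^sub>R G\<psi> z) (\<lambda>j. Hu j z + e *\<^sub>R H\<psi> j z)" if "z \<in> \<Omega>" for z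
      using has_jet2_add_mult[OF ju[OF that] j\<psi>[OF that]] unfolding v_def .
    have Lv: "e \<le> elliptic_op a2 a1 a0 v z" if "z \<in> \<Omega>" for z
    proof -
      have "elliptic_op a2 a1 a0 v z = g z + e * 1"
        using elliptic_op_add_mult[OF ju[OF that] j\<psi>[OF that], of a2 a1 a0 e] u \<psi> that
        unfolding v_def classical_solution_def by simp
      then show ?thesis using g[OF that] by simp
    qed
    show False
    proof (cases "x0 \<in> \<Omega>")
      case True
      have "\<forall>\<^sub>F y in nhds x0. y \<in> \<Omega>" using \<open>open \<Omega>\<close> True by (intro eventually_nhds_in_open) auto
      then have ev: "\<forall>\<^sub>F y in nhds x0. v x0 \<le> v y"
        by (rule eventually_mono) (use min closure_subset in auto)
      obtain \<mu>0 where "\<mu>0 > 0" "\<And>\<xi> :: real^'m. \<mu>0 * (norm \<xi>)\<^sup>2 \<le> (\<Sum>j\<in>UNIV. \<Sum>l\<in>UNIV. a2 j l x0 * \<xi> $ j * \<xi> $ l)"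
        using coeffs True unfolding elliptic_coeffs_def by blast
      moreover have "0 \<le> a0 x0" "\<And>j l. a2 j l x0 = a2 l j x0"
        using coeffs x0 unfolding elliptic_coeffs_def by auto
      ultimately have "elliptic_op a2 a1 a0 v x0 \<le> 0"
        using elliptic_op_nonpos_at_min[OF jv[OF True] ev] neg by auto
      then show False using Lv[OF True] e by simp
    next
      case False
      then have fr: "x0 \<in> frontier \<Omega>" using x0 \<open>open \<Omega>\<close> by (simp add: frontier_def interior_open)
      define n where "n = \<nu> x0"
      have n: "n \<notin> tangent_vectors (frontier \<Omega>) x0"
        and inw: "eventually (\<lambda>t. x0 - t *\<^sub>R n \<in> \<Omega>) (at_right 0)"
        using field fr unfolding outward_field_def n_def by (auto elim: eventually_mono)
      have qu: "((\<lambda>t. (u x0 - u (x0 - t *\<^sub>R n)) / t) \<longlongrightarrow> Gu x0 \<bullet> n) (at_right 0)"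
        by (rule tendsto_outward_difference_quotient) (use uC2 x0 inw in \<open>simp_all add: C2_with_def\<close>)
      have q\<psi>: "((\<lambda>t. (\<psi> x0 - \<psi> (x0 - t *\<^sub>R n)) / t) \<longlongrightarrow> G\<psi> x0 \<bullet> n) (at_right 0)"
        by (rule tendsto_outward_difference_quotient) (use \<psi>C2 x0 inw in \<open>simp_all add: C2_with_def\<close>)
      have "((\<lambda>t. (u x0 - u (x0 - t *\<^sub>R n)) / t + e * ((\<psi> x0 - \<psi> (x0 - t *\<^sub>R n)) / t))
          \<longlongrightarrow> Gu x0 \<bullet> n + e * (G\<psi> x0 \<bullet> n)) (at_right 0)"
        by (intro tendsto_intros qu q\<psi>)
      then have qv: "((\<lambda>t. (v x0 - v (x0 - t *\<^sub>R n)) / t) \<longlongrightarrow> Gu x0 \<bullet> n + e * (G\<psi> x0 \<bullet> n)) (at_right 0)"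
        by (simp add: v_def algebra_simps add_divide_distrib diff_divide_distrib)
      have hopf: "Gu x0 \<bullet> n + e * (G\<psi> x0 \<bullet> n) < 0"
        using hopf_boundary_point[OF \<mu> dom coeffs fr n inw vc _ e Lv min _ qv] jv neg by (meson less_imp_le)
      \<comment> \<open>\<open>outward_deriv\<close> is a \<open>Lim\<close> and hence additive only
        once the limits of both quotients are known to exist.\<close>
      have "outward_deriv \<nu> u x0 = Gu x0 \<bullet> n" "outward_deriv \<nu> \<psi> x0 = G\<psi> x0 \<bullet> n"
        unfolding outward_deriv_def n_def[symmetric] by (intro tendsto_Lim qu q\<psi>; simp)+
      then have "b x0 * u x0 + real d * (Gu x0 \<bullet> n) = \<zeta> x0" "b x0 * \<psi> x0 + real d * (G\<psi> x0 \<bullet> n) = 0"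
        using u \<psi> fr unfolding classical_solution_def boundary_op_def by auto
      moreover have "b x0 * v x0 + real d * (Gu x0 \<bullet> n + e * (G\<psi> x0 \<bullet> n))
          = (b x0 * u x0 + real d * (Gu x0 \<bullet> n)) + e * (b x0 * \<psi> x0 + real d * (G\<psi> x0 \<bullet> n))"
        by (simp add: v_def algebra_simps)
      ultimately have B: "b x0 * v x0 + real d * (Gu x0 \<bullet> n + e * (G\<psi> x0 \<bullet> n)) = \<zeta> x0" by simp
      \<comment> \<open>The Neumann and the oblique case merge, as both provide
        \<open>0 \<le> b x0\<close>.\<close>
      consider "d = 0" "b x0 = 1" | "d = 1" "0 \<le> b x0"
        using bc fr unfolding boundary_coeffs_def by force
      then show False
      proof cases
        case 1
        then show False using B neg \<zeta>[OF fr] by simp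
      next
        case 2
        have "b x0 * v x0 \<le> 0" using 2 neg by (simp add: mult_nonneg_nonpos)
        then show False using B hopf \<zeta>[OF fr] 2 by simp
      qed
    qed
  qed
  show "0 \<le> u x"
  proof (rule ccontr)
    assume "\<not> 0 \<le> u x"
    \<comment> \<open>This size ensures \<open>e * \<psi> x \<le> - u x / 2\<close>, so the
      perturbed value would still be negative.\<close>
    define e where "e = - u x / (2 * (\<bar>\<psi> x\<bar> + 1))"
    have e: "e > 0" using \<open>\<not> 0 \<le> u x\<close> by (simp add: e_def field_simps)
    have "e * \<psi> x \<le> e * (\<bar>\<psi> x\<bar> + 1)" using e by (intro mult_left_mono) auto
    also have "\<dots> = - u x / 2" by (simp add: e_def field_simps)
    finally show False using nonneg[OF e x] \<open>\<not> 0 \<le> u x\<close> by simp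
  qed
qed

section \<open>Superposition operators and the supremum norm\<close>

lemma uniform_limit_const_tendsto:
  "(c \<longlongrightarrow> l) F \<Longrightarrow> uniform_limit D (\<lambda>k x. c k) (\<lambda>x. l) F"
  by (auto simp: uniform_limit_iff tendsto_iff elim!: allE eventually_mono)

lemma uniform_limit_Pair:
  assumes "uniform_limit D f l F" "uniform_limit D g m F"
  shows "uniform_limit D (\<lambda>k x. (f k x, g k x)) (\<lambda>x. (l x, m x)) F"
proof (rule uniform_limitI)
  fix e :: real assume "e > 0"
  then have "\<forall>\<^sub>F k in F. \<forall>x\<in>D. dist (f k x) (l x) < e / 2" "\<forall>\<^sub>F k in F. \<forall>x\<in>D. dist (g k x) (m x) < e / 2"
    using assms uniform_limitD half_gt_zero by blast+
  then show "\<forall>\<^sub>F k in F. \<forall>x\<in>D. dist (f k x, g k x) (l x, m x) < e"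
  proof eventually_elim
    case (elim k)
    show ?case
    proof
      fix x assume "x \<in> D"
      then have "dist (f k x) (l x) < e / 2" "dist (g k x) (m x) < e / 2" using elim by auto
      moreover have "dist (f k x, g k x) (l x, m x) \<le> dist (f k x) (l x) + dist (g k x) (m x)"
        unfolding dist_Pair_Pair by (rule sqrt_sum_squares_le_sum) auto
      ultimately show "dist (f k x, g k x) (l x, m x) < e" by simp
    qed
  qed
qed

lemma uniform_limit_vec_lambda:
  fixes g :: "'n::finite \<Rightarrow> 'k \<Rightarrow> 'x \<Rightarrow> real"
  assumes "\<And>i. uniform_limit D (g i) (l i) F"
  shows "uniform_limit D (\<lambda>k x. \<chi> i. g i k x) (\<lambda>x. \<chi> i. l i x) F"
proof (rule uniform_limitI)
  fix e :: real assume "e > 0"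
  \<comment> \<open>The Euclidean distance is at most the sum of the \<open>CARD('n)\<close>
    component distances; the factor 2 keeps the final bound strict.\<close>
  define e' where "e' = e / (2 * real CARD('n))"
  have e': "e' > 0" using \<open>e > 0\<close> by (simp add: e'_def)
  have "\<forall>\<^sub>F k in F. \<forall>i. \<forall>x\<in>D. dist (g i k x) (l i x) < e'"
    using uniform_limitD[OF assms e'] by (simp add: eventually_all_finite)
  then show "\<forall>\<^sub>F k in F. \<forall>x\<in>D. dist (\<chi> i. g i k x) (\<chi> i. l i x) < e"
  proof (rule eventually_mono, intro ballI)
    fix k x assume *: "\<forall>i. \<forall>x\<in>D. dist (g i k x) (l i x) < e'" and x: "x \<in> D"
    have "dist (\<chi> i. g i k x) (\<chi> i. l i x) \<le> (\<Sum>i\<in>UNIV. dist (g i k x) (l i x))"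
      unfolding dist_vec_def by (simp add: L2_set_le_sum)
    also have "\<dots> \<le> (\<Sum>i\<in>(UNIV :: 'n set). e')" using * x by (intro sum_mono less_imp_le) auto
    also have "\<dots> = e / 2" by (simp add: e'_def)
    finally show "dist (\<chi> i. g i k x) (\<chi> i. l i x) < e" using \<open>e > 0\<close> by simp
  qed
qed

lemma uniform_limit_min_const:
  fixes g :: "'k \<Rightarrow> 'x \<Rightarrow> real"
  assumes "uniform_limit D g l F"
  shows "uniform_limit D (\<lambda>k x. min (g k x) c) (\<lambda>x. min (l x) c) F"
  by (rule metric_uniform_limit_imp_uniform_limit[OF assms always_eventually], intro allI ballI)
     (unfold dist_real_def, linarith)

lemma superposition_in_C_space:
  assumes "bounded \<Omega>" "u \<in> P_set \<Omega> J" "continuous_on (closure \<Omega> \<times> J \<times> W) f" "w u \<in> W"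
  shows "superposition \<Omega> f w u \<in> C_space \<Omega>"
proof -
  have u: "continuous_on (closure \<Omega>) u" "\<And>x. x \<in> closure \<Omega> \<Longrightarrow> u x \<in> J"
    using assms by (auto simp: P_set_def C_space_iff)
  have "continuous_on (closure \<Omega>) (\<lambda>x. f (x, u x, w u))"
    by (rule continuous_on_compose2[OF assms(3)]) (use u assms(4) in \<open>auto intro!: continuous_intros\<close>)
  then show ?thesis using assms(1) by (auto simp: C_space_iff superposition_def)
qed

text \<open>The arguments \<open>(x, U k x, w (U k))\<close> converge uniformly in \<open>x\<close>
  and stay in a compact set, on which \<open>f\<close> is uniformly continuous.\<close>

lemma uniform_limit_superposition:
  assumes "bounded \<Omega>" "compact J" "compact W" and f: "continuous_on (closure \<Omega> \<times> J \<times> W) f"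
    and w: "continuous_functional \<Omega> J w" "\<And>u. u \<in> P_set \<Omega> J \<Longrightarrow> w u \<in> W"
    and U: "\<And>k. U k \<in> P_set \<Omega> J" "u \<in> P_set \<Omega> J" "uniform_limit (closure \<Omega>) U u sequentially"
  shows "uniform_limit (closure \<Omega>) (\<lambda>k. superposition \<Omega> f w (U k)) (superposition \<Omega> f w u) sequentially"
proof -
  have cpt: "compact (closure \<Omega> \<times> J \<times> W)" using assms(1-3) by (intro compact_Times) auto
  have uc: "uniformly_continuous_on (closure \<Omega> \<times> J \<times> W) f" using f cpt by (intro compact_uniformly_continuous)
  have "(\<lambda>k. w (U k)) \<longlonglongrightarrow> w u" by (rule tendsto_continuous_functional[OF w(1) U])
  then have lim: "uniform_limit (closure \<Omega>) (\<lambda>k x. (x, U k x, w (U k))) (\<lambda>x. (x, u x, w u)) sequentially"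
    by (intro uniform_limit_Pair U uniform_limit_const uniform_limit_const_tendsto)
  have "\<forall>y\<in>closure \<Omega>. (y, U k y, w (U k)) \<in> closure \<Omega> \<times> J \<times> W" for k
    using U(1)[of k] w(2)[OF U(1)[of k]] by (simp add: P_set_def)
  from uniform_limit_compose_uniformly_continuous_on[OF lim uc always_eventually[OF allI[OF this]] compact_imp_closed[OF cpt]]
  show ?thesis
    by (rule uniform_limit_cong'[THEN iffD1, rotated 2]) (auto simp: superposition_def)
qed

lemma superposition_le_SUP:
  assumes "bounded \<Omega>" "compact J" "compact W" "continuous_on (closure \<Omega> \<times> J \<times> W) f"
    and "u \<in> P_set \<Omega> J" "w u \<in> W" "x \<in> closure \<Omega>"
  shows "superposition \<Omega> f w u x \<le> (SUP z\<in>closure \<Omega> \<times> J \<times> W. f z)"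
proof -
  have "compact (f ` (closure \<Omega> \<times> J \<times> W))"
    using assms(1-4) by (intro compact_continuous_image compact_Times) auto
  then show ?thesis
    using assms(5-7) unfolding superposition_def P_set_def
    by (auto intro!: cSUP_upper bounded_imp_bdd_above compact_imp_bounded)
qed

lemma vec_sup_norm_le:
  assumes "\<Omega> \<noteq> {}" "\<And>x i. x \<in> closure \<Omega> \<Longrightarrow> \<bar>u x $ i\<bar> \<le> c"
  shows "vec_sup_norm \<Omega> u \<le> c"
  using assms unfolding vec_sup_norm_def sup_norm_def by (auto intro!: cSUP_least)

lemma abs_le_vec_sup_norm:
  fixes u :: "real^'m \<Rightarrow> real^'n::finite"
  assumes "bounded \<Omega>" "u \<in> C_space \<Omega>" "x \<in> closure \<Omega>"
  shows "\<bar>u x $ i\<bar> \<le> vec_sup_norm \<Omega> u"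
proof -
  have "compact ((\<lambda>x. \<bar>u x $ i\<bar>) ` closure \<Omega>)"
    using assms by (intro compact_continuous_image) (auto simp: C_space_iff intro!: continuous_intros)
  then have "\<bar>u x $ i\<bar> \<le> sup_norm \<Omega> (\<lambda>x. u x $ i)"
    unfolding sup_norm_def using assms(3)
    by (intro cSUP_upper bounded_imp_bdd_above compact_imp_bounded) auto
  also have "\<dots> \<le> vec_sup_norm \<Omega> u" unfolding vec_sup_norm_def by (intro Max_ge) auto
  finally show ?thesis .
qed

text \<open>This makes the forcing strength continuous. The convergence is measured in the Euclidean
  norm of the values, which dominates each component.\<close>

lemma tendsto_vec_sup_norm:
  fixes U :: "nat \<Rightarrow> real^'m \<Rightarrow> real^'n::finite"
  assumes "bounded \<Omega>" "\<Omega> \<noteq> {}" "\<And>k. U k \<in> C_space \<Omega>" "u \<in> C_space \<Omega>"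
    and "uniform_limit (closure \<Omega>) U u sequentially"
  shows "(\<lambda>k. vec_sup_norm \<Omega> (U k)) \<longlonglongrightarrow> vec_sup_norm \<Omega> u"
proof (rule tendstoI)
  fix e :: real assume "e > 0"
  then have "e / 2 > 0" by simp
  from uniform_limitD[OF assms(5) this]
  show "\<forall>\<^sub>F k in sequentially. dist (vec_sup_norm \<Omega> (U k)) (vec_sup_norm \<Omega> u) < e"
  proof (rule eventually_mono)
    fix k assume "\<forall>x\<in>closure \<Omega>. dist (U k x) (u x) < e / 2"
    then have *: "\<bar>U k x $ i - u x $ i\<bar> \<le> e / 2" if "x \<in> closure \<Omega>" for x i
      using that component_le_norm_cart[of "U k x - u x" i] by (force simp: dist_norm)
    have "vec_sup_norm \<Omega> (U k) \<le> vec_sup_norm \<Omega> u + e / 2"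
    proof (rule vec_sup_norm_le[OF assms(2)])
      fix x i assume "x \<in> closure \<Omega>"
      then show "\<bar>U k x $ i\<bar> \<le> vec_sup_norm \<Omega> u + e / 2"
        using *[of x i] abs_le_vec_sup_norm[OF assms(1,4), of x i] by linarith
    qed
    moreover have "vec_sup_norm \<Omega> u \<le> vec_sup_norm \<Omega> (U k) + e / 2"
    proof (rule vec_sup_norm_le[OF assms(2)])
      fix x i assume "x \<in> closure \<Omega>"
      then show "\<bar>u x $ i\<bar> \<le> vec_sup_norm \<Omega> (U k) + e / 2"
        using *[of x i] abs_le_vec_sup_norm[OF assms(1) assms(3)[of k], of x i] by linarith
    qed
    ultimately show "dist (vec_sup_norm \<Omega> (U k)) (vec_sup_norm \<Omega> u) < e"
      using \<open>e > 0\<close> by (simp add: dist_real_def abs_if)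
  qed
qed

lemma C_space_mult:
  fixes g :: "real^'m \<Rightarrow> real"
  assumes "bounded \<Omega>" "g \<in> C_space \<Omega>"
  shows "(\<lambda>y\<in>closure \<Omega>. c * g y) \<in> C_space \<Omega>"
  using assms by (auto simp: C_space_iff intro!: continuous_intros)

lemma positive_operator_mono:
  fixes g g' :: "real^'m \<Rightarrow> real"
  assumes "bounded \<Omega>" and K: "continuous_linear_operator \<Omega> K" "positive_operator \<Omega> K"
    and g: "g \<in> C_space \<Omega>" "g' \<in> C_space \<Omega>" and le: "\<And>x. x \<in> closure \<Omega> \<Longrightarrow> g x \<le> g' x"
    and x: "x \<in> closure \<Omega>"
  shows "K g x \<le> K g' x"
proof -
  define k where "k = (\<lambda>y\<in>closure \<Omega>. g' y - g y)"
  have kC: "k \<in> C_space \<Omega>"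
    using assms(1) g by (auto simp: C_space_iff k_def intro!: continuous_intros)
  have "(\<lambda>y\<in>closure \<Omega>. g y + k y) = g'"
    using g(2) assms(1) by (auto simp: k_def C_space_iff extensional_def fun_eq_iff)
  moreover have "K (\<lambda>y\<in>closure \<Omega>. g y + k y) x = K g x + K k x"
    using K(1) g kC x unfolding continuous_linear_operator_def by blast
  moreover have "0 \<le> K k x"
    using K(2) kC x le unfolding positive_operator_def by (simp add: k_def)
  ultimately show ?thesis by simp
qed

section \<open>Existence of a nonzero solution\<close>

text \<open>Every summand is nonnegative and the minimum caps it from above, so the box is mapped
  into itself. A bound on \<open>f\<close> feeds the compact operators a bounded sequence, while
  \<open>h i u\<close> and the forcing strength range over bounded intervals; convergent
  subsequences of all of them make the image relatively compact.\<close>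

lemma truncated_fixed_point:
  fixes \<Omega> :: "(real^'m) set" and \<rho> :: "real^'n::finite"
  defines "I \<equiv> {v. \<forall>i. v $ i \<in> {0..\<rho> $ i}}"
  assumes \<Omega>: "\<Omega> \<noteq> {}" "bounded \<Omega>"
    and K: "\<And>i. continuous_linear_operator \<Omega> (K i)" "\<And>i. compact_operator \<Omega> (K i)" "\<And>i. positive_operator \<Omega> (K i)"
    and \<gamma>: "\<And>i. \<gamma> i \<in> C_space \<Omega>" "\<And>i x. x \<in> closure \<Omega> \<Longrightarrow> 0 \<le> \<gamma> i x"
    and p: "\<And>i. p i \<in> C_space \<Omega>" and p_nn: "\<And>i x. x \<in> closure \<Omega> \<Longrightarrow> 0 \<le> p i x"
    and lam: "\<And>i. 0 \<le> lam i" and eta: "\<And>i. 0 \<le> eta i" and rho: "\<And>i. 0 < \<rho> $ i" and r0: "0 < r0"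
    and w: "\<And>i. continuous_functional \<Omega> I (w i)" "\<And>i u. u \<in> P_set \<Omega> I \<Longrightarrow> w i u \<in> W i" and W: "\<And>i. compact (W i)"
    and f: "\<And>i. continuous_on (closure \<Omega> \<times> I \<times> W i) (f i)"
    and f_nonneg: "\<And>i z. z \<in> closure \<Omega> \<times> I \<times> W i \<Longrightarrow> 0 \<le> f i z"
    and h_cont: "\<And>i. continuous_functional \<Omega> I (h i)" and h_nonneg: "\<And>i u. u \<in> P_set \<Omega> I \<Longrightarrow> 0 \<le> h i u"
    and h_bounded: "\<And>i. bdd_above (h i ` P_set \<Omega> I)"
  shows "\<exists>u\<in>P_set \<Omega> I. \<forall>x\<in>closure \<Omega>. \<forall>i. u x $ i =
    min (lam i * K i (superposition \<Omega> (f i) (w i) u) x + eta i * h i u * \<gamma> i x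
      + max 0 (r0 - vec_sup_norm \<Omega> u) * p i x) (\<rho> $ i)"
proof -
  define D where "D = closure \<Omega>"
  have D: "compact D" "D \<noteq> {}" using \<Omega> by (simp_all add: D_def)
  have C_iff: "u \<in> C_space \<Omega> \<longleftrightarrow> u \<in> extensional D \<and> continuous_on D u" for u :: "real^'m \<Rightarrow> real"
    unfolding D_def by (rule C_space_iff[OF \<Omega>(2)])
  have C_iff': "u \<in> C_space \<Omega> \<longleftrightarrow> u \<in> extensional D \<and> continuous_on D u" for u :: "real^'m \<Rightarrow> real^'n"
    unfolding D_def by (rule C_space_iff[OF \<Omega>(2)])
  have bdd_real: "bounded (u ` D)" if "u \<in> C_space \<Omega>" for u :: "real^'m \<Rightarrow> real"
    using that D(1) by (auto simp: C_iff intro!: compact_imp_bounded compact_continuous_image)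
  have bdd_vec: "bounded (u ` D)" if "u \<in> C_space \<Omega>" for u :: "real^'m \<Rightarrow> real^'n"
    using that D(1) by (auto simp: C_iff' intro!: compact_imp_bounded compact_continuous_image)
  note KC = continuous_linear_operator_in_C_space[OF K(1)]
  have K_nonneg: "0 \<le> K i g x" if "g \<in> C_space \<Omega>" "\<And>x. x \<in> D \<Longrightarrow> 0 \<le> g x" "x \<in> D" for i g x
    using K(3)[of i] that unfolding positive_operator_def D_def by blast
  have I_box: "I = cbox 0 \<rho>" by (auto simp: I_def mem_box_cart)
  have I: "compact I" "convex I" "closed I" by (simp_all add: I_box closed_cbox compact_cbox)
  define P where "P = P_set \<Omega> I"
  have P_iff: "u \<in> P \<longleftrightarrow> u \<in> extensional D \<and> continuous_on D u \<and> (\<forall>x\<in>D. \<forall>i. 0 \<le> u x $ i \<and> u x $ i \<le> \<rho> $ i)" for u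
    by (auto simp: P_def P_set_def C_iff' I_def D_def)
  have PC: "u \<in> C_space \<Omega>" if "u \<in> P" for u using that by (simp add: P_def P_set_def)
  have w_range: "w i u \<in> W i" if "u \<in> P" for i u using w(2) that by (simp add: P_def)
  define F where "F i u = superposition \<Omega> (f i) (w i) u" for i u
  have FC: "F i u \<in> C_space \<Omega>" if "u \<in> P" for i u
    unfolding F_def using superposition_in_C_space[OF \<Omega>(2) _ f w_range] that by (simp add: P_def)
  have F_nonneg: "0 \<le> F i u x" if "u \<in> P" "x \<in> D" for i u x
    using f_nonneg[of "(x, u x, w i u)" i] w_range that by (simp add: F_def superposition_def P_def P_set_def D_def)
  define M where "M i = (SUP z\<in>closure \<Omega> \<times> I \<times> W i. f i z)" for i
  have F_le: "F i u x \<le> M i" if "u \<in> P" "x \<in> D" for i u x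
    unfolding F_def M_def using that w_range
    by (intro superposition_le_SUP[OF \<Omega>(2) I(1) W f]) (simp_all add: P_def D_def)

  have \<gamma>_nn: "0 \<le> \<gamma> i x" if "x \<in> D" for i x using \<gamma>(2) that by (simp add: D_def)
  define s where "s u = max 0 (r0 - vec_sup_norm \<Omega> u)" for u :: "real^'m \<Rightarrow> real^'n"
  \<comment> \<open>\<open>Q\<close> isolates the data through which \<open>S\<close> depends on
    \<open>u\<close>: the functions \<open>a i\<close> and the scalars \<open>c i\<close> and
    \<open>r\<close>. Continuity and compactness of \<open>S\<close> then both reduce to convergence
    of these data.\<close>
  define Q where "Q a c r x = (\<chi> i. min (lam i * a i x + eta i * c i * \<gamma> i x + r * p i x) (\<rho> $ i))"
    for a :: "'n \<Rightarrow> real^'m \<Rightarrow> real" and c :: "'n \<Rightarrow> real" and r x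
  define S where "S u = (\<lambda>x\<in>D. Q (\<lambda>i. K i (F i u)) (\<lambda>i. h i u) (s u) x)" for u
  have p_bdd: "bounded (p i ` D)" for i
    by (rule bdd_real[OF p])
  have p_cont: "continuous_on D (p i)" for i
    using p by (simp add: C_iff)
  have p_nonneg: "0 \<le> p i x" if "x \<in> D" for i x using p_nn that by (simp add: D_def)
  have s_nonneg: "0 \<le> s u" for u by (simp add: s_def)

  have Q_P: "(\<lambda>x\<in>D. Q a c r x) \<in> P"
    if a: "\<And>i. a i \<in> C_space \<Omega>" "\<And>i x. x \<in> D \<Longrightarrow> 0 \<le> a i x" and c: "\<And>i. 0 \<le> c i" and r: "0 \<le> r" for a c r
  proof -
    have ac: "continuous_on D (a i)" "continuous_on D (\<gamma> i)" for i using a(1) \<gamma>(1) by (simp_all add: C_iff)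
    have "continuous_on D (\<lambda>x. Q a c r x)" unfolding Q_def by (intro continuous_intros ac p_cont)
    moreover have "0 \<le> lam i * a i x + eta i * c i * \<gamma> i x + r * p i x" if "x \<in> D" for i x
      using that by (intro add_nonneg_nonneg mult_nonneg_nonneg a c r lam eta \<gamma>_nn p_nonneg)
    ultimately show ?thesis using rho by (auto simp: P_iff Q_def less_imp_le)
  qed
  have Q_lim: "uniform_limit D (\<lambda>k. \<lambda>x\<in>D. Q (A k) (c k) (r k) x) (\<lambda>x\<in>D. Q a c' r' x) sequentially"
    if "\<And>i. uniform_limit D (\<lambda>k. A k i) (a i) sequentially" "\<And>i. (\<lambda>k. c k i) \<longlonglongrightarrow> c' i" "r \<longlonglongrightarrow> r'"
    for A c r a c' r'
  proof -
    have "uniform_limit D (\<lambda>k x. Q (A k) (c k) (r k) x) (\<lambda>x. Q a c' r' x) sequentially"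
      unfolding Q_def
      by (intro uniform_limit_vec_lambda uniform_limit_min_const uniform_limit_add uniform_lim_mult
          bounded_linear.uniform_limit[OF bounded_linear_mult_right] uniform_limit_const_tendsto
          uniform_limit_const tendsto_mult_left that p_bdd bdd_real[OF \<gamma>(1)])
        (auto simp: image_constant_conv)
    then show ?thesis by (rule uniform_limit_cong'[THEN iffD1, rotated 2]) auto
  qed
  have h_lim: "(\<lambda>k. h i (U k)) \<longlonglongrightarrow> h i u" if "\<And>k. U k \<in> P" "u \<in> P" "uniform_limit D U u sequentially" for i U u
    using tendsto_continuous_functional[OF h_cont] that unfolding P_def D_def by blast
  have h_nn: "0 \<le> h i u" if "u \<in> P" for i u using h_nonneg that by (simp add: P_def)

  have "\<exists>u\<in>P. S u = u"
  proof (rule schauder_uniform_limit)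
    show "P \<subseteq> extensional D" by (auto simp: P_iff)
    show "bounded (u ` D)" if "u \<in> P" for u by (rule bdd_vec[OF PC[OF that]])
    have "(\<lambda>x\<in>D. 0) \<in> P" using rho by (auto simp: P_iff less_imp_le)
    then show "P \<noteq> {}" by blast
    show "S u \<in> P" if "u \<in> P" for u
      unfolding S_def by (intro Q_P KC FC that K_nonneg F_nonneg h_nn s_nonneg)
    show "(\<lambda>x\<in>D. (1 - t) *\<^sub>R u x + t *\<^sub>R v x) \<in> P" if uv: "u \<in> P" "v \<in> P" and t: "0 \<le> t" "t \<le> 1" for u v t
    proof -
      have "(1 - t) *\<^sub>R u x + t *\<^sub>R v x \<in> I" if "x \<in> D" for x
        using uv that t by (intro convexD[OF I(2)]) (auto simp: P_def P_set_def D_def)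
      then show ?thesis
        using uv by (auto simp: P_iff I_def intro!: continuous_intros)
    qed
    show "uniform_limit D (\<lambda>k. S (U k)) (S u) sequentially"
      if U: "\<And>k. U k \<in> P" "u \<in> P" "uniform_limit D U u sequentially" for U u
    proof -
      have "uniform_limit D (\<lambda>k. K i (F i (U k))) (K i (F i u)) sequentially" for i
        unfolding D_def
      proof (rule uniform_limit_continuous_linear_operator[OF K(1)])
        show "uniform_limit (closure \<Omega>) (\<lambda>k. F i (U k)) (F i u) sequentially"
          unfolding F_def
          by (rule uniform_limit_superposition[OF \<Omega>(2) I(1) W f w(1)])
             (use U w_range in \<open>simp_all add: P_def D_def\<close>)
      qed (use FC U in blast)+
      moreover have "(\<lambda>k. s (U k)) \<longlonglongrightarrow> s u"
        unfolding s_def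
        by (intro tendsto_intros tendsto_vec_sup_norm \<Omega> PC U) (use U(3) in \<open>simp add: D_def\<close>)
      ultimately show ?thesis
        unfolding S_def by (intro Q_lim h_lim U)
    qed
    show "\<exists>r v. strict_mono r \<and> v \<in> P \<and> uniform_limit D (\<lambda>k. S (U (r k))) v sequentially"
      if U: "\<And>k. U k \<in> P" for U :: "nat \<Rightarrow> real^'m \<Rightarrow> real^'n"
    proof -
      \<comment> \<open>The forcing strength does not depend on \<open>i\<close>; including it in
        each \<open>conv i\<close> lets one common subsequence handle everything.\<close>
      define conv where "conv i r \<longleftrightarrow> (\<exists>l\<in>C_space \<Omega>. uniform_limit D (\<lambda>k. K i (F i (U (r k)))) l sequentially) \<and>
          convergent (\<lambda>k. h i (U (r k))) \<and> convergent (\<lambda>k. s (U (r k)))" for i and r :: "nat \<Rightarrow> nat"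
      have "\<exists>r. strict_mono r \<and> (\<forall>i\<in>UNIV. conv i r)"
      proof (rule finite_common_subsequence)
        show "conv i (r \<circ> t)" if "conv i r" "strict_mono t" for i and r t :: "nat \<Rightarrow> nat"
          using that convergent_subseq_convergent[OF _ that(2), of "\<lambda>k. h i (U (r k))"]
            convergent_subseq_convergent[OF _ that(2), of "\<lambda>k. s (U (r k))"]
            filterlim_compose[OF _ filterlim_subseq[OF that(2)]]
          unfolding conv_def by (fastforce simp: o_def)
        show "\<exists>t :: nat \<Rightarrow> nat. strict_mono t \<and> conv i (r \<circ> t)" if "strict_mono r" for i and r :: "nat \<Rightarrow> nat"
        proof -
          have "sup_norm \<Omega> (F i (U (r k))) \<le> M i" for k
            unfolding sup_norm_def using D(2) F_nonneg[OF U] F_le[OF U]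
            by (intro cSUP_least) (auto simp: D_def[symmetric])
          then have "\<exists>t l. strict_mono t \<and> l \<in> C_space \<Omega> \<and>
              uniform_limit (closure \<Omega>) (\<lambda>k. K i (F i (U (r (t k))))) l sequentially"
            using compact_operator_subsequence[where g = "\<lambda>k. F i (U (r k))", OF K(1,2) FC[OF U]]
            by blast
          then obtain t1 l where t1: "strict_mono t1" and l: "l \<in> C_space \<Omega>"
            "uniform_limit D (\<lambda>k. K i (F i (U (r (t1 k))))) l sequentially" unfolding D_def by blast
          obtain H where H: "\<And>u. u \<in> P \<Longrightarrow> h i u \<le> H"
            using h_bounded[of i] unfolding bdd_above_def P_def by blast
          have "\<forall>k. h i (U (r (t1 k))) \<in> {0..H}" using H h_nn U by simp
          then obtain c t2 where t2: "strict_mono t2" "((\<lambda>k. h i (U (r (t1 k)))) \<circ> t2) \<longlonglongrightarrow> c"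
            using seq_compactE[OF compact_imp_seq_compact[OF compact_Icc[of 0 H]]] by metis
          have "0 \<le> vec_sup_norm \<Omega> u" if "u \<in> P" for u
          proof -
            obtain y where "y \<in> closure \<Omega>" using D(2) D_def by blast
            from abs_le_vec_sup_norm[OF \<Omega>(2) PC[OF that] this] show ?thesis
              by (meson abs_ge_zero order_trans)
          qed
          then have "\<forall>k. s (U (r (t1 (t2 k)))) \<in> {0..r0}" using r0 U by (simp add: s_def)
          then obtain \<sigma> t3 where t3: "strict_mono t3" "((\<lambda>k. s (U (r (t1 (t2 k))))) \<circ> t3) \<longlonglongrightarrow> \<sigma>"
            using seq_compactE[OF compact_imp_seq_compact[OF compact_Icc[of 0 r0]]] by metis
          let ?t = "t1 \<circ> (t2 \<circ> t3)"
          have mono: "strict_mono (t2 \<circ> t3)" "strict_mono ?t" using t1 t2(1) t3(1) by (simp_all add: strict_mono_o)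
          have "uniform_limit D (\<lambda>k. K i (F i (U ((r \<circ> ?t) k)))) l sequentially"
            using filterlim_compose[OF l(2) filterlim_subseq[OF mono(1)]] by (simp add: o_def)
          moreover have "convergent (\<lambda>k. h i (U ((r \<circ> ?t) k)))"
            using LIMSEQ_subseq_LIMSEQ[OF t2(2) t3(1)] by (auto simp: o_def convergent_def)
          moreover have "convergent (\<lambda>k. s (U ((r \<circ> ?t) k)))"
            using t3(2) by (auto simp: o_def convergent_def)
          ultimately show ?thesis using l(1) mono(2) unfolding conv_def by blast
        qed
      qed simp
      then obtain r where r: "strict_mono r" and conv: "\<And>i. conv i r" by blast
      obtain a c where a: "\<And>i. a i \<in> C_space \<Omega>"
          "\<And>i. uniform_limit D (\<lambda>k. K i (F i (U (r k)))) (a i) sequentially"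
        and c: "\<And>i. (\<lambda>k. h i (U (r k))) \<longlonglongrightarrow> c i"
        using conv unfolding conv_def convergent_def by metis
      obtain \<sigma> where \<sigma>: "(\<lambda>k. s (U (r k))) \<longlonglongrightarrow> \<sigma>" using conv unfolding conv_def convergent_def by blast
      \<comment> \<open>Nonnegativity passes to the limits, so the limiting data again define an
        element of the box.\<close>
      have "0 \<le> a i x" if "x \<in> D" for i x
        by (rule LIMSEQ_le_const[OF tendsto_uniform_limitI[OF a(2) that]])
           (use K_nonneg[OF FC[OF U] F_nonneg[OF U] that] in blast)
      moreover have "0 \<le> c i" for i by (rule LIMSEQ_le_const[OF c]) (use h_nn[OF U] in blast)
      moreover have "0 \<le> \<sigma>" by (rule LIMSEQ_le_const[OF \<sigma>]) (use s_nonneg in blast)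
      ultimately have "(\<lambda>x\<in>D. Q a c \<sigma> x) \<in> P" using a(1) by (intro Q_P)
      moreover have "uniform_limit D (\<lambda>k. S (U (r k))) (\<lambda>x\<in>D. Q a c \<sigma> x) sequentially"
        unfolding S_def by (intro Q_lim a c \<sigma>)
      ultimately show ?thesis using r by blast
    qed
  qed
  then obtain u where u: "u \<in> P" "S u = u" by blast
  have "u x $ i = min (lam i * K i (F i u) x + eta i * h i u * \<gamma> i x + s u * p i x) (\<rho> $ i)" if "x \<in> D" for x i
    using fun_cong[OF u(2), of x] that by (simp add: S_def Q_def vec_eq_iff)
  then show ?thesis using u(1) unfolding P_def D_def F_def s_def by blast
qed

theorem theorem2p3:
  fixes muh :: real
    and \<Omega> :: "(real^'m) set"
    and a2 :: "'n::finite \<Rightarrow> 'm \<Rightarrow> 'm \<Rightarrow> real^'m \<Rightarrow> real"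
    and a1 :: "'n \<Rightarrow> 'm \<Rightarrow> real^'m \<Rightarrow> real"
    and a0 :: "'n \<Rightarrow> real^'m \<Rightarrow> real"
    and \<nu> :: "real^'m \<Rightarrow> real^'m"
    and b :: "'n \<Rightarrow> real^'m \<Rightarrow> real"
    and d :: "'n \<Rightarrow> nat"
    and \<zeta> :: "'n \<Rightarrow> real^'m \<Rightarrow> real"
    and L B :: "'n \<Rightarrow> (real^'m \<Rightarrow> real) \<Rightarrow> real^'m \<Rightarrow> real"
    and K :: "'n \<Rightarrow> (real^'m \<Rightarrow> real) \<Rightarrow> real^'m \<Rightarrow> real"
    and \<gamma> :: "'n \<Rightarrow> real^'m \<Rightarrow> real"
    and mu :: "'n \<Rightarrow> real"
    and lam eta :: "'n \<Rightarrow> real"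
    and \<rho> :: "real^'n"
    and I I0 :: "(real^'n) set"
    and w h :: "'n \<Rightarrow> (real^'m \<Rightarrow> real^'n) \<Rightarrow> real"
    and wlo whi M hbar :: "'n \<Rightarrow> real"
    and f :: "'n \<Rightarrow> (real^'m) \<times> (real^'n) \<times> real \<Rightarrow> real"
    and \<delta> \<rho>0 wlo0 whi0 :: real
    and i0 :: 'n
  \<comment> \<open>domain and operators\<close>
  assumes dim: "CARD('m) \<ge> 2"
    and muh: "0 < muh" "muh < 1"
    and domain: "holder_domain muh \<Omega>"
    and coeffs: "\<And>i. elliptic_coeffs muh \<Omega> (a2 i) (a1 i) (a0 i)"
    and field: "outward_field muh \<Omega> \<nu>"
    and bcoeffs: "\<And>i. boundary_coeffs muh \<Omega> (a0 i) (b i) (d i)"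
    and zeta: "\<And>i. boundary_class (2 - d i) muh \<Omega> (\<zeta> i)"
    and L_def: "\<And>i. L i = elliptic_op (a2 i) (a1 i) (a0 i)"
    and B_def: "\<And>i. B i = boundary_op \<nu> (b i) (d i)"
  \<comment> \<open>solution operators\<close>
    and K: "\<And>i. solution_operator muh \<Omega> (L i) (B i) (K i)"
    and K_compact: "\<And>i. compact_operator \<Omega> (K i)"
    and K_pos: "\<And>i. positive_operator \<Omega> (K i)"
    and radius: "\<And>i. 0 < operator_radius \<Omega> (K i)"
    and mu_def: "\<And>i. mu i = principal_value \<Omega> (K i)"
    and eigenfunction: "\<And>i. \<exists>\<phi>\<in>C_space \<Omega>. (\<forall>x\<in>closure \<Omega>. 0 \<le> \<phi> x) \<and>
           (\<exists>x\<in>closure \<Omega>. \<phi> x \<noteq> 0) \<and> (\<forall>x\<in>closure \<Omega>. \<phi> x = mu i * K i \<phi> x)"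
    and gamma: "\<And>i. unique_classical_solution muh \<Omega> (L i) (B i) (\<lambda>x. 0) (\<zeta> i) (\<gamma> i)"
  \<comment> \<open>parameters\<close>
    and lam: "\<And>i. 0 \<le> lam i"
    and eta: "\<And>i. 0 \<le> eta i"
    and rho: "\<And>i. 0 < \<rho> $ i"
    and I_def: "I = {v. \<forall>i. v $ i \<in> {0..\<rho> $ i}}"
  \<comment> \<open>(a)\<close>
    and w_cont: "\<And>i. continuous_functional \<Omega> I (w i)"
    and w_below: "\<And>i. bdd_below (w i ` P_set \<Omega> I)"
    and w_above: "\<And>i. bdd_above (w i ` P_set \<Omega> I)"
    and wlo_def: "\<And>i. wlo i = (INF u\<in>P_set \<Omega> I. w i u)"
    and whi_def: "\<And>i. whi i = (SUP u\<in>P_set \<Omega> I. w i u)"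
  \<comment> \<open>(b)\<close>
    and f_cont: "\<And>i. continuous_on (closure \<Omega> \<times> I \<times> {wlo i..whi i}) (f i)"
    and f_nonneg: "\<And>i z. z \<in> closure \<Omega> \<times> I \<times> {wlo i..whi i} \<Longrightarrow> 0 \<le> f i z"
    and M_def: "\<And>i. M i = (SUP z\<in>closure \<Omega> \<times> I \<times> {wlo i..whi i}. f i z)"
  \<comment> \<open>(c)\<close>
    and delta: "0 < \<delta>"
    and rho0: "0 < \<rho>0" "\<rho>0 < Min (range (\<lambda>i. \<rho> $ i))"
    and I0_def: "I0 = {v. \<forall>i. v $ i \<in> {0..\<rho>0}}"
    and wlo0_def: "wlo0 = (INF u\<in>P_set \<Omega> I0. w i0 u)"
    and whi0_def: "whi0 = (SUP u\<in>P_set \<Omega> I0. w i0 u)"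
    and f_lower: "\<And>x v s. x \<in> closure \<Omega> \<Longrightarrow> v \<in> I0 \<Longrightarrow> s \<in> {wlo0..whi0} \<Longrightarrow>
           f i0 (x, v, s) \<ge> \<delta> * v $ i0"
  \<comment> \<open>(d)\<close>
    and zeta_nonneg: "\<And>i x. x \<in> frontier \<Omega> \<Longrightarrow> 0 \<le> \<zeta> i x"
    and h_cont: "\<And>i. continuous_functional \<Omega> I (h i)"
    and h_nonneg: "\<And>i u. u \<in> P_set \<Omega> I \<Longrightarrow> 0 \<le> h i u"
    and h_bounded: "\<And>i. bdd_above (h i ` P_set \<Omega> I)"
    and hbar_def: "\<And>i. hbar i = (SUP u\<in>P_boundary \<Omega> I. h i u)"
  \<comment> \<open>(e)\<close>
    and lam_lower: "mu i0 / \<delta> \<le> lam i0"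
    and bound: "\<And>i. lam i * M i * sup_norm \<Omega> (K i (\<lambda>x\<in>closure \<Omega>. 1))
                     + eta i * hbar i * sup_norm \<Omega> (\<gamma> i) \<le> \<rho> $ i"
  shows "\<exists>u. weak_solution \<Omega> I K \<gamma> lam eta f w h u \<and> nonzero_positive \<Omega> u \<and>
           \<rho>0 \<le> vec_sup_norm \<Omega> u \<and> (\<forall>i. sup_norm \<Omega> (\<lambda>x. u x $ i) \<le> \<rho> $ i)"
proof -
  define D where "D = closure \<Omega>"
  have \<Omega>: "open \<Omega>" "\<Omega> \<noteq> {}" "bounded \<Omega>" using domain by (simp_all add: holder_domain_def)
  have D: "compact D" "D \<noteq> {}" using \<Omega> by (simp_all add: D_def)
  have C_iff: "u \<in> C_space \<Omega> \<longleftrightarrow> u \<in> extensional D \<and> continuous_on D u" for u :: "real^'m \<Rightarrow> real"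
    unfolding D_def by (rule C_space_iff[OF \<Omega>(3)])
  have C_iff': "u \<in> C_space \<Omega> \<longleftrightarrow> u \<in> extensional D \<and> continuous_on D u" for u :: "real^'m \<Rightarrow> real^'n"
    unfolding D_def by (rule C_space_iff[OF \<Omega>(3)])
  have K_lin: "continuous_linear_operator \<Omega> (K i)" for i using K[of i] by (simp add: solution_operator_def)
  note KC = continuous_linear_operator_in_C_space[OF K_lin]
  have K_mono: "K i g x \<le> K i g' x"
    if "g \<in> C_space \<Omega>" "g' \<in> C_space \<Omega>" "\<And>x. x \<in> D \<Longrightarrow> g x \<le> g' x" "x \<in> D" for i g g' x
    using positive_operator_mono[OF \<Omega>(3) K_lin K_pos] that unfolding D_def by blast
  have K_mult: "K i (\<lambda>y\<in>D. c * g y) x = c * K i g x" if "g \<in> C_space \<Omega>" "x \<in> D" for i c g x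
    using K_lin[of i] that unfolding continuous_linear_operator_def D_def by blast
  have K_nonneg: "0 \<le> K i g x" if "g \<in> C_space \<Omega>" "\<And>x. x \<in> D \<Longrightarrow> 0 \<le> g x" "x \<in> D" for i g x
    using K_pos[of i] that unfolding positive_operator_def D_def by blast
  have multC: "(\<lambda>y\<in>D. c * g y) \<in> C_space \<Omega>" if "g \<in> C_space \<Omega>" for c and g :: "real^'m \<Rightarrow> real"
    using C_space_mult[OF \<Omega>(3) that] by (simp add: D_def)

  define one where "one = (\<lambda>x\<in>D. 1 :: real)"
  have oneC: "one \<in> C_space \<Omega>" by (auto simp: C_iff one_def)
  have \<gamma>C: "\<gamma> i \<in> C_space \<Omega>" for i
    using gamma[of i] by (simp add: unique_classical_solution_def classical_solution_def)
  have \<gamma>_nonneg: "0 \<le> \<gamma> i x" if "x \<in> D" for i x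
  proof (rule classical_solution_nonneg[OF muh(1) domain coeffs field bcoeffs])
    \<comment> \<open>The constant 1 is Hoelder continuous, so \<open>K i one\<close> is a genuine
      classical solution and can serve as the strict perturbation in the maximum principle.\<close>
    have "holder_on muh (closure \<Omega>) one"
      unfolding holder_on_def by (intro exI[of _ 0]) (auto simp: one_def D_def)
    then have "classical_solution muh \<Omega> (L i) (B i) one (\<lambda>x. 0) (K i one)"
      using K[of i] oneC by (simp add: solution_operator_def unique_classical_solution_def)
    moreover have "one x = 1" if "x \<in> \<Omega>" for x using that closure_subset by (auto simp: one_def D_def)
    ultimately show "classical_solution muh \<Omega> (elliptic_op (a2 i) (a1 i) (a0 i)) (boundary_op \<nu> (b i) (d i))
        (\<lambda>x. 1) (\<lambda>x. 0) (K i one)"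
      by (simp add: classical_solution_def L_def B_def)
    show "classical_solution muh \<Omega> (elliptic_op (a2 i) (a1 i) (a0 i)) (boundary_op \<nu> (b i) (d i))
        (\<lambda>x. 0) (\<zeta> i) (\<gamma> i)"
      using gamma[of i] by (simp add: unique_classical_solution_def L_def B_def)
  qed (use zeta_nonneg that in \<open>auto simp: D_def\<close>)

  have I_box: "I = cbox 0 \<rho>" by (auto simp: I_def mem_box_cart)
  have I: "compact I" "convex I" "closed I" by (simp_all add: I_box closed_cbox compact_cbox)
  have I_nonneg: "I \<subseteq> {v. \<forall>i. 0 \<le> v $ i}" by (auto simp: I_def)
  define P where "P = P_set \<Omega> I"
  have P_iff: "u \<in> P \<longleftrightarrow> u \<in> extensional D \<and> continuous_on D u \<and> (\<forall>x\<in>D. \<forall>i. 0 \<le> u x $ i \<and> u x $ i \<le> \<rho> $ i)" for u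
    by (auto simp: P_def P_set_def C_iff' I_def D_def)
  have PC: "u \<in> C_space \<Omega>" if "u \<in> P" for u using that by (simp add: P_def P_set_def)
  have w_range: "w i u \<in> {wlo i..whi i}" if "u \<in> P" for i u
    using that cINF_lower[OF w_below] cSUP_upper[OF _ w_above] by (simp add: wlo_def whi_def P_def)
  define F where "F i u = superposition \<Omega> (f i) (w i) u" for i u
  have FC: "F i u \<in> C_space \<Omega>" if "u \<in> P" for i u
    unfolding F_def using superposition_in_C_space[OF \<Omega>(3) _ f_cont w_range] that by (simp add: P_def)
  have F_eq: "F i u x = f i (x, u x, w i u)" if "x \<in> D" for i u x
    using that by (simp add: F_def superposition_def D_def)
  have F_arg: "(x, u x, w i u) \<in> closure \<Omega> \<times> I \<times> {wlo i..whi i}" if "u \<in> P" "x \<in> D" for i u x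
    using that w_range[of u i] by (simp add: P_def P_set_def D_def)
  have F_nonneg: "0 \<le> F i u x" if "u \<in> P" "x \<in> D" for i u x
    using f_nonneg[OF F_arg[OF that]] F_eq[OF that(2)] by simp
  have F_le: "F i u x \<le> M i" if "u \<in> P" "x \<in> D" for i u x
    unfolding F_def M_def using that w_range
    by (intro superposition_le_SUP[OF \<Omega>(3) I(1) compact_Icc f_cont]) (simp_all add: P_def D_def del: atLeastAtMost_iff)

  obtain \<phi> where \<phi>C: "\<phi> \<in> C_space \<Omega>" and \<phi>_nonneg: "\<And>x. x \<in> D \<Longrightarrow> 0 \<le> \<phi> x"
    and \<phi>_eq: "\<And>x. x \<in> D \<Longrightarrow> \<phi> x = mu i0 * K i0 \<phi> x" and "\<exists>x\<in>D. \<phi> x \<noteq> 0"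
    using eigenfunction[of i0] unfolding D_def by blast
  then obtain z where z: "z \<in> D" "\<phi> z > 0" by (metis less_eq_real_def)
  have mu_pos: "0 < mu i0" using radius[of i0] by (simp add: mu_def principal_value_def)

  define s where "s u = max 0 (\<rho>0 - vec_sup_norm \<Omega> u)" for u :: "real^'m \<Rightarrow> real^'n"
  define p where "p i = (if i = i0 then \<phi> else (\<lambda>x\<in>D. 0))" for i
  define T where "T i u x = lam i * K i (F i u) x + eta i * h i u * \<gamma> i x" for i u x
  have h_nn: "0 \<le> h i u" if "u \<in> P" for i u using h_nonneg that by (simp add: P_def)
  have "\<exists>u\<in>P. \<forall>x\<in>D. \<forall>i. u x $ i = min (T i u x + s u * p i x) (\<rho> $ i)"
    unfolding P_def D_def T_def F_def s_def
  proof (rule truncated_fixed_point[where W = "\<lambda>i. {wlo i..whi i}" and \<rho> = \<rho>, folded I_def];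
      (intro \<Omega> K_lin K_compact K_pos \<gamma>C lam eta rho rho0(1) w_cont compact_Icc f_cont h_cont h_bounded)?)
    show "0 \<le> \<gamma> i x" if "x \<in> closure \<Omega>" for i x using \<gamma>_nonneg that by (simp add: D_def)
    show "p i \<in> C_space \<Omega>" for i using \<phi>C by (simp add: p_def C_iff)
    show "0 \<le> p i x" if "x \<in> closure \<Omega>" for i x using \<phi>_nonneg that by (simp add: p_def D_def)
    show "w i u \<in> {wlo i..whi i}" if "u \<in> P_set \<Omega> I" for i u using w_range that by (simp add: P_def)
    show "0 \<le> f i z" if "z \<in> closure \<Omega> \<times> I \<times> {wlo i..whi i}" for i z using f_nonneg that by blast
    show "0 \<le> h i u" if "u \<in> P_set \<Omega> I" for i u using h_nonneg that by blast
  qed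
  then obtain u where u: "u \<in> P" and u_eq: "\<And>x i. x \<in> D \<Longrightarrow> u x $ i = min (T i u x + s u * p i x) (\<rho> $ i)"
    by blast
  have "\<rho>0 \<le> vec_sup_norm \<Omega> u"
  proof (rule ccontr)
    assume "\<not> \<rho>0 \<le> vec_sup_norm \<Omega> u"
    then have lt: "vec_sup_norm \<Omega> u < \<rho>0" and s_pos: "0 < s u" by (simp_all add: s_def)
    have small: "0 \<le> u x $ i" "u x $ i < \<rho>0" if "x \<in> D" for x i
      using abs_le_vec_sup_norm[OF \<Omega>(3) PC[OF u], of x i] that lt u by (auto simp: D_def[symmetric] P_iff)
    \<comment> \<open>This serves twice: it gives \<open>I0 \<subseteq> I\<close>, so that the
      extrema of \<open>w i0\<close> over the small box are taken over a bounded set, and it keeps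
      \<open>u\<close> strictly below the cap.\<close>
    have \<rho>0_lt: "\<rho>0 < \<rho> $ i" for i
      by (rule less_le_trans[OF rho0(2)]) (auto intro: Min_le)
    have "v \<in> I" if "v \<in> I0" for v
      unfolding I_def
    proof (intro CollectI allI)
      fix i
      have "v $ i \<in> {0..\<rho>0}" using that by (simp add: I0_def)
      then show "v $ i \<in> {0..\<rho> $ i}" using \<rho>0_lt[of i] by simp
    qed
    then have "P_set \<Omega> I0 \<subseteq> P_set \<Omega> I" by (auto simp: P_set_def)
    then have "bdd_below (w i0 ` P_set \<Omega> I0)" "bdd_above (w i0 ` P_set \<Omega> I0)"
      using bdd_below_mono[OF w_below] bdd_above_mono[OF w_above] by (meson image_mono)+
    moreover have uI0: "u \<in> P_set \<Omega> I0"
      using PC[OF u] small by (auto simp: P_set_def I0_def D_def[symmetric] less_imp_le)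
    ultimately have w0: "w i0 u \<in> {wlo0..whi0}"
      using cINF_lower[of "w i0"] cSUP_upper[of u _ "w i0"] by (simp add: wlo0_def whi0_def)
    define v where "v = (\<lambda>x\<in>D. u x $ i0)"
    have vC: "v \<in> C_space \<Omega>" using u by (auto simp: C_iff P_iff v_def intro!: continuous_intros)
    have v_eq: "v x = u x $ i0" if "x \<in> D" for x using that by (simp add: v_def)
    have v_ge: "mu i0 * K i0 v x + s u * \<phi> x \<le> v x" if x: "x \<in> D" for x
    proof -
      have "\<delta> * K i0 v x = K i0 (\<lambda>y\<in>D. \<delta> * v y) x" by (rule K_mult[OF vC x, symmetric])
      also have "\<dots> \<le> K i0 (F i0 u) x"
      proof (rule K_mono[OF multC[OF vC] FC[OF u] _ x])
        fix y assume y: "y \<in> D"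
        then have "\<delta> * u y $ i0 \<le> f i0 (y, u y, w i0 u)"
          using f_lower[of y "u y" "w i0 u"] w0 uI0 by (simp add: D_def P_set_def)
        then show "(\<lambda>y\<in>D. \<delta> * v y) y \<le> F i0 u y" using y by (simp add: F_eq v_eq)
      qed
      finally have 1: "\<delta> * K i0 v x \<le> K i0 (F i0 u) x" .
      have "0 \<le> K i0 v x" by (rule K_nonneg[OF vC _ x]) (simp add: v_eq small)
      moreover have "mu i0 \<le> lam i0 * \<delta>" using lam_lower delta by (simp add: field_simps)
      ultimately have "mu i0 * K i0 v x \<le> lam i0 * \<delta> * K i0 v x" by (rule mult_right_mono[rotated])
      also have "\<dots> \<le> lam i0 * K i0 (F i0 u) x"
        using mult_left_mono[OF 1 lam[of i0]] by (simp add: mult.assoc)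
      also have "\<dots> \<le> T i0 u x"
        unfolding T_def using mult_nonneg_nonneg[OF mult_nonneg_nonneg[OF eta h_nn[OF u]] \<gamma>_nonneg[OF x]] by simp
      \<comment> \<open>Since \<open>u x $ i0\<close> is strictly below \<open>\<rho> $ i0\<close>,
        the minimum is its first argument.\<close>
      finally show ?thesis using u_eq[OF x, of i0] small(2)[OF x, of i0] \<rho>0_lt[of i0]
        by (simp add: v_eq[OF x] p_def)
    qed
    \<comment> \<open>Applying \<open>mu i0 * K i0\<close> to \<open>n * s u * \<phi>\<close>
      reproduces it, and \<open>v_ge\<close> contributes one further
      \<open>s u * \<phi>\<close>.\<close>
    have iter: "real n * s u * \<phi> x \<le> v x" if "x \<in> D" for n x
      using that
    proof (induction n arbitrary: x)
      case 0
      then show ?case by (simp add: v_eq small)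
    next
      case (Suc n)
      have "K i0 (\<lambda>y\<in>D. real n * s u * \<phi> y) x \<le> K i0 v x"
        by (rule K_mono[OF multC[OF \<phi>C] vC _ Suc.prems]) (simp add: Suc.IH)
      then have "real n * s u * K i0 \<phi> x \<le> K i0 v x"
        by (simp add: K_mult[OF \<phi>C Suc.prems])
      then have "mu i0 * (real n * s u * K i0 \<phi> x) \<le> mu i0 * K i0 v x"
        using mu_pos by (intro mult_left_mono) auto
      also have "mu i0 * (real n * s u * K i0 \<phi> x) = real n * s u * \<phi> x"
        using \<phi>_eq[OF Suc.prems] by (simp add: mult_ac)
      finally show ?case using v_ge[OF Suc.prems] by (simp add: algebra_simps)
    qed
    obtain n where "v z < real n * (s u * \<phi> z)"
      using reals_Archimedean3[of "s u * \<phi> z"] s_pos z(2) by auto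
    then show False using iter[OF z(1), of n] by (simp add: mult.assoc)
  qed
  then have s0: "s u = 0" by (simp add: s_def)
  have T_le: "T i u x \<le> \<rho> $ i" if "x \<in> D" for i x
  proof (rule ccontr)
    assume "\<not> T i u x \<le> \<rho> $ i"
    then have "u x $ i = \<rho> $ i" using u_eq[OF that, of i] s0 by simp
    \<comment> \<open>The cap is attained at \<open>x\<close>, so any multiple of \<open>u\<close>
      by a factor above 1 leaves the box there. This gives access to \<open>hbar\<close>, which
      controls \<open>h\<close> on the boundary only.\<close>
    have "u \<in> P_boundary \<Omega> I"
    proof (rule P_boundaryI[OF u[unfolded P_def] I_nonneg \<Omega>(3)])
      show "x \<in> closure \<Omega>" using that by (simp add: D_def)
      show "t *\<^sub>R u x \<notin> I" if "1 < t" for t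
      proof
        assume "t *\<^sub>R u x \<in> I"
        then have "t * \<rho> $ i \<le> \<rho> $ i" using \<open>u x $ i = \<rho> $ i\<close> unfolding I_def by (metis (mono_tags) atLeastAtMost_iff mem_Collect_eq vector_scaleR_component real_scaleR_def)
        then show False using rho[of i] that by simp
      qed
    qed
    then have "h i u \<le> hbar i"
      unfolding hbar_def
      by (rule cSUP_upper) (rule bdd_above_mono[OF h_bounded image_mono[OF P_boundary_subset[OF I(3)]]])
    have K1: "K i one x \<le> sup_norm \<Omega> (K i one)"
      using sup_norm_bound[OF \<Omega>(3) KC[OF oneC], of x i] that by (simp add: D_def)
    \<comment> \<open>Nonnegativity of \<open>M i\<close> is read off from a value of
      \<open>F i u\<close>; it is needed to multiply the bound on \<open>K i one\<close>.\<close>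
    have M0: "0 \<le> M i" using F_nonneg[OF u that, of i] F_le[OF u that, of i] by linarith
    have "K i (F i u) x \<le> K i (\<lambda>y\<in>D. M i * one y) x"
      by (rule K_mono[OF FC[OF u] multC[OF oneC] _ that]) (simp add: one_def F_le[OF u])
    also have "\<dots> = M i * K i one x" by (rule K_mult[OF oneC that])
    also have "\<dots> \<le> M i * sup_norm \<Omega> (K i one)" by (rule mult_left_mono[OF K1 M0])
    finally have 1: "lam i * K i (F i u) x \<le> lam i * (M i * sup_norm \<Omega> (K i one))"
      by (rule mult_left_mono[OF _ lam])
    have "\<gamma> i x \<le> sup_norm \<Omega> (\<gamma> i)"
      using sup_norm_bound[OF \<Omega>(3) \<gamma>C, of x i] that by (simp add: D_def)
    then have "eta i * h i u * \<gamma> i x \<le> eta i * hbar i * sup_norm \<Omega> (\<gamma> i)"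
      using \<open>h i u \<le> hbar i\<close> eta[of i] h_nn[OF u, of i] \<gamma>_nonneg[OF that, of i]
      by (intro mult_mono mult_left_mono mult_nonneg_nonneg) auto
    with 1 bound[of i] have "T i u x \<le> \<rho> $ i"
      unfolding T_def one_def D_def by (simp add: mult.assoc)
    then show False using \<open>\<not> T i u x \<le> \<rho> $ i\<close> by simp
  qed
  have u_T: "u x $ i = T i u x" if "x \<in> D" for i x
    using u_eq[OF that, of i] T_le[OF that, of i] s0 by simp
  show ?thesis
  proof (intro exI conjI allI)
    show "weak_solution \<Omega> I K \<gamma> lam eta f w h u"
      using u u_T unfolding weak_solution_def P_def T_def F_def D_def by blast
    show "nonzero_positive \<Omega> u"
    proof -
      have "\<exists>j. \<exists>x\<in>D. u x $ j \<noteq> 0"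
      proof (rule ccontr)
        assume "\<not> ?thesis"
        then have "vec_sup_norm \<Omega> u \<le> 0" by (intro vec_sup_norm_le[OF \<Omega>(2)]) (simp add: D_def)
        then show False using \<open>\<rho>0 \<le> vec_sup_norm \<Omega> u\<close> rho0(1) by simp
      qed
      then show ?thesis using u by (auto simp: nonzero_positive_def P_iff D_def)
    qed
    show "\<rho>0 \<le> vec_sup_norm \<Omega> u" by fact
    show "sup_norm \<Omega> (\<lambda>x. u x $ i) \<le> \<rho> $ i" for i
      unfolding sup_norm_def using D(2) u by (intro cSUP_least) (auto simp: P_iff D_def[symmetric])
  qed
qed

end
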